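(* Let $G$ be a finite graph (parallel edges allowed, no loops) and let $d$ and $k$ be positive integers. Define the fractional arboricity $\gamma(G) = \max_{H \subseteq G,\, v(H) \geq 2} \frac{e(H)}{v(H)-1}$, where $e(H)=|E(H)|$ and $v(H)=|V(H)|$. If $\gamma(G) \leq k + \frac{d}{d+k+1}$, then there is a partition of $E(G)$ into $k+1$ forests such that in one of these forests every connected component has at most \[ d + \left\lceil k\left(\left\lceil \tfrac{d}{k+1}\right\rceil - 1\right)\left(\frac{d}{k+1} - \frac{1}{2}\left\lceil \tfrac{d}{k+1}\right\rceil\right)\right\rceil \] edges.
   Context: Graphs may have parallel edges but no loops. The maximum in the definition of $\gamma(G)$ ranges over all subgraphs $H$ of $G$ with at least two vertices. *)

theory Defs
  imports Complex_Main
begin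

definition multigraph :: "'v set \<Rightarrow> 'e set \<Rightarrow> ('e \<Rightarrow> 'v set) \<Rightarrow> bool" where
  "multigraph V E ends \<longleftrightarrow> finite V \<and> finite E \<and>
     (\<forall>e\<in>E. ends e \<subseteq> V \<and> card (ends e) = 2)"

definition frac_arboricity :: "'v set \<Rightarrow> 'e set \<Rightarrow> ('e \<Rightarrow> 'v set) \<Rightarrow> real" where
  "frac_arboricity V E ends = Max {real (card F) / (real (card W) - 1) | W F.
      W \<subseteq> V \<and> F \<subseteq> E \<and> (\<forall>e\<in>F. ends e \<subseteq> W) \<and> card W \<ge> 2}"

text \<open>A cycle in the edge set F: n \<ge> 2 distinct vertices and n distinct edges,
  edge i joining vertex i and vertex i+1 (mod n). Length-2 cycles are pairs of
  parallel edges.\<close>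
definition has_cycle :: "'e set \<Rightarrow> ('e \<Rightarrow> 'v set) \<Rightarrow> bool" where
  "has_cycle F ends \<longleftrightarrow> (\<exists>vs es. length vs = length es \<and> length vs \<ge> 2 \<and>
      distinct vs \<and> distinct es \<and> set es \<subseteq> F \<and>
      (\<forall>i<length vs. ends (es ! i) = {vs ! i, vs ! ((i + 1) mod length vs)}))"

definition is_forest :: "'e set \<Rightarrow> ('e \<Rightarrow> 'v set) \<Rightarrow> bool" where
  "is_forest F ends \<longleftrightarrow> \<not> has_cycle F ends"

definition adj_rel :: "'e set \<Rightarrow> ('e \<Rightarrow> 'v set) \<Rightarrow> ('v \<times> 'v) set" where
  "adj_rel F ends = {(u, v). \<exists>e\<in>F. ends e = {u, v}}"

definition components :: "'v set \<Rightarrow> 'e set \<Rightarrow> ('e \<Rightarrow> 'v set) \<Rightarrow> 'v set set" where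
  "components V F ends = {{u \<in> V. (v, u) \<in> (adj_rel F ends)\<^sup>*} | v. v \<in> V}"

definition comp_edges :: "'e set \<Rightarrow> ('e \<Rightarrow> 'v set) \<Rightarrow> 'v set \<Rightarrow> 'e set" where
  "comp_edges F ends C = {e \<in> F. ends e \<subseteq> C}"

end

theory Submission
  imports Defs
begin

text \<open>Allowing virtual edges, start from k edge-disjoint spanning trees (blue) together with a red
  forest, covering all edges. If every such decomposition has a too large red component, minimise
  the largest size M of a red component, then the number of components of this size, and then,
  lexicographically, the sizes in a list of red components that starts with a component of size
  M containing the root r and continues along blue arcs directed towards r. Any cyclic exchange along blue
  trees that moves a red edge of the list into a blue tree shrinks a member of the list, so that it
  must create a larger component elsewhere. Hence no virtual arc leaves the list; and if m arcs of
  one blue tree lead from a component K of the list to small components, then exchanging all of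
  them at once against edges of K shows that one of these small components has at least m - 1
  edges more than K lacks to the maximal size. The small components reached from K through one
  tree therefore form a staircase, their total deficit against the average d / (k + 1) is
  compensated by K, and the subgraph spanned by the list is denser than the fractional
  arboricity allows. The same augmentations, applied to k + 1 blue trees and a single red edge,
  give the initial decomposition.\<close>

section \<open>Connectivity and arcs of rooted forests\<close>

text \<open>Exchanging one arc at a time bounds the size of each small component at
  \<open>K\<close>, but not their number. With m arcs exchanged at once, each piece of
  \<open>K\<close> misses the m - 1 other terminals (tails of the exchanged arcs) and is smaller by
  that much. The obstacle is that the same red edges of \<open>K\<close> must separate the terminals
  and rejoin the blocks into which the blue tree has fallen; an arbitrary cut would close blue
  cycles. Whether \<open>K\<close> supplies m red edges or only m - 1, with one more from an earlier
  member, depends on where the cut-off blocks meet the list. The constant comes from balancing. Let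
  a = d / (k + 1) and let t be its ceiling. Small components with 0, 1, ..., t - 1 edges have
  deficits a, a - 1, ..., a - t + 1, in each of k trees, with sum k a + k (t - 1) (a - t / 2). A
  component with l edges has surplus l - a. As (k + 1) a = d, the surplus suffices once l is at
  least d + k (t - 1) (a - t / 2).\<close>

locale edge_ends =
  fixes ends :: "'a \<Rightarrow> 'v set"
begin

definition conn :: "'a set \<Rightarrow> 'v \<Rightarrow> 'v \<Rightarrow> bool" where
  "conn F u v \<longleftrightarrow> (u, v) \<in> (adj_rel F ends)\<^sup>*"

definition comp :: "'a set \<Rightarrow> 'v \<Rightarrow> 'v set" where
  "comp F v = {u. conn F v u}"

text \<open>Every edge is a bridge. This excludes loops and parallel edges as well and suits forests
  that grow edge by edge; cycles as vertex sequences appear only when the result is translated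
  back.\<close>

definition acyc :: "'a set \<Rightarrow> bool" where
  "acyc F \<longleftrightarrow> (\<forall>e\<in>F. \<forall>p q. ends e = {p, q} \<longrightarrow> \<not> conn (F - {e}) p q)"

text \<open>In a forest this is the edge \<open>b\<close> oriented from \<open>z\<close> to
  \<open>y\<close> along the path of \<open>z\<close> to the root \<open>r\<close>. The direction is
  read off from what deleting \<open>b\<close> does to its ends, so no orientation has to be updated
  when trees change.\<close>

definition arc :: "'v \<Rightarrow> 'a set \<Rightarrow> 'a \<Rightarrow> 'v \<Rightarrow> 'v \<Rightarrow> bool" where
  "arc r A b z y \<longleftrightarrow>
     b \<in> A \<and> ends b = {z, y} \<and> conn (A - {b}) y r \<and> \<not> conn (A - {b}) z r"

lemma conn_refl [simp, intro]: "conn F u u"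
  by (simp add: conn_def)

lemma conn_sym: "conn F u v \<Longrightarrow> conn F v u"
proof -
  assume "conn F u v"
  moreover have "sym (adj_rel F ends)"
    by (auto simp: sym_def adj_rel_def insert_commute)
  ultimately show ?thesis
    unfolding conn_def by (meson sym_rtrancl symD)
qed

lemma conn_commute: "conn F u v \<longleftrightarrow> conn F v u"
  using conn_sym by blast

lemma conn_trans: "conn F u v \<Longrightarrow> conn F v w \<Longrightarrow> conn F u w"
  by (simp add: conn_def)

lemma conn_edge: "e \<in> F \<Longrightarrow> ends e = {u, v} \<Longrightarrow> conn F u v"
  by (auto simp: conn_def adj_rel_def)

lemma conn_least:
  assumes "conn F u v" and refl: "\<And>x. R x x"
    and trans: "\<And>x y z. R x y \<Longrightarrow> R y z \<Longrightarrow> R x z"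
    and edge: "\<And>e p q. e \<in> F \<Longrightarrow> ends e = {p, q} \<Longrightarrow> R p q"
  shows "R u v"
  using assms(1) unfolding conn_def
proof (induction rule: rtrancl_induct)
  case base
  show ?case by (rule refl)
next
  case (step y z)
  then show ?case using trans edge by (auto simp: adj_rel_def)
qed

lemma conn_mono: "conn F u v \<Longrightarrow> F \<subseteq> H \<Longrightarrow> conn H u v"
  by (rule conn_least[where R = "conn H"]) (auto intro: conn_trans conn_edge)

lemma conn_insert:
  assumes b: "ends b = {p, q}"
  shows "conn (insert b F) u v \<longleftrightarrow>
    conn F u v \<or> (conn F u p \<and> conn F q v) \<or> (conn F u q \<and> conn F p v)"
    (is "?L \<longleftrightarrow> ?R u v")
proof
  assume ?L
  then show "?R u v"
  proof (rule conn_least[where R = ?R], goal_cases)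
    case (2 x y z)
    then show ?case by (metis conn_sym conn_trans)
  next
    case (3 e p' q')
    then show ?case using b
      by (auto simp: doubleton_eq_iff intro: conn_edge)
  qed simp
next
  assume "?R u v"
  moreover have "conn (insert b F) p q"
    using b by (auto intro: conn_edge)
  moreover have "\<And>x y. conn F x y \<Longrightarrow> conn (insert b F) x y"
    by (auto intro: conn_mono)
  ultimately show ?L by (meson conn_sym conn_trans)
qed

lemma conn_closed:
  assumes "conn F u v" "u \<in> S"
    and "\<And>e p q. e \<in> F \<Longrightarrow> ends e = {p, q} \<Longrightarrow> p \<in> S \<Longrightarrow> q \<in> S"
  shows "v \<in> S"
  using conn_least[OF assms(1), where R = "\<lambda>x y. x \<in> S \<longrightarrow> y \<in> S"] assms by blast

lemma conn_crossing:
  assumes "conn F u v" "u \<in> S" "v \<notin> S"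
  obtains e p q where "e \<in> F" "ends e = {p, q}" "p \<in> S" "q \<notin> S"
  using conn_closed[OF assms(1,2)] assms(3) by metis

text \<open>The set \<open>S2\<close> grown from \<open>r\<close> without touching \<open>S\<close>
  does not contain \<open>v\<close>. A walk from \<open>r\<close> to \<open>v\<close> leaves it by
  some edge, and that edge must enter \<open>S\<close>, since otherwise it would have extended
  \<open>S2\<close>.\<close>

lemma last_exit:
  assumes "conn T v r" "v \<in> S" "r \<notin> S"
  obtains b s t where "b \<in> T" "ends b = {s, t}" "s \<in> S" "t \<notin> S" "conn {e \<in> T. ends e \<inter> S = {}} t r"
proof -
  define T' where "T' = {e \<in> T. ends e \<inter> S = {}}"
  define S2 where "S2 = {x. conn T' x r}"
  have S2: "x \<notin> S" if "x \<in> S2" for x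
  proof -
    have "conn T' r x" using that conn_sym by (auto simp: S2_def)
    then have "x \<in> - S"
      by (rule conn_closed) (use assms in \<open>auto simp: T'_def\<close>)
    then show ?thesis by simp
  qed
  have "r \<in> S2" by (simp add: S2_def)
  moreover have "v \<notin> S2" using S2 assms by blast
  ultimately obtain e p q where e: "e \<in> T" "ends e = {p, q}" "p \<in> S2" "q \<notin> S2"
    using conn_crossing[OF conn_sym[OF assms(1)]] by metis
  have "q \<in> S"
  proof (rule ccontr)
    assume "q \<notin> S"
    then have "e \<in> T'" using e S2 by (auto simp: T'_def)
    then have "conn T' q p" using e conn_edge conn_sym by metis
    then show False using e by (auto simp: S2_def intro: conn_trans)
  qed
  moreover have "conn T' p r" using e by (auto simp: S2_def)
  ultimately show thesis
    using that[of e q p] e S2 by (auto simp: T'_def insert_commute)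
qed

lemma acycD: "acyc F \<Longrightarrow> e \<in> F \<Longrightarrow> ends e = {p, q} \<Longrightarrow> \<not> conn (F - {e}) p q"
  by (auto simp: acyc_def)

lemma acyc_subset: "acyc F \<Longrightarrow> H \<subseteq> F \<Longrightarrow> acyc H"
  unfolding acyc_def by (meson Diff_mono conn_mono in_mono order_refl)

lemma acyc_insert:
  assumes F: "acyc F" and e: "ends e = {p, q}" and pq: "\<not> conn F p q"
  shows "acyc (insert e F)"
  unfolding acyc_def
proof (intro ballI allI impI notI)
  fix e' p' q'
  assume e': "e' \<in> insert e F" "ends e' = {p', q'}" and c: "conn (insert e F - {e'}) p' q'"
  show False
  proof (cases "e' = e")
    case True
    then have "conn F p' q'" using c by (auto intro: conn_mono)
    then show False using True e e' pq by (auto simp: doubleton_eq_iff conn_commute)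
  next
    case False
    then have e'F: "e' \<in> F" using e' by auto
    have "conn (insert e (F - {e'})) p' q'"
      using c False by (simp add: insert_Diff_if)
    then have "(conn (F - {e'}) p' p \<and> conn (F - {e'}) q q') \<or> (conn (F - {e'}) p' q \<and> conn (F - {e'}) p q')"
      using acycD[OF F e'F e'(2)] by (simp add: conn_insert[OF e])
    moreover have "\<And>x y. conn (F - {e'}) x y \<Longrightarrow> conn F x y"
      by (auto intro: conn_mono)
    moreover have "conn F p' q'" using e'F e' conn_edge by blast
    ultimately have "conn F p q" by (meson conn_sym conn_trans)
    then show False using pq by simp
  qed
qed

lemma comp_self [simp, intro]: "v \<in> comp F v"
  by (simp add: comp_def)

lemma comp_eq: "conn F u v \<Longrightarrow> comp F u = comp F v"
  unfolding comp_def using conn_sym conn_trans by blast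

lemma comp_eqI: "u \<in> comp F v \<Longrightarrow> comp F u = comp F v"
  using comp_eq unfolding comp_def by (metis mem_Collect_eq)

lemma comp_mono: "F \<subseteq> H \<Longrightarrow> comp F v \<subseteq> comp H v"
  unfolding comp_def using conn_mono by blast

lemma arc_exists:
  assumes "acyc A" "conn A x r" "x \<noteq> r"
  obtains b y where "arc r A b x y"
proof -
  obtain b s t where b: "b \<in> A" "ends b = {s, t}" "s \<in> {x}" "t \<notin> {x}"
      "conn {e \<in> A. ends e \<inter> {x} = {}} t r"
    by (rule last_exit[of A x r "{x}"]) (use assms in auto)
  have "conn (A - {b}) t r"
    by (rule conn_mono[OF b(5)]) (use b in auto)
  moreover have "\<not> conn (A - {b}) x t"
    using acycD[OF assms(1) b(1,2)] b(3) by simp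
  then have "\<not> conn (A - {b}) x r"
    using calculation conn_sym conn_trans by meson
  ultimately show thesis using that[of b t] b(1,2,3) unfolding arc_def by simp
qed

text \<open>Suppose the tails stay together. The connection from \<open>y\<close> to
  \<open>r\<close> avoiding \<open>b\<close> may avoid \<open>b'\<close> too, and then
  \<open>z'\<close> reaches \<open>r\<close> through \<open>z\<close> and \<open>b\<close> without
  \<open>b'\<close>; or it uses \<open>b'\<close>, and then \<open>z\<close> reaches
  \<open>r\<close> without \<open>b\<close> by way of \<open>z'\<close>.\<close>

lemma arc_tails_separated:
  assumes b: "arc r A b z y" and b': "arc r A b' z' y'" and ne: "b \<noteq> b'"
  shows "\<not> conn (A - {b, b'}) z z'"
proof
  define A0 where "A0 = A - {b, b'}"
  assume "conn (A - {b, b'}) z z'"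
  then have zz: "conn A0 z z'" by (simp add: A0_def)
  have 1: "A - {b} = insert b' A0" and 2: "A - {b'} = insert b A0"
    using b b' ne by (auto simp: A0_def arc_def)
  have e: "ends b = {z, y}" "ends b' = {z', y'}" using b b' by (auto simp: arc_def)
  have c1: "conn (insert b' A0) y r" "\<not> conn (insert b' A0) z r"
    using b 1 by (auto simp: arc_def)
  have c2: "\<not> conn (insert b A0) z' r"
    using b' 2 by (auto simp: arc_def)
  show False
    using c1 c2 zz unfolding conn_insert[OF e(1)] conn_insert[OF e(2)]
    by (meson conn_sym conn_trans conn_refl)
qed

lemma arc_tail_inj:
  assumes "arc r A b z y" "arc r A b' z y'"
  shows "b = b'"
  using arc_tails_separated[OF assms] by auto

lemma arc_unique:
  assumes "arc r A b z y" "arc r A b z' y'"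
  shows "z = z' \<and> y = y'"
  using assms unfolding arc_def by (auto simp: doubleton_eq_iff)

text \<open>The connection from \<open>z\<close> to \<open>r\<close> inside \<open>A0\<close> must
  run through \<open>b\<close>, so \<open>y\<close> reaches \<open>r\<close> there without
  \<open>b\<close>. In the larger forest \<open>X\<close> another way from \<open>z\<close> to
  \<open>r\<close> would close a cycle with \<open>b\<close>. Hence a tree may be changed freely as
  long as the root paths of the tails in question survive.\<close>

lemma arc_transfer:
  assumes b: "arc r A b z y" and "A0 \<subseteq> A" "b \<in> A0" "conn A0 z r" "A0 \<subseteq> X" "acyc X"
  shows "arc r X b z y"
proof -
  have e: "ends b = {z, y}" using b by (auto simp: arc_def)
  have "\<not> conn (A0 - {b}) z r" using b assms(2) unfolding arc_def
    by (meson Diff_mono conn_mono order_refl)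
  moreover have "conn (insert b (A0 - {b})) z r" using assms by (simp add: insert_absorb)
  ultimately have "conn (A0 - {b}) y r" unfolding conn_insert[OF e] by auto
  then have y: "conn (X - {b}) y r" using assms(5) by (auto intro: conn_mono)
  moreover have "\<not> conn (X - {b}) z r"
    using acycD[OF assms(6) _ e] assms y by (meson conn_sym conn_trans in_mono)
  ultimately show ?thesis using assms e unfolding arc_def by auto
qed

lemma arc_not_deleted:
  assumes "arc r A b z y" "conn (A - B) z r"
  shows "b \<notin> B"
proof
  assume "b \<in> B"
  then have "conn (A - {b}) z r" using assms(2) by (auto intro: conn_mono)
  then show False using assms(1) by (auto simp: arc_def)
qed

lemma acyc_imp_is_forest:
  assumes "acyc F"
  shows "is_forest F ends"
  unfolding is_forest_def has_cycle_def
proof (intro notI, elim exE conjE)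
  fix vs es
  assume len: "length vs = length es" and l2: "2 \<le> length vs" and "distinct vs" "distinct es"
    and F: "set es \<subseteq> F"
    and cyc: "\<forall>i<length vs. ends (es ! i) = {vs ! i, vs ! ((i + 1) mod length vs)}"
  define n where "n = length vs"
  define e where "e = es ! (n - 1)"
  have n: "n - 1 < n" "n \<ge> 2" using l2 by (auto simp: n_def)
  have path: "conn (F - {e}) (vs ! 0) (vs ! i)" if "i < n" for i
    using that
  proof (induction i)
    case (Suc i)
    have "es ! i \<noteq> e"
      using \<open>distinct es\<close> Suc.prems n len by (auto simp: e_def n_def nth_eq_iff_index_eq)
    moreover have "es ! i \<in> F"
      using F Suc.prems len by (auto simp: n_def)
    moreover have "ends (es ! i) = {vs ! i, vs ! Suc i}"
      using cyc[rule_format, of i] Suc.prems by (simp add: n_def)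
    ultimately have "conn (F - {e}) (vs ! i) (vs ! Suc i)"
      by (auto intro: conn_edge)
    then show ?case using Suc conn_trans by auto
  qed simp
  have "e \<in> F" using F len n(1) unfolding e_def n_def by (metis nth_mem subsetD)
  moreover have "ends e = {vs ! (n - 1), vs ! 0}"
  proof -
    have "n - 1 + 1 = length vs" using n(2) unfolding n_def by linarith
    then have "(n - 1 + 1) mod length vs = 0" by simp
    then show ?thesis using cyc n(1) unfolding e_def n_def by metis
  qed
  ultimately show False
    using acycD[OF assms] conn_sym[OF path[OF n(1)]] by blast
qed

text \<open>With the component rooted at \<open>v\<close>, every edge in it is an arc, and sending
  an edge to its tail is injective and never hits \<open>v\<close>.\<close>

lemma card_edges_comp_le:
  assumes F: "acyc F" and fin: "finite (comp F v)" and valid: "\<And>e. e \<in> F \<Longrightarrow> card (ends e) = 2"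
  shows "finite {e \<in> F. ends e \<subseteq> comp F v} \<and> card {e \<in> F. ends e \<subseteq> comp F v} \<le> card (comp F v) - 1"
proof -
  let ?E = "{e \<in> F. ends e \<subseteq> comp F v}"
  have ex: "\<exists>z. z \<in> comp F v - {v} \<and> (\<exists>y. arc v F e z y)" if e: "e \<in> ?E" for e
  proof -
    have "card (ends e) = 2" using valid e by simp
    then obtain p q where pq: "ends e = {p, q}" by (auto simp: card_2_iff)
    have n: "\<not> conn (F - {e}) p q" using acycD[OF F _ pq] e by auto
    have "conn (insert e (F - {e})) p v"
      using e pq conn_sym by (auto simp: comp_def insert_absorb)
    then consider "conn (F - {e}) p v" | "conn (F - {e}) q v"
      unfolding conn_insert[OF pq] by blast
    then have "arc v F e p q \<or> arc v F e q p"
    proof cases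
      case 1
      then have "\<not> conn (F - {e}) q v" using n conn_sym conn_trans by meson
      then show ?thesis using 1 e pq by (auto simp: arc_def insert_commute)
    next
      case 2
      then have "\<not> conn (F - {e}) p v" using n conn_sym conn_trans by meson
      then show ?thesis using 2 e pq by (auto simp: arc_def)
    qed
    moreover have "p \<in> comp F v" "q \<in> comp F v" using e pq by auto
    moreover have "x \<noteq> v" if "arc v F e x y" for x y using that by (auto simp: arc_def)
    ultimately show ?thesis by auto
  qed
  define t where "t e = (SOME z. z \<in> comp F v - {v} \<and> (\<exists>y. arc v F e z y))" for e
  have t: "t e \<in> comp F v - {v} \<and> (\<exists>y. arc v F e (t e) y)" if "e \<in> ?E" for e
    unfolding t_def using someI_ex[OF ex[OF that]] .
  have inj: "inj_on t ?E"
  proof (rule inj_onI)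
    fix e e' assume "e \<in> ?E" "e' \<in> ?E" "t e = t e'"
    then show "e = e'" using t[of e] t[of e'] arc_tail_inj by metis
  qed
  have sub: "t ` ?E \<subseteq> comp F v - {v}" using t by auto
  have "finite ?E" using inj_on_finite[OF inj sub] fin by auto
  moreover have "card ?E \<le> card (comp F v - {v})"
    using card_inj_on_le[OF inj sub] fin by auto
  ultimately show ?thesis using fin by auto
qed

text \<open>The converse count: each vertex of \<open>S\<close> other than the root is sent to the
  arc leaving it, and closure keeps that arc inside \<open>S\<close>.\<close>

lemma card_edges_within_ge:
  assumes A: "acyc A" "finite A" and S: "finite S" "r \<in> S"
    and con: "\<And>x. x \<in> S \<Longrightarrow> conn A x r"
    and cl: "\<And>b x y. arc r A b x y \<Longrightarrow> x \<in> S \<Longrightarrow> y \<in> S"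
  shows "card S - 1 \<le> card {e \<in> A. ends e \<subseteq> S}"
proof -
  have ex: "\<exists>b y. arc r A b x y" if "x \<in> S - {r}" for x
    by (rule arc_exists[OF A(1) con]) (use that in auto)
  define t where "t x = (SOME b. \<exists>y. arc r A b x y)" for x
  have t: "\<exists>y. arc r A (t x) x y" if "x \<in> S - {r}" for x
    unfolding t_def using someI_ex[OF ex[OF that]] .
  have inj: "inj_on t (S - {r})"
  proof (rule inj_onI)
    fix x x' assume "x \<in> S - {r}" "x' \<in> S - {r}" "t x = t x'"
    then show "x = x'" using t[of x] t[of x'] arc_unique by metis
  qed
  have sub: "t ` (S - {r}) \<subseteq> {e \<in> A. ends e \<subseteq> S}"
  proof
    fix b assume "b \<in> t ` (S - {r})"
    then obtain x where x: "x \<in> S - {r}" "b = t x" by blast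
    then obtain y where "x \<in> S" "arc r A b x y" using t by blast
    then show "b \<in> {e \<in> A. ends e \<subseteq> S}" using cl by (auto simp: arc_def)
  qed
  have "card (S - {r}) \<le> card {e \<in> A. ends e \<subseteq> S}"
    using card_inj_on_le[OF inj sub] A by auto
  then show ?thesis using S by auto
qed

end

section \<open>Lists of red components and augmentations\<close>

context edge_ends
begin

text \<open>Each new member is entered at the head of an arc whose tail lies in the earlier members.
  So a list survives every change of the blue trees that keeps the arcs with tails in it, and every
  change of the red forest that keeps its members.\<close>

inductive legal :: "'v \<Rightarrow> nat \<Rightarrow> (nat \<Rightarrow> 'a set) \<Rightarrow> 'a set \<Rightarrow> 'v set list \<Rightarrow> bool"
  for r k T F where
  root: "legal r k T F [comp F r]"
| step: "\<lbrakk>legal r k T F L; i < k; z \<in> \<Union>(set L); arc r (T i) b z y; y \<notin> \<Union>(set L)\<rbrakk>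
    \<Longrightarrow> legal r k T F (L @ [comp F y])"

lemma legal_nonempty: "legal r k T F L \<Longrightarrow> L \<noteq> [] \<and> hd L = comp F r"
  by (induction rule: legal.induct) auto

lemma legal_root_mem: "legal r k T F L \<Longrightarrow> r \<in> \<Union>(set L)"
  using legal_nonempty comp_self by (metis UnionI hd_in_set)

lemma legal_members: "legal r k T F L \<Longrightarrow> R \<in> set L \<Longrightarrow> \<exists>v. R = comp F v"
  by (induction rule: legal.induct) auto

lemma legal_closed:
  assumes "legal r k T F L" "x \<in> \<Union>(set L)"
  shows "comp F x \<in> set L"
proof -
  obtain R where R: "R \<in> set L" "x \<in> R" using assms by auto
  then obtain v where "R = comp F v" using legal_members[OF assms(1)] by auto
  then show ?thesis using R comp_eqI by metis
qed

lemma legal_comp_disjoint: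
  assumes "legal r k T F L" "y \<notin> \<Union>(set L)"
  shows "comp F y \<inter> \<Union>(set L) = {}"
proof (rule ccontr)
  assume "comp F y \<inter> \<Union>(set L) \<noteq> {}"
  then obtain x where x: "x \<in> comp F y" "x \<in> \<Union>(set L)" by auto
  then have "comp F y \<in> set L" using legal_closed[OF assms(1)] comp_eqI by metis
  then show False using assms(2) by auto
qed

lemma legal_disjoint: "legal r k T F L \<Longrightarrow> sorted_wrt (\<lambda>A B. A \<inter> B = {}) L"
proof (induction rule: legal.induct)
  case (step L i z b y)
  then show ?case
    using legal_comp_disjoint[OF step.hyps(1,5)] by (auto simp: sorted_wrt_append)
qed simp

lemma legal_prefix:
  assumes "legal r k T F (L0 @ L1)" "L0 \<noteq> []"
  shows "legal r k T F L0"
  using assms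
proof (induction "L0 @ L1" arbitrary: L1 rule: legal.induct)
  case root
  then show ?case by (metis append_Nil2 append_eq_Cons_conv append_is_Nil_conv legal.root)
next
  case (step L i z b y)
  show ?case
  proof (cases L1 rule: rev_cases)
    case Nil
    then show ?thesis using step legal.step by (metis append_Nil2)
  next
    case (snoc L2 R)
    then show ?thesis using step by auto
  qed
qed

lemma legal_transfer:
  assumes "legal r k T F L"
    and "\<And>i b z y. i < k \<Longrightarrow> arc r (T i) b z y \<Longrightarrow> z \<in> \<Union>(set L) \<Longrightarrow> arc r (T2 i) b z y"
    and "\<And>v. v \<in> \<Union>(set L) \<Longrightarrow> comp F2 v = comp F v"
  shows "legal r k T2 F2 L"
  using assms
proof (induction rule: legal.induct)
  case root
  have "comp F2 r = comp F r" using root by simp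
  then show ?case using legal.root by metis
next
  case (step L i z b y)
  have "legal r k T2 F2 L" using step by simp
  moreover have "arc r (T2 i) b z y" using step by auto
  ultimately have "legal r k T2 F2 (L @ [comp F2 y])"
    using legal.step[of r k T2 F2 L i z b y] step.hyps by simp
  moreover have "comp F2 y = comp F y" using step.prems(2)[of y] by simp
  ultimately show ?case by simp
qed

lemma legal_entry:
  assumes "legal r k T F (L0 @ R # L1)"
  obtains w where "R = comp F w" "w \<notin> \<Union>(set L0)"
    "(L0 = [] \<and> w = r) \<or> (legal r k T F L0 \<and> (\<exists>i b z. i < k \<and> z \<in> \<Union>(set L0) \<and> arc r (T i) b z w))"
proof -
  have l: "legal r k T F (L0 @ [R])" using legal_prefix[of r k T F "L0 @ [R]" L1] assms by simp
  then show thesis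
  proof (cases rule: legal.cases)
    case root
    then show thesis using that[of r] by auto
  next
    case (step L i z b y)
    then have "L = L0" "R = comp F y" by auto
    then show thesis using that[of y] step by blast
  qed
qed

text \<open>Only the entry vertex \<open>w\<close> of the last member matters for legality. After a
  change that spares the earlier members, whatever red component then contains \<open>w\<close> may
  take the last place.\<close>

lemma legal_replace:
  assumes "(L0 = [] \<and> w = r) \<or> (legal r k T F L0 \<and> (\<exists>i b z. i < k \<and> z \<in> \<Union>(set L0) \<and> arc r (T i) b z w))"
    and "w \<notin> \<Union>(set L0)"
    and arcs: "\<And>i b z y. i < k \<Longrightarrow> arc r (T i) b z y \<Longrightarrow> z \<in> \<Union>(set L0) \<Longrightarrow> arc r (T2 i) b z y"
    and comps: "\<And>v. v \<in> \<Union>(set L0) \<Longrightarrow> comp F2 v = comp F v"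
  shows "legal r k T2 F2 (L0 @ [comp F2 w])"
  using assms(1)
proof
  assume "L0 = [] \<and> w = r"
  then show ?thesis using legal.root by auto
next
  assume *: "legal r k T F L0 \<and> (\<exists>i b z. i < k \<and> z \<in> \<Union>(set L0) \<and> arc r (T i) b z w)"
  then have "legal r k T2 F2 L0" using legal_transfer arcs comps by blast
  then show ?thesis using * arcs assms(2) by (meson legal.step)
qed

end

section \<open>Families of blue trees and chains of augmentations\<close>

locale multigr = edge_ends ends for ends :: "'a \<Rightarrow> 'v set" +
  fixes V :: "'v set" and G :: "'a set"
  assumes finV: "finite V" and finG: "finite G"
    and ends_V: "\<And>e. e \<in> G \<Longrightarrow> ends e \<subseteq> V"
    and ends_2: "\<And>e. e \<in> G \<Longrightarrow> card (ends e) = 2"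
begin

lemma edge_obtain:
  assumes "e \<in> G"
  obtains p q where "ends e = {p, q}" "p \<in> V" "q \<in> V" "p \<noteq> q"
  using ends_V[OF assms] ends_2[OF assms] by (auto simp: card_2_iff)

lemma conn_V: "conn F u v \<Longrightarrow> F \<subseteq> G \<Longrightarrow> u \<in> V \<Longrightarrow> v \<in> V"
  by (rule conn_closed) (use ends_V in auto)

lemma comp_V: "F \<subseteq> G \<Longrightarrow> v \<in> V \<Longrightarrow> comp F v \<subseteq> V"
  using conn_V conn_sym unfolding comp_def by blast

definition trees :: "nat \<Rightarrow> (nat \<Rightarrow> 'a set) \<Rightarrow> bool" where
  "trees k T \<longleftrightarrow> (\<forall>i<k. T i \<subseteq> G \<and> acyc (T i) \<and> (\<forall>u\<in>V. \<forall>v\<in>V. conn (T i) u v)) \<and>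
     (\<forall>i<k. \<forall>j<k. i \<noteq> j \<longrightarrow> T i \<inter> T j = {})"

text \<open>All members of the family are spanning trees, except that the i-th one has lost an
  edge: U is the part of it that does not contain the root.\<close>
definition near :: "'v \<Rightarrow> nat \<Rightarrow> (nat \<Rightarrow> 'a set) \<Rightarrow> nat \<Rightarrow> 'v set \<Rightarrow> bool" where
  "near r k T i U \<longleftrightarrow> i < k \<and> r \<in> V \<and> (\<forall>j<k. T j \<subseteq> G \<and> acyc (T j)) \<and>
     (\<forall>j<k. j \<noteq> i \<longrightarrow> (\<forall>u\<in>V. \<forall>v\<in>V. conn (T j) u v)) \<and>
     U = {v\<in>V. \<not> conn (T i) v r} \<and> (\<forall>u\<in>U. \<forall>v\<in>U. conn (T i) u v) \<and>
     (\<forall>j<k. \<forall>l<k. j \<noteq> l \<longrightarrow> T j \<inter> T l = {})"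

lemma nearD:
  assumes "near r k T i U"
  shows "i < k" "r \<in> V" "U = {v\<in>V. \<not> conn (T i) v r}"
    "\<And>u v. u \<in> U \<Longrightarrow> v \<in> U \<Longrightarrow> conn (T i) u v"
    "\<And>j. j < k \<Longrightarrow> T j \<subseteq> G" "\<And>j. j < k \<Longrightarrow> acyc (T j)"
    "\<And>j u v. j < k \<Longrightarrow> j \<noteq> i \<Longrightarrow> u \<in> V \<Longrightarrow> v \<in> V \<Longrightarrow> conn (T j) u v"
    "\<And>j l. j < k \<Longrightarrow> l < k \<Longrightarrow> j \<noteq> l \<Longrightarrow> T j \<inter> T l = {}"
    "r \<notin> U"
  using assms unfolding near_def by blast+

lemma treesD:
  assumes "trees k T"
  shows "\<And>j. j < k \<Longrightarrow> T j \<subseteq> G" "\<And>j. j < k \<Longrightarrow> acyc (T j)"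
    "\<And>j u v. j < k \<Longrightarrow> u \<in> V \<Longrightarrow> v \<in> V \<Longrightarrow> conn (T j) u v"
    "\<And>j l. j < k \<Longrightarrow> l < k \<Longrightarrow> j \<noteq> l \<Longrightarrow> T j \<inter> T l = {}"
  using assms unfolding trees_def by blast+

lemma near_insert:
  assumes N: "near r k T i U" and e: "ends e = {p, q}" "e \<in> G" "p \<notin> U" "q \<in> U"
    and new: "\<And>j. j < k \<Longrightarrow> e \<notin> T j"
  shows "trees k (T(i := insert e (T i)))"
proof -
  have pV: "p \<in> V" "q \<in> V" using ends_V[OF e(2)] e(1) by auto
  note U = nearD(3)[OF N] and Uc = nearD(4)[OF N]
  have pr: "conn (T i) p r" using pV e U by auto
  have "\<not> conn (T i) q r" using e(4) U by simp
  then have "\<not> conn (T i) p q" using pr conn_sym conn_trans by meson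
  then have ac: "acyc (insert e (T i))"
    using acyc_insert[OF nearD(6)[OF N nearD(1)[OF N]] e(1)] by simp
  have cr: "conn (insert e (T i)) v r" if "v \<in> V" for v
  proof (cases "v \<in> U")
    case True
    then have "conn (T i) v q" using Uc e by auto
    then show ?thesis using pr unfolding conn_insert[OF e(1)] by auto
  next
    case False
    then show ?thesis using that U unfolding conn_insert[OF e(1)] by auto
  qed
  then have "conn (insert e (T i)) u v" if "u \<in> V" "v \<in> V" for u v
    using that conn_sym conn_trans by meson
  moreover have "insert e (T i) \<inter> T j = {}" "T j \<inter> insert e (T i) = {}" if "j < k" "j \<noteq> i" for j
    using nearD(8)[OF N that(1) nearD(1)[OF N] that(2)] new[OF that(1)] by auto
  ultimately show ?thesis
    using ac e(2) nearD(5,6,7,8)[OF N] nearD(1)[OF N] unfolding trees_def by simp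
qed

lemma arc_removal_side:
  assumes ac: "acyc A" and con: "\<And>u v. u \<in> V \<Longrightarrow> v \<in> V \<Longrightarrow> conn A u v" and r: "r \<in> V"
    and b: "arc r A b z y" and U: "U = {v\<in>V. \<not> conn (A - {b}) v r}" and u: "u \<in> U"
  shows "conn (A - {b}) u z"
proof -
  have e: "ends b = {z, y}" "b \<in> A" "conn (A - {b}) y r" "\<not> conn (A - {b}) z r"
    using b by (auto simp: arc_def)
  have "conn (insert b (A - {b})) u r" using con u U r e(2) by (simp add: insert_absorb)
  moreover have "\<not> conn (A - {b}) u r" using u U by auto
  ultimately show ?thesis using e unfolding conn_insert[OF e(1)] by auto
qed

lemma near_remove:
  assumes T: "trees k T" and i: "i < k" and r: "r \<in> V" and b: "arc r (T i) b z y" and z: "z \<in> V"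
    and U: "U = {v\<in>V. \<not> conn (T i - {b}) v r}"
  shows "near r k (T(i := T i - {b})) i U \<and> z \<in> U"
proof -
  have s: "conn (T i - {b}) u z" if "u \<in> U" for u
    by (rule arc_removal_side[OF treesD(2,3)[OF T i] r b U that])
  then have "conn (T i - {b}) u v" if "u \<in> U" "v \<in> U" for u v
    using that conn_sym conn_trans by meson
  moreover have "acyc (T i - {b})" using acyc_subset[OF treesD(2)[OF T i]] by blast
  moreover have "z \<in> U" using b z U by (auto simp: arc_def)
  moreover have "T j \<inter> (T i - {b}) = {}" "(T i - {b}) \<inter> T j = {}" if "j < k" "j \<noteq> i" for j
    using treesD(4)[OF T that(1) i that(2)] by auto
  moreover have "T i - {b} \<subseteq> G" using treesD(1)[OF T i] by auto
  ultimately show ?thesis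
    using treesD[OF T] i r U unfolding near_def by simp
qed

text \<open>The outcome of an augmentation: a red edge inside some member of the list has become
  blue; that member shrinks, and the list is unchanged up to this position.\<close>
definition shrinkable :: "'v \<Rightarrow> nat \<Rightarrow> (nat \<Rightarrow> 'a set) \<Rightarrow> 'a set \<Rightarrow> 'v set list \<Rightarrow> bool" where
  "shrinkable r k T F L \<longleftrightarrow> (\<exists>T' e L0 R L1 R'. L = L0 @ R # L1 \<and> e \<in> F \<and> ends e \<subseteq> R \<and>
     trees k T' \<and> (\<Union>i<k. T' i) = insert e (\<Union>i<k. T i) \<and>
     legal r k T' (F - {e}) (L0 @ [R']) \<and> R' \<subset> R)"

lemma shrinkable_append: "shrinkable r k T F L \<Longrightarrow> shrinkable r k T F (L @ L')"
  unfolding shrinkable_def by (metis append_Cons append_assoc)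

lemma shrinkable_cong:
  "(\<Union>i<k. T i) = (\<Union>i<k. T' i) \<Longrightarrow> shrinkable r k T F L \<longleftrightarrow> shrinkable r k T' F L"
  unfolding shrinkable_def by simp

lemma near_arc_transfer:
  assumes N: "near r k T i U" and X: "acyc X" and j: "j < k" and sub: "T j \<subseteq> X"
    and b: "arc r (T j) b z y" and z: "z \<in> V" "j = i \<Longrightarrow> z \<notin> U"
  shows "arc r X b z y"
proof (rule arc_transfer[OF b order_refl _ _ sub X])
  show "b \<in> T j" using b by (auto simp: arc_def)
  show "conn (T j) z r"
    using z nearD(2,3)[OF N] nearD(7)[OF N j] by (cases "j = i") auto
qed

lemma remove_edge_comp:
  assumes "v \<notin> comp F p" "ends e = {p, q}"
  shows "comp (F - {e}) v = comp F v"
proof (cases "e \<in> F")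
  case True
  have "conn (F - {e}) v u" if "conn F v u" for u
  proof -
    have "conn (insert e (F - {e})) v u" using that True by (simp add: insert_absorb)
    moreover have m: "conn F x y" if "conn (F - {e}) x y" for x y
      using that by (rule conn_mono) auto
    have np: "\<not> conn F v p" using assms(1) conn_sym by (auto simp: comp_def)
    moreover have "conn F q p" using conn_sym[OF conn_edge[OF True assms(2)]] .
    then have "\<not> conn F v q" using np conn_trans by blast
    then have "\<not> conn (F - {e}) v q" "\<not> conn (F - {e}) v p" using m np by blast+
    ultimately show ?thesis unfolding conn_insert[OF assms(2)] by auto
  qed
  then show ?thesis
    unfolding comp_def using conn_mono[OF _ Diff_subset] by blast
qed simp

lemma legal_V:
  assumes "legal r k T F L" "F \<subseteq> G" "\<And>i. i < k \<Longrightarrow> T i \<subseteq> G" "r \<in> V"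
  shows "\<Union>(set L) \<subseteq> V"
  using assms(1)
proof (induction rule: legal.induct)
  case root
  then show ?case using comp_V assms by simp
next
  case (step L i z b y)
  have "b \<in> G" using step.hyps(2,4) assms(3) unfolding arc_def by blast
  then have "y \<in> V" using ends_V[of b] step by (auto simp: arc_def)
  then show ?case using step comp_V[OF assms(2)] by auto
qed

text \<open>\<open>R\<close> is the first member that meets the cut-off part \<open>U\<close>; let
  \<open>w\<close> be its entry vertex. If \<open>w\<close> lies in \<open>U\<close>, it is not the
  root, so an arc with tail in \<open>L0\<close> ends in \<open>U\<close> and the hypothesis on
  \<open>L0\<close> applies. Otherwise \<open>R\<close> has vertices on both sides, and any red edge
  of \<open>R\<close> across the border of \<open>U\<close> reconnects tree \<open>i\<close>;
  without it the component of \<open>w\<close> is properly smaller.\<close>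

lemma shrink_at:
  assumes l: "legal r k T F (L0 @ [R])" and N: "near r k T i U" and F: "acyc F" "F \<subseteq> G"
    and FT: "F \<inter> (\<Union>j<k. T j) = {}"
    and dis: "\<Union>(set L0) \<inter> U = {}" and q: "q \<in> R" "q \<in> U"
    and IH: "L0 \<noteq> [] \<Longrightarrow> legal r k T F L0 \<Longrightarrow>
      (\<exists>j b z y. j < k \<and> arc r (T j) b z y \<and> z \<in> \<Union>(set L0) \<and> y \<in> U) \<Longrightarrow> shrinkable r k T F L0"
  shows "shrinkable r k T F (L0 @ [R])"
proof -
  have rV: "r \<in> V" and rU: "r \<notin> U" and U: "U = {v\<in>V. \<not> conn (T i) v r}" and i: "i < k"
    using nearD[OF N] by blast+
  obtain w where w: "R = comp F w" "w \<notin> \<Union>(set L0)"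
    "(L0 = [] \<and> w = r) \<or> (legal r k T F L0 \<and> (\<exists>i b z. i < k \<and> z \<in> \<Union>(set L0) \<and> arc r (T i) b z w))"
    by (rule legal_entry[OF l])
  show ?thesis
  proof (cases "w \<in> U")
    case True
    then have "L0 \<noteq> []" "legal r k T F L0" using w(3) rU by auto
    then have "shrinkable r k T F L0" using IH w(3) True by blast
    then show ?thesis by (rule shrinkable_append)
  next
    case False
    have cq: "conn F w q" using q w by (auto simp: comp_def)
    have "q \<notin> R - U" "w \<in> R - U" using q False w by auto
    then obtain e p p' where e: "e \<in> F" "ends e = {p, p'}" "p \<in> R - U" "p' \<notin> R - U"
      using conn_crossing[OF cq] by metis
    have "conn F w p" using e(3) w(1) by (simp add: comp_def)
    then have "p' \<in> R" using w(1) conn_trans[OF _ conn_edge[OF e(1,2)]] by (simp add: comp_def)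
    then have p': "p' \<in> U" "p' \<in> R" using e by auto
    have eG: "e \<in> G" using e F by auto
    define T' where "T' = T(i := insert e (T i))"
    have T': "trees k T'" unfolding T'_def
      by (rule near_insert[OF N e(2) eG]) (use e p' FT in auto)
    have un: "(\<Union>j<k. T' j) = insert e (\<Union>j<k. T j)"
      using i by (auto simp: T'_def split: if_splits)
    have LV: "x \<in> V" if "x \<in> \<Union>(set L0)" for x
      using legal_V[OF l F(2) nearD(5)[OF N] rV] that by auto
    have dR: "R \<inter> \<Union>(set L0) = {}"
      using legal_disjoint[OF l] by (auto simp: sorted_wrt_append)
    have "legal r k T' (F - {e}) (L0 @ [comp (F - {e}) w])"
    proof (rule legal_replace[OF w(3,2)])
      fix j b z y assume a: "j < k" "arc r (T j) b z y" "z \<in> \<Union>(set L0)"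
      have "acyc (T' j)" using T' a(1) by (simp add: trees_def)
      moreover have "T j \<subseteq> T' j" by (auto simp: T'_def)
      moreover have "z \<notin> U" using a dis by auto
      ultimately show "arc r (T' j) b z y"
        using near_arc_transfer[OF N _ a(1) _ a(2) LV[OF a(3)]] by blast
    next
      fix v assume v: "v \<in> \<Union>(set L0)"
      have "comp F p = R" using e w comp_eqI by auto
      then show "comp (F - {e}) v = comp F v"
        using remove_edge_comp[OF _ e(2)] dR v by blast
    qed
    moreover have "comp (F - {e}) w \<subset> R"
    proof -
      have "comp (F - {e}) w \<subseteq> R" using w comp_mono[of "F - {e}" F] by auto
      moreover have "\<not> (conn (F - {e}) p w \<and> conn (F - {e}) p' w)"
        using acycD[OF F(1) e(1,2)] conn_sym conn_trans by meson
      ultimately show ?thesis using e(3) p' unfolding comp_def using conn_sym by blast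
    qed
    moreover have "ends e \<subseteq> R" using e p' by auto
    ultimately show ?thesis unfolding shrinkable_def using T' un e(1) by blast
  qed
qed

lemma legal_prefix_transfer:
  assumes l: "legal r k T F (La @ Ra # Lb)"
    and arcs: "\<And>i b z y. i < k \<Longrightarrow> arc r (T i) b z y \<Longrightarrow> z \<in> \<Union>(set La) \<Longrightarrow> arc r (T2 i) b z y"
  shows "legal r k T2 F (La @ [Ra])"
proof -
  obtain w where w: "Ra = comp F w" "w \<notin> \<Union>(set La)"
    "(La = [] \<and> w = r) \<or> (legal r k T F La \<and> (\<exists>i b z. i < k \<and> z \<in> \<Union>(set La) \<and> arc r (T i) b z w))"
    by (rule legal_entry[OF l])
  show ?thesis unfolding w(1)
    by (rule legal_replace[OF w(3,2) arcs refl])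
qed

text \<open>The damage is passed from tree to tree, moving strictly towards the front of the list,
  until a red edge can repair it.\<close>

lemma augment_arc:
  assumes "legal r k T F L" "near r k T i U" "acyc F" "F \<subseteq> G" "F \<inter> (\<Union>j<k. T j) = {}"
    "\<Union>(set L) \<inter> U = {}" "j < k" "arc r (T j) b z y" "z \<in> \<Union>(set L)" "y \<in> U"
  shows "shrinkable r k T F L"
  using assms
proof (induction "length L" arbitrary: L T i U j b z y rule: less_induct)
  case less
  note N = less.prems(2)
  note D = nearD[OF N]
  have LV: "\<Union>(set L) \<subseteq> V" using legal_V[OF less.prems(1,4) D(5) D(2)] .
  have b: "b \<in> T j" "ends b = {z, y}" using less.prems(8) by (auto simp: arc_def)
  have zV: "z \<in> V" "z \<notin> U" using less.prems(6,9) LV by auto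
  \<comment> \<open>An arc of tree \<open>i\<close> itself with tail outside \<open>U\<close> also
    ends outside \<open>U\<close>.\<close>
  have ji: "j \<noteq> i"
  proof
    assume "j = i"
    then have "conn (T i) y z" using conn_sym[OF conn_edge[OF b]] by simp
    moreover have "conn (T i) z r" using zV D(3) by auto
    ultimately have "conn (T i) y r" by (rule conn_trans)
    then show False using less.prems(10) D(3) by auto
  qed
  have bG: "b \<in> G" using b D(5)[OF less.prems(7)] by auto
  \<comment> \<open>The arc \<open>b\<close> repairs tree \<open>i\<close> and is now missing from
    tree \<open>j\<close>. The set of all blue edges stays the same, so the red forest is not
    affected.\<close>
  define T2 where "T2 = T(j := T j - {b}, i := insert b (T i))"
  define U2 where "U2 = {v\<in>V. \<not> conn (T j - {b}) v r}"
  have T2: "T2 j = T j - {b}" "T2 i = insert b (T i)" "\<And>l. l \<noteq> i \<Longrightarrow> l \<noteq> j \<Longrightarrow> T2 l = T l"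
    using ji by (auto simp: T2_def)
  have un: "(\<Union>l<k. T2 l) = (\<Union>l<k. T l)"
  proof
    show "(\<Union>l<k. T2 l) \<subseteq> (\<Union>l<k. T l)"
      using b(1) less.prems(7) D(1) T2 by (auto simp: T2_def split: if_splits)
    show "(\<Union>l<k. T l) \<subseteq> (\<Union>l<k. T2 l)"
    proof
      fix e assume "e \<in> (\<Union>l<k. T l)"
      then obtain l where l: "l < k" "e \<in> T l" by auto
      show "e \<in> (\<Union>l<k. T2 l)"
      proof (cases "e = b")
        case True
        then show ?thesis using D(1) T2(2) by blast
      next
        case False
        then have "e \<in> T2 l" using l by (auto simp: T2_def)
        then show ?thesis using l by auto
      qed
    qed
  qed
  have acj: "acyc (T j)" and conj: "\<And>u v. u \<in> V \<Longrightarrow> v \<in> V \<Longrightarrow> conn (T j) u v"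
    using D(6,7) less.prems(7) ji by blast+
  have near2: "near r k T2 j U2"
  proof -
    have "\<not> conn (T i) y r" using less.prems(10) D(3) by auto
    then have "\<not> conn (T i) z y" using zV D(3) conn_sym conn_trans by (metis (mono_tags, lifting) mem_Collect_eq)
    then have ac: "acyc (insert b (T i))" using acyc_insert[OF D(6)[OF D(1)] b(2)] by simp
    have ins: "conn (T2 i) v r" if "v \<in> V" for v
    proof (cases "v \<in> U")
      case True
      then have "conn (T i) v y" using D(4) less.prems(10) by blast
      then show ?thesis using zV D(3) unfolding T2 conn_insert[OF b(2)] by auto
    next
      case False
      then show ?thesis using that D(3) unfolding T2 conn_insert[OF b(2)] by auto
    qed
    have 1: "T2 l \<subseteq> G \<and> acyc (T2 l)" if "l < k" for l
      using that ac D(5,6)[OF that] bG acyc_subset[OF acj, of "T j - {b}"]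
      by (auto simp: T2_def)
    have 2: "conn (T2 l) u v" if l: "l < k" "l \<noteq> j" and uv: "u \<in> V" "v \<in> V" for l u v
    proof (cases "l = i")
      case True
      then show ?thesis using ins uv conn_sym conn_trans by meson
    next
      case False
      then show ?thesis using D(7)[OF l(1) _ uv] T2(3) l by simp
    qed
    have "conn (T j - {b}) u z" if "u \<in> U2" for u
      by (rule arc_removal_side[OF acj conj D(2) less.prems(8) U2_def that])
    then have 3: "conn (T2 j) u v" if "u \<in> U2" "v \<in> U2" for u v
      using that conn_sym conn_trans unfolding T2 by meson
    have 4: "T2 l \<inter> T2 l' = {}" if l: "l < k" "l' < k" "l \<noteq> l'" for l l'
    proof -
      have "b \<notin> T l" if "l < k" "l \<noteq> j" for l
        using D(8)[OF that(1) less.prems(7) that(2)] b(1) by auto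
      then show ?thesis using D(8)[OF l] l by (auto simp: T2_def)
    qed
    show ?thesis
      unfolding near_def using less.prems(7) D(2) 1 2 3 4 by (simp add: T2(1) U2_def)
  qed
  \<comment> \<open>The new cut-off part contains the tail \<open>z\<close>, a vertex of the list.
    Hence the list meets it, and the prefix before the first meeting is shorter than
    \<open>L\<close>, which drives the induction.\<close>
  have zU2: "z \<in> U2" using less.prems(8) zV by (simp add: arc_def U2_def)
  then have "\<exists>R\<in>set L. R \<inter> U2 \<noteq> {}" using less.prems(9) by auto
  then obtain La Ra Lb where L: "L = La @ Ra # Lb" "Ra \<inter> U2 \<noteq> {}" "\<forall>R\<in>set La. \<not> R \<inter> U2 \<noteq> {}"
    using split_list_first_prop[of L "\<lambda>R. R \<inter> U2 \<noteq> {}"] by auto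
  have La: "\<Union>(set La) \<inter> U2 = {}" using L(3) by auto
  have l2: "legal r k T2 F (La @ [Ra])"
  proof (rule legal_prefix_transfer)
    show "legal r k T F (La @ Ra # Lb)" using less.prems(1) L by simp
    fix l b' z' y' assume a: "l < k" "arc r (T l) b' z' y'" "z' \<in> \<Union>(set La)"
    have z': "z' \<in> V" "z' \<notin> U2" "z' \<notin> U" using a LV La less.prems(6) L by auto
    have ac2: "acyc (T2 l)" using nearD(6)[OF near2 a(1)] .
    show "arc r (T2 l) b' z' y'"
    proof (cases "l = j")
      case True
      have c: "conn (T j - {b}) z' r" using z' by (simp add: U2_def)
      have a': "arc r (T j) b' z' y'" using a True by simp
      then have "b' \<in> T j - {b}" using arc_not_deleted[OF a' c] by (auto simp: arc_def)
      then show ?thesis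
        using arc_transfer[OF a' _ _ c, of "T2 j"] ac2 True T2(1) by blast
    next
      case False
      then have "T l \<subseteq> T2 l" by (auto simp: T2_def)
      then show ?thesis by (rule near_arc_transfer[OF N ac2 a(1) _ a(2) z'(1,3)])
    qed
  qed
  have "shrinkable r k T2 F (La @ [Ra])"
  proof (rule shrink_at[OF l2 near2 less.prems(3,4) _ La])
    show "F \<inter> (\<Union>j<k. T2 j) = {}" using less.prems(5) un by simp
    obtain q where "q \<in> Ra" "q \<in> U2" using L by auto
    then show "(SOME q. q \<in> Ra \<inter> U2) \<in> Ra" "(SOME q. q \<in> Ra \<inter> U2) \<in> U2"
      using someI_ex[of "\<lambda>q. q \<in> Ra \<inter> U2"] by blast+
  next
    assume lLa: "legal r k T2 F La"
      and "\<exists>j b z y. j < k \<and> arc r (T2 j) b z y \<and> z \<in> \<Union>(set La) \<and> y \<in> U2"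
    then obtain j' b' z' y' where
      a: "j' < k" "arc r (T2 j') b' z' y'" "z' \<in> \<Union>(set La)" "y' \<in> U2" by blast
    have len: "length La < length L" using L by simp
    have FT2: "F \<inter> (\<Union>j<k. T2 j) = {}" using less.prems(5) un by simp
    show "shrinkable r k T2 F La"
      by (rule less.hyps[OF len lLa near2 less.prems(3,4) FT2 La a])
  qed
  then have "shrinkable r k T F (La @ [Ra])" using shrinkable_cong[OF un] by simp
  then show ?case using shrinkable_append[of r k T F "La @ [Ra]" Lb] L by simp
qed

lemma augment:
  assumes "legal r k T F (La @ [R])" "near r k T i U" "acyc F" "F \<subseteq> G"
    "F \<inter> (\<Union>j<k. T j) = {}" "\<Union>(set La) \<inter> U = {}" "q \<in> R" "q \<in> U"
  shows "shrinkable r k T F (La @ [R])"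
  by (rule shrink_at[OF assms]) (use augment_arc[OF _ assms(2-6)] in blast)

text \<open>The part cut off by deleting \<open>b\<close> contains \<open>z\<close>, so some member
  meets it. The arcs leaving the members before the first such one have their tails in the root part
  and survive.\<close>

lemma augment_removed:
  assumes T: "trees k T" and r: "r \<in> V" and l: "legal r k T F L" and F: "acyc F" "F \<subseteq> G"
    and FT: "F \<inter> (\<Union>j<k. T j) = {}"
    and i: "i < k" and b: "arc r (T i) b z y" and z: "z \<in> \<Union>(set L)"
  shows "shrinkable r k (T(i := T i - {b})) F L"
proof -
  define U where "U = {v\<in>V. \<not> conn (T i - {b}) v r}"
  let ?T = "T(i := T i - {b})"
  have LV: "\<Union>(set L) \<subseteq> V" using legal_V[OF l F(2) treesD(1)[OF T] r] .
  have N: "near r k ?T i U" "z \<in> U"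
    using near_remove[OF T i r b _ U_def] z LV by auto
  have "\<exists>R\<in>set L. R \<inter> U \<noteq> {}" using z N(2) by auto
  then obtain La Ra Lb where L: "L = La @ Ra # Lb" "Ra \<inter> U \<noteq> {}" "\<forall>R\<in>set La. \<not> R \<inter> U \<noteq> {}"
    using split_list_first_prop[of L "\<lambda>R. R \<inter> U \<noteq> {}"] by auto
  obtain q where q: "q \<in> Ra" "q \<in> U" using L by auto
  have La: "\<Union>(set La) \<inter> U = {}" using L(3) by auto
  have "legal r k ?T F (La @ [Ra])"
  proof (rule legal_prefix_transfer)
    show "legal r k T F (La @ Ra # Lb)" using l L by simp
    fix l b' z' y' assume a: "l < k" "arc r (T l) b' z' y'" "z' \<in> \<Union>(set La)"
    have z': "z' \<in> V" "z' \<notin> U" using a LV La L by auto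
    show "arc r (?T l) b' z' y'"
    proof (cases "l = i")
      case True
      have c: "conn (T i - {b}) z' r" using z' by (simp add: U_def)
      have a': "arc r (T i) b' z' y'" using a True by simp
      then have "b' \<in> T i - {b}" using arc_not_deleted[OF a' c] by (auto simp: arc_def)
      then have "arc r (T i - {b}) b' z' y'"
        using arc_transfer[OF a' _ _ c order_refl] acyc_subset[OF treesD(2)[OF T i]] by blast
      then show ?thesis using True by simp
    next
      case False
      then show ?thesis using a by simp
    qed
  qed
  moreover have "F \<inter> (\<Union>j<k. ?T j) = {}" using FT i by (auto split: if_splits)
  ultimately have "shrinkable r k ?T F (La @ [Ra])"
    using augment[OF _ N(1) F _ La q] by blast
  then show ?thesis using shrinkable_append[of r k ?T F "La @ [Ra]" Lb] L by simp
qed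

lemma legal_length:
  assumes l: "legal r k T F L" and "F \<subseteq> G" "\<And>i. i < k \<Longrightarrow> T i \<subseteq> G" "r \<in> V"
  shows "length L \<le> card V"
proof -
  have V: "\<Union>(set L) \<subseteq> V" using legal_V[OF assms] .
  have ne: "R \<noteq> {}" if "R \<in> set L" for R using legal_members[OF l that] by auto
  have d: "sorted_wrt (\<lambda>A B. A \<inter> B = {}) L" by (rule legal_disjoint[OF l])
  have "length L \<le> card (\<Union>(set L))" using V ne d
  proof (induction L)
    case (Cons R L)
    have f: "finite R" "finite (\<Union>(set L))" using Cons.prems finV by (auto dest: finite_subset)
    have "card R \<ge> 1" using Cons.prems f by (simp add: Suc_leI card_gt_0_iff)
    moreover have "R \<inter> \<Union>(set L) = {}" using Cons.prems by auto
    moreover have "length L \<le> card (\<Union>(set L))" using Cons by auto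
    ultimately show ?case using card_Un_disjoint[OF f] by auto
  qed simp
  also have "\<dots> \<le> card V" using V finV by (rule card_mono[rotated])
  finally show ?thesis .
qed

end

section \<open>Density of closed lists and the covering by forests\<close>

context multigr
begin

lemma legal_distinct:
  assumes "legal r k T F L"
  shows "distinct L"
proof -
  have "sorted_wrt (\<lambda>A B. A \<inter> B = {}) L" by (rule legal_disjoint[OF assms])
  moreover have "\<forall>R\<in>set L. R \<noteq> {}" using legal_members[OF assms] by auto
  ultimately show ?thesis by (induction L) auto
qed

lemma legal_pairwise_disjoint:
  assumes "legal r k T F L" "R \<in> set L" "R' \<in> set L" "R \<noteq> R'"
  shows "R \<inter> R' = {}"
proof -
  obtain v v' where "R = comp F v" "R' = comp F v'" using legal_members assms by metis
  then show ?thesis using assms(4) comp_eqI by (metis disjoint_iff)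
qed

lemma union_swap:
  assumes T: "trees k T" and i: "i < k" and B: "B \<subseteq> T i"
  shows "(\<Union>j<k. (T(i := T i - B \<union> Q)) j) = (\<Union>j<k. T j) - B \<union> Q"
proof
  have nB: "e \<notin> B" if "j < k" "j \<noteq> i" "e \<in> T j" for j e
    using treesD(4)[OF T that(1) i that(2)] that B by blast
  show "(\<Union>j<k. (T(i := T i - B \<union> Q)) j) \<subseteq> (\<Union>j<k. T j) - B \<union> Q"
  proof
    fix e assume "e \<in> (\<Union>j<k. (T(i := T i - B \<union> Q)) j)"
    then obtain j where "j \<in> {..<k}" "e \<in> (T(i := T i - B \<union> Q)) j" by (rule UN_E)
    then show "e \<in> (\<Union>j<k. T j) - B \<union> Q" using nB[of j e] by (cases "j = i") auto
  qed
  show "(\<Union>j<k. T j) - B \<union> Q \<subseteq> (\<Union>j<k. (T(i := T i - B \<union> Q)) j)"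
  proof
    fix e assume "e \<in> (\<Union>j<k. T j) - B \<union> Q"
    then consider "e \<in> Q" | j where "j < k" "e \<in> T j" "e \<notin> B" by auto
    then show "e \<in> (\<Union>j<k. (T(i := T i - B \<union> Q)) j)"
    proof cases
      case 1
      then show ?thesis using i by (intro UN_I[of i]) auto
    next
      case 2
      then show ?thesis by (intro UN_I[of j]) auto
    qed
  qed
qed

lemma union_remove:
  assumes "trees k T" "i < k" "b \<in> T i"
  shows "(\<Union>j<k. (T(i := T i - {b})) j) = (\<Union>j<k. T j) - {b}"
  using union_swap[OF assms(1,2), of "{b}" "{}"] assms(3) by simp

lemma card_red_within:
  assumes F: "acyc F" "F \<subseteq> G" and v: "v \<in> V"
  shows "card (comp F v) - 1 \<le> card {e \<in> F. ends e \<subseteq> comp F v}"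
proof (rule card_edges_within_ge[where r = v])
  show "finite F" using F finG finite_subset by blast
  show "finite (comp F v)" using comp_V[OF F(2) v] finV finite_subset by blast
  show "conn F x v" if "x \<in> comp F v" for x using that conn_sym by (simp add: comp_def)
  show "y \<in> comp F v" if "arc v F b x y" "x \<in> comp F v" for b x y
    using that conn_edge[of b F x y] conn_trans by (auto simp: arc_def comp_def)
qed (use F in auto)

text \<open>Root paths that start in the list stay in it, so every blue tree contributes a spanning
  tree of the union, made of edges of \<open>E\<close>. These trees are disjoint from each other and
  from the red edges that span the members.\<close>

lemma dense_closure:
  assumes T: "trees k T" and r: "r \<in> V" and l: "legal r k T F L" and F: "acyc F" "F \<subseteq> E" and E: "E \<subseteq> G"
    and FT: "F \<inter> (\<Union>j<k. T j) = {}"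
    and cl: "\<And>i b z y. i < k \<Longrightarrow> arc r (T i) b z y \<Longrightarrow> z \<in> \<Union>(set L) \<Longrightarrow> b \<in> E \<and> y \<in> \<Union>(set L)"
  shows "k * (card (\<Union>(set L)) - 1) + (\<Sum>R\<in>set L. card R - 1) \<le> card {e \<in> E. ends e \<subseteq> \<Union>(set L)}"
    and "card (\<Union>(set L)) = (\<Sum>R\<in>set L. card R)"
proof -
  let ?H = "\<Union>(set L)"
  have FG: "F \<subseteq> G" using F E by auto
  have HV: "?H \<subseteq> V" using legal_V[OF l FG treesD(1)[OF T] r] .
  then have finH: "finite ?H" using finV finite_subset by blast
  have finE: "finite E" using E finG finite_subset by blast
  have finR: "finite R" if "R \<in> set L" for R using that finH by (meson Union_upper finite_subset)
  have dj: "R \<inter> R' = {}" if "R \<in> set L" "R' \<in> set L" "R \<noteq> R'" for R R'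
    using legal_pairwise_disjoint[OF l that] .
  show "card ?H = (\<Sum>R\<in>set L. card R)"
    using card_Union_disjoint[of "set L"] finR dj by (simp add: pairwise_def disjnt_def)
  define BT where "BT i = {e \<in> E \<inter> T i. ends e \<subseteq> ?H}" for i
  define RE where "RE R = {e \<in> F. ends e \<subseteq> R}" for R
  have bt: "card ?H - 1 \<le> card (BT i)" if i: "i < k" for i
  proof -
      have ex: "\<exists>b. \<exists>y. arc r (T i) b x y" if "x \<in> ?H - {r}" for x
      proof -
        have "conn (T i) x r" using treesD(3)[OF T i _ r] that HV by blast
        then show ?thesis using arc_exists[OF treesD(2)[OF T i]] that by blast
      qed
      define t where "t x = (SOME b. \<exists>y. arc r (T i) b x y)" for x
      have t: "\<exists>y. arc r (T i) (t x) x y" if "x \<in> ?H - {r}" for x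
        unfolding t_def using someI_ex[OF ex[OF that]] .
      have inj: "inj_on t (?H - {r})"
      proof (rule inj_onI)
        fix x x' assume "x \<in> ?H - {r}" "x' \<in> ?H - {r}" "t x = t x'"
        then show "x = x'" using t[of x] t[of x'] arc_unique by metis
      qed
      have sub: "t ` (?H - {r}) \<subseteq> BT i"
      proof
        fix b assume "b \<in> t ` (?H - {r})"
        then obtain x where x: "x \<in> ?H - {r}" "b = t x" by blast
        then obtain y where y: "arc r (T i) b x y" using t by blast
        then have "b \<in> E" "y \<in> ?H" using cl[OF i y] x by auto
        then show "b \<in> BT i" using x y by (auto simp: arc_def BT_def)
      qed
      have "card (?H - {r}) \<le> card (BT i)"
        using card_inj_on_le[OF inj sub] finE by (simp add: BT_def)
      moreover have "r \<in> ?H" using legal_root_mem[OF l] .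
      ultimately show ?thesis using finH by simp
  qed
  have re: "card R - 1 \<le> card (RE R)" if R: "R \<in> set L" for R
  proof -
    obtain v where v: "R = comp F v" using legal_members[OF l R] by auto
    then have "v \<in> V" using R HV comp_self by blast
    then show ?thesis using card_red_within[OF F(1) FG] v by (simp add: RE_def)
  qed
  have fin: "finite (BT i)" "finite (RE R)" for i R
    using finE F(2) finite_subset by (auto simp: BT_def RE_def intro: finite_subset[of _ E])
  have "card ((\<Union>i<k. BT i) \<union> (\<Union>R\<in>set L. RE R)) = card (\<Union>i<k. BT i) + card (\<Union>R\<in>set L. RE R)"
  proof (rule card_Un_disjoint)
    show "(\<Union>i<k. BT i) \<inter> (\<Union>R\<in>set L. RE R) = {}" using FT by (auto simp: BT_def RE_def)
  qed (use fin in auto)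
  also have "card (\<Union>i<k. BT i) = (\<Sum>i<k. card (BT i))"
  proof (rule card_UN_disjoint)
    show "\<forall>i\<in>{..<k}. \<forall>j\<in>{..<k}. i \<noteq> j \<longrightarrow> BT i \<inter> BT j = {}"
      using treesD(4)[OF T] by (fastforce simp: BT_def)
  qed (use fin in auto)
  also have "card (\<Union>R\<in>set L. RE R) = (\<Sum>R\<in>set L. card (RE R))"
  proof (rule card_UN_disjoint)
    show "\<forall>R\<in>set L. \<forall>R'\<in>set L. R \<noteq> R' \<longrightarrow> RE R \<inter> RE R' = {}"
    proof (intro ballI impI, rule ccontr)
      fix R R' assume *: "R \<in> set L" "R' \<in> set L" "R \<noteq> R'" "RE R \<inter> RE R' \<noteq> {}"
      then obtain e where e: "e \<in> F" "ends e \<subseteq> R" "ends e \<subseteq> R'" by (auto simp: RE_def)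
      have "ends e = {}" using dj[OF *(1-3)] e by auto
      then show False using ends_2[of e] e FG by auto
    qed
  qed (use fin in auto)
  finally have c: "card ((\<Union>i<k. BT i) \<union> (\<Union>R\<in>set L. RE R)) = (\<Sum>i<k. card (BT i)) + (\<Sum>R\<in>set L. card (RE R))" .
  have "(\<Sum>i<k. card ?H - 1) \<le> (\<Sum>i<k. card (BT i))" by (rule sum_mono) (use bt in auto)
  moreover have "(\<Sum>R\<in>set L. card R - 1) \<le> (\<Sum>R\<in>set L. card (RE R))" by (rule sum_mono) (use re in auto)
  moreover have "card ((\<Union>i<k. BT i) \<union> (\<Union>R\<in>set L. RE R)) \<le> card {e \<in> E. ends e \<subseteq> ?H}"
    by (rule card_mono) (use finE F(2) in \<open>auto simp: BT_def RE_def\<close>)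
  ultimately show "k * (card ?H - 1) + (\<Sum>R\<in>set L. card R - 1) \<le> card {e \<in> E. ends e \<subseteq> ?H}"
    using c by simp
qed

text \<open>Among all families of trees, one leaving the fewest edges of \<open>E\<close> uncovered
  is taken. An uncovered edge \<open>f\<close> serves as the whole red forest, rooted at one of its
  ends. A virtual arc out of a maximal list could be traded for \<open>f\<close>; without such arcs
  the list spans too many edges.\<close>

lemma tree_cover:
  assumes T0: "trees k T0" and E: "E \<subseteq> G"
    and dens: "\<And>H. H \<subseteq> V \<Longrightarrow> card H \<ge> 2 \<Longrightarrow> card {e \<in> E. ends e \<subseteq> H} \<le> k * (card H - 1)"
  obtains T where "trees k T" "E \<subseteq> (\<Union>i<k. T i)"
proof -
  define unc where "unc T = card (E - (\<Union>i<k. T i))" for T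
  obtain T where T: "trees k T" and min: "\<And>T'. trees k T' \<Longrightarrow> unc T \<le> unc T'"
    using ex_has_least_nat[of "trees k" T0 unc] T0 by blast
  have finE: "finite E" using E finG finite_subset by blast
  have "E \<subseteq> (\<Union>i<k. T i)"
  proof (rule ccontr)
    assume "\<not> E \<subseteq> (\<Union>i<k. T i)"
    then obtain f where f: "f \<in> E" "f \<notin> (\<Union>i<k. T i)" by auto
    obtain r v where rv: "ends f = {r, v}" "r \<in> V" "v \<in> V" "r \<noteq> v"
      by (rule edge_obtain[of f]) (use f E in auto)
    have F: "acyc {f}" "{f} \<subseteq> E" "{f} \<subseteq> G" "{f} \<inter> (\<Union>i<k. T i) = {}"
    proof -
      have "acyc {}" by (simp add: acyc_def)
      moreover have "\<not> conn {} r v" using rv(4) by (simp add: conn_def adj_rel_def)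
      ultimately show "acyc {f}" using acyc_insert[of "{}"] rv by blast
    qed (use f E in auto)
    have "\<exists>L. legal r k T {f} L \<and> (\<forall>L'. legal r k T {f} L' \<longrightarrow> length L' \<le> length L)"
    proof (rule ex_has_greatest_nat)
      show "legal r k T {f} [comp {f} r]" by (rule legal.root)
      show "\<forall>L. legal r k T {f} L \<longrightarrow> length L < Suc (card V)"
        using legal_length[OF _ F(3) treesD(1)[OF T] rv(2)] by (simp add: less_Suc_eq_le)
    qed
    then obtain L where L: "legal r k T {f} L" "\<And>L'. legal r k T {f} L' \<Longrightarrow> length L' \<le> length L" by blast
    let ?H = "\<Union>(set L)"
    have cl: "b \<in> E \<and> y \<in> ?H" if i: "i < k" and b: "arc r (T i) b z y" and z: "z \<in> ?H" for i b z y
    proof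
      show "y \<in> ?H"
      proof (rule ccontr)
        assume "y \<notin> ?H"
        then show False using L(2)[OF legal.step[OF L(1) i z b]] by simp
      qed
      show "b \<in> E"
      proof (rule ccontr)
        assume bE: "b \<notin> E"
        \<comment> \<open>\<open>f\<close> is the only red edge, so the augmentation covers
          \<open>f\<close>, and only the virtual edge \<open>b\<close> is lost.\<close>
        obtain T' e where T': "trees k T'" "e = f"
          "(\<Union>i<k. T' i) = insert e (\<Union>j<k. (T(i := T i - {b})) j)"
          using augment_removed[OF T rv(2) L(1) F(1,3,4) i b z] unfolding shrinkable_def by blast
        have bT: "b \<in> T i" using b by (simp add: arc_def)
        have "E - (\<Union>i<k. T' i) \<subset> E - (\<Union>i<k. T i)"
          using T'(2,3) f bE unfolding union_remove[OF T i bT] by auto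
        then have "unc T' < unc T" unfolding unc_def using finE by (simp add: psubset_card_mono)
        then show False using min[OF T'(1)] by simp
      qed
    qed
    have c: "k * (card ?H - 1) + (\<Sum>R\<in>set L. card R - 1) \<le> card {e \<in> E. ends e \<subseteq> ?H}"
      by (rule dense_closure(1)[OF T rv(2) L(1) F(1,2) E F(4)]) (rule cl; assumption)
    have HV: "?H \<subseteq> V" using legal_V[OF L(1) F(3) treesD(1)[OF T] rv(2)] .
    \<comment> \<open>The member containing both ends of \<open>f\<close> supplies the edge by which
      the density bound is exceeded.\<close>
    have R1: "comp {f} r \<in> set L" using legal_nonempty[OF L(1)] hd_in_set by metis
    have "{r, v} \<subseteq> comp {f} r" using conn_edge[of f "{f}"] rv(1) by (auto simp: comp_def)
    moreover have fR1: "finite (comp {f} r)" using HV R1 finV by (meson Union_upper finite_subset)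
    ultimately have c2: "card (comp {f} r) \<ge> 2" using card_mono[of "comp {f} r" "{r, v}"] rv(4) by simp
    have "card (comp {f} r) - 1 \<le> (\<Sum>R\<in>set L. card R - 1)"
      by (rule member_le_sum) (use R1 in auto)
    moreover have "card ?H \<ge> card (comp {f} r)"
      using R1 HV finV by (intro card_mono) (auto intro: finite_subset)
    ultimately show False using c c2 dens[OF HV] by linarith
  qed
  then show thesis using that T by blast
qed

end

section \<open>Cutting a red tree between terminals\<close>

context edge_ends
begin

text \<open>The region of a terminal is the part of the red tree around it that carries its own
  label. The cut edge found here leaves a region all of whose rivals lie on the other side; it
  minimises the side of the region.\<close>
lemma leaf_region_cut:
  assumes F: "acyc F" and X: "a0 \<in> X" "b0 \<in> X" "a0 \<noteq> b0" and con: "\<And>x x'. x \<in> X \<Longrightarrow> x' \<in> X \<Longrightarrow> conn F x x'"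
    and fin: "finite (comp F a0)" and tau: "\<And>x. x \<in> X \<Longrightarrow> \<tau> x = x"
  obtains e p q a where "e \<in> F" "ends e = {p, q}" "a \<in> X" "\<tau> q = a" "\<tau> p \<noteq> a"
    "a \<in> comp (F - {e}) q" "\<And>x. x \<in> X \<Longrightarrow> x \<noteq> a \<Longrightarrow> x \<in> comp (F - {e}) p" "conn F q a"
proof -
  define Fl where "Fl a = {e \<in> F. \<forall>x\<in>ends e. \<tau> x = a}" for a
  define Rg where "Rg a = comp (Fl a) a" for a
  have RgF: "conn F a v" if "v \<in> Rg a" for a v
    using that conn_mono[of "Fl a" a v F] by (auto simp: Rg_def comp_def Fl_def)
  have Rgt: "\<tau> v = a" if "a \<in> X" "v \<in> Rg a" for a v
  proof -
    have "conn (Fl a) a v" using that by (simp add: Rg_def comp_def)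
    then have "v \<in> {v. \<tau> v = a}"
      by (rule conn_closed) (use tau that in \<open>auto simp: Fl_def\<close>)
    then show ?thesis by simp
  qed
  \<comment> \<open>Demanding another terminal on the side of \<open>p\<close> makes the cut
    separate terminals; an edge from the region of \<open>a\<close> into a part without rivals is no
    candidate.\<close>
  define cand where "cand c \<longleftrightarrow> (case c of (e, p, q, a) \<Rightarrow> e \<in> F \<and> ends e = {p, q} \<and> a \<in> X \<and>
     q \<in> Rg a \<and> p \<notin> Rg a \<and> (\<exists>b\<in>X. b \<noteq> a \<and> conn (F - {e}) p b))" for c
  define m where "m c = (case c of (e, p, q, a) \<Rightarrow> card (comp (F - {e}) q))" for c :: "'a \<times> 'v \<times> 'v \<times> 'v"
  have ex0: "\<exists>c. cand c"
  proof -
    have nb: "b0 \<notin> Rg a0" using Rgt[OF X(1)] tau[OF X(2)] X(3) by auto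
    have na: "a0 \<in> Rg a0" by (simp add: Rg_def)
    obtain b s t where b: "b \<in> F" "ends b = {s, t}" "s \<in> Rg a0" "t \<notin> Rg a0"
      "conn {e \<in> F. ends e \<inter> Rg a0 = {}} t b0"
      by (rule last_exit[OF con[OF X(1,2)] na nb])
    have "conn (F - {b}) t b0" by (rule conn_mono[OF b(5)]) (use b in auto)
    then have "cand (b, t, s, a0)" unfolding cand_def using b X by (auto simp: insert_commute)
    then show ?thesis by blast
  qed
  then obtain c where c: "cand c" "\<And>c'. cand c' \<Longrightarrow> m c \<le> m c'"
    using ex_has_least_nat[of cand _ m] by blast
  obtain e p q a where epqa: "c = (e, p, q, a)" by (cases c)
  have e: "e \<in> F" "ends e = {p, q}" "a \<in> X" "q \<in> Rg a" "p \<notin> Rg a"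
    using c(1) unfolding cand_def epqa by auto
  have tq: "\<tau> q = a" using Rgt e by simp
  have tp: "\<tau> p \<noteq> a"
  proof
    assume "\<tau> p = a"
    then have "e \<in> Fl a" using e tq by (simp add: Fl_def)
    then have "conn (Fl a) q p" using conn_sym[OF conn_edge] e(2) by blast
    then have "p \<in> Rg a" using e(4) unfolding Rg_def comp_def by (auto intro: conn_trans)
    then show False using e by simp
  qed
  have qa: "conn (F - {e'}) q a" if "e' \<notin> Fl a" for e'
  proof -
    have "conn (Fl a) q a" using e(4) conn_sym by (simp add: Rg_def comp_def)
    then show ?thesis by (rule conn_mono) (use that in \<open>auto simp: Fl_def\<close>)
  qed
  have eFl: "e \<notin> Fl a" using tp e by (simp add: Fl_def)
  have only: "x = a" if x: "x \<in> X" "conn (F - {e}) q x" for x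
  proof (rule ccontr)
    assume xa: "x \<noteq> a"
    have nq: "q \<notin> Rg x" using Rgt[OF x(1)] tq xa by auto
    have nx: "x \<in> Rg x" by (simp add: Rg_def)
    \<comment> \<open>Leaving the region of \<open>x\<close> for the last time on the way to
      \<open>q\<close> gives a candidate for \<open>x\<close> with \<open>a\<close> as its rival.
      Its side lies within the side of \<open>q\<close> but misses \<open>q\<close>, against
      minimality.\<close>
    obtain b s t where b: "b \<in> F - {e}" "ends b = {s, t}" "s \<in> Rg x" "t \<notin> Rg x"
      "conn {e' \<in> F - {e}. ends e' \<inter> Rg x = {}} t q"
      by (rule last_exit[OF conn_sym[OF x(2)] nx nq])
    have tq1: "conn (F - {b} - {e}) t q" by (rule conn_mono[OF b(5)]) (use b in auto)
    then have tq2: "conn (F - {b}) t q" "conn (F - {e}) t q"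
      using conn_mono[of "F - {b} - {e}" t q] by (meson Diff_subset, meson Diff_mono Diff_subset subset_refl)
    have "\<tau> s = x" using Rgt[OF x(1) b(3)] .
    then have bFl: "b \<notin> Fl a" using b(2) xa by (simp add: Fl_def)
    have ta: "conn (F - {b}) t a" using conn_trans[OF tq2(1) qa[OF bFl]] .
    have "cand (b, t, s, x)"
      unfolding cand_def using b x e(3) xa ta by (auto simp: insert_commute)
    then have le: "m c \<le> m (b, t, s, x)" by (rule c(2))
    have st: "\<not> conn (F - {b}) s t" using acycD[OF F _ b(2)] b(1) by simp
    have sq: "\<not> conn (F - {b}) s q" using st tq2(1) conn_sym conn_trans by meson
    have Fb: "F - {b} = insert e (F - {b} - {e})" using e(1) b(1) by auto
    have lift: "conn (F - {b}) u v" "conn (F - {e}) u v" if "conn (F - {b} - {e}) u v" for u v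
      using conn_mono[OF that, of "F - {b}"] conn_mono[OF that, of "F - {e}"] by auto
    have sqe: "conn (F - {e}) q s"
      using conn_trans[OF conn_sym[OF tq2(2)] conn_sym[OF conn_edge[OF b(1,2)]]] .
    have sp: "\<not> conn (F - {b} - {e}) s p"
    proof
      assume "conn (F - {b} - {e}) s p"
      then have "conn (F - {b}) s p" by (rule lift)
      moreover have "conn (F - {b}) p q" using e(1,2) b(1) conn_edge[of e "F - {b}"] by auto
      ultimately show False using sq conn_trans by blast
    qed
    have "comp (F - {b}) s \<subseteq> comp (F - {e}) q"
    proof
      fix u assume "u \<in> comp (F - {b}) s"
      then have "conn (insert e (F - {b} - {e})) s u" using Fb by (simp add: comp_def)
      then have "conn (F - {b} - {e}) s u"
        unfolding conn_insert[OF e(2)] using sp sq lift(1) by blast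
      then show "u \<in> comp (F - {e}) q" using conn_trans[OF sqe lift(2)] by (simp add: comp_def)
    qed
    moreover have "q \<notin> comp (F - {b}) s" using sq by (simp add: comp_def)
    moreover have "q \<in> comp (F - {e}) q" by simp
    ultimately have sub: "comp (F - {b}) s \<subset> comp (F - {e}) q" by blast
    have "conn F a0 q" using con[OF X(1) e(3)] RgF[OF e(4)] conn_trans by blast
    then have "comp (F - {e}) q \<subseteq> comp F a0"
      using comp_mono[of "F - {e}" F q] comp_eq[of F a0 q] by auto
    then have "finite (comp (F - {e}) q)" using fin finite_subset by blast
    then have "m (b, t, s, x) < m c" unfolding m_def epqa using sub by (simp add: psubset_card_mono)
    then show False using le by simp
  qed
  have "x \<in> comp (F - {e}) p" if x: "x \<in> X" "x \<noteq> a" for x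
  proof -
    have "conn F q x" using conn_trans[OF conn_sym[OF RgF[OF e(4)]] con[OF e(3) x(1)]] .
    then have "conn (insert e (F - {e})) q x" using e(1) by (simp add: insert_absorb)
    moreover have "\<not> conn (F - {e}) q p" using acycD[OF F e(1,2)] conn_sym by blast
    ultimately have "conn (F - {e}) p x" unfolding conn_insert[OF e(2)] using only x by blast
    then show ?thesis by (simp add: comp_def)
  qed
  moreover have "a \<in> comp (F - {e}) q" using qa[OF eFl] by (simp add: comp_def)
  ultimately show thesis using that[of e p q a] e tq tp conn_sym[OF RgF[OF e(4)]] by blast
qed

text \<open>The labels stand for the blocks of a blue forest. Read on the labels, a set Q of edges
  is a spanning tree if it joins all the labels and closes no cycle with any forest that
  respects the labels.\<close>
definition joins :: "'v set \<Rightarrow> ('v \<Rightarrow> 'v) \<Rightarrow> 'a set \<Rightarrow> 'v set \<Rightarrow> bool" where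
  "joins S \<tau> Q X \<longleftrightarrow> (\<forall>R. equivp R \<longrightarrow> (\<forall>v\<in>S. R v (\<tau> v)) \<longrightarrow>
     (\<forall>e\<in>Q. \<forall>p q. ends e = {p, q} \<longrightarrow> R p q) \<longrightarrow> (\<forall>x\<in>X. \<forall>x'\<in>X. R x x'))"

text \<open>Quantifying over \<open>A\<close> lets the edges of \<open>Q\<close> be added one at a
  time, with the forest built so far in the place of \<open>A\<close>. The second clause goes beyond
  acyclicity: distinct components of \<open>A\<close> with equal labels are not joined through
  \<open>Q\<close>.\<close>

definition cycle_free :: "('v \<Rightarrow> 'v) \<Rightarrow> 'a set \<Rightarrow> bool" where
  "cycle_free \<tau> Q \<longleftrightarrow> (\<forall>A. acyc A \<longrightarrow> (\<forall>u v. conn A u v \<longrightarrow> \<tau> u = \<tau> v) \<longrightarrow>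
     acyc (A \<union> Q) \<and> (\<forall>u v. \<tau> u = \<tau> v \<longrightarrow> conn (A \<union> Q) u v \<longrightarrow> conn A u v))"

text \<open>Induction on the number of terminals. The edge \<open>e\<close> from
  \<open>leaf_region_cut\<close> separates one terminal \<open>a\<close> from all others and becomes
  a leaf edge of the spanning tree on the labels. The rest is found on the other side of
  \<open>e\<close>, where the label \<open>a\<close> is absorbed by the label of
  \<open>p\<close>.\<close>

lemma separating_tree:
  assumes "finite X" "c \<in> X" "acyc F" "X \<subseteq> comp F c" "finite (comp F c)"
    "\<And>x. x \<in> X \<Longrightarrow> \<tau> x = x" "\<And>v. v \<in> comp F c \<Longrightarrow> \<tau> v \<in> X"
  shows "\<exists>Q \<subseteq> F. (\<forall>e\<in>Q. ends e \<subseteq> comp F c) \<and>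
    (\<forall>x\<in>X. \<forall>x'\<in>X. x \<noteq> x' \<longrightarrow> \<not> conn (F - Q) x x') \<and>
    joins (comp F c) \<tau> Q X \<and> cycle_free \<tau> Q"
    (is "\<exists>Q\<subseteq>F. ?P F X \<tau> c Q")
  using assms
proof (induction "card X" arbitrary: X c F \<tau> rule: less_induct)
  case less
  show ?case
  proof (cases "\<exists>d\<in>X. d \<noteq> c")
    case False
    then have one: "x = x'" if "x \<in> X" "x' \<in> X" for x x' using that by metis
    have "?P F X \<tau> c {}"
    proof (intro conjI)
      show "\<forall>x\<in>X. \<forall>x'\<in>X. x \<noteq> x' \<longrightarrow> \<not> conn (F - {}) x x'" using one by blast
    next
      show "joins (comp F c) \<tau> {} X"
        unfolding joins_def using one equivp_reflp by metis
    next
      show "cycle_free \<tau> {}" unfolding cycle_free_def Un_empty_right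
        by (intro allI impI conjI; assumption)
    qed blast
    then show ?thesis by blast
  next
    case True
    then obtain d where d: "d \<in> X" "c \<noteq> d" by auto
    have con: "conn F x x'" if "x \<in> X" "x' \<in> X" for x x'
    proof -
      have "conn F c x" "conn F c x'" using less.prems(4) that by (auto simp: comp_def)
      then show ?thesis using conn_sym conn_trans by meson
    qed
    obtain e p q a where e: "e \<in> F" "ends e = {p, q}" "a \<in> X" "\<tau> q = a" "\<tau> p \<noteq> a"
        "a \<in> comp (F - {e}) q" and rest: "\<And>x. x \<in> X \<Longrightarrow> x \<noteq> a \<Longrightarrow> x \<in> comp (F - {e}) p" and qa: "conn F q a"
      by (rule leaf_region_cut[where \<tau> = \<tau>, OF less.prems(3,2) d con less.prems(5,6)]; blast)
    have ca: "conn F c a" using con less.prems(2) e(3) by blast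
    have cq: "conn F c q" using conn_trans[OF ca conn_sym[OF qa]] .
    have cp: "conn F c p" using conn_trans[OF cq conn_sym[OF conn_edge[OF e(1,2)]]] .
    have pq: "\<not> conn (F - {e}) p q" using acycD[OF less.prems(3) e(1,2)] .
    obtain c1 where c1: "c1 \<in> X - {a}" using d less.prems(2) by auto
    have c1p: "comp (F - {e}) c1 = comp (F - {e}) p" using rest c1 comp_eqI by blast
    have sub: "comp (F - {e}) c1 \<subseteq> comp F c"
      unfolding c1p using comp_mono[of "F - {e}" F p] comp_eq[OF cp] by auto
    define \<tau>' where "\<tau>' v = (if \<tau> v = a then \<tau> p else \<tau> v)" for v
    have tp: "\<tau> p \<in> X - {a}" using less.prems(7)[of p] cp e(5) by (simp add: comp_def)
    have "\<exists>Q\<subseteq>F - {e}. ?P (F - {e}) (X - {a}) \<tau>' c1 Q"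
    proof (rule less.hyps)
      show "card (X - {a}) < card X" using less.prems(1) e(3) by (rule card_Diff1_less)
      show "acyc (F - {e})" using acyc_subset[OF less.prems(3)] by blast
      show "X - {a} \<subseteq> comp (F - {e}) c1" using rest c1p by auto
      show "finite (comp (F - {e}) c1)" using sub less.prems(5) finite_subset by blast
      show "\<tau>' x = x" if "x \<in> X - {a}" for x using less.prems(6)[of x] that by (auto simp: \<tau>'_def)
      show "\<tau>' v \<in> X - {a}" if "v \<in> comp (F - {e}) c1" for v
        using less.prems(7)[of v] that sub tp by (auto simp: \<tau>'_def)
    qed (use less.prems(1) c1 in auto)
    then obtain Q where Q: "Q \<subseteq> F - {e}" "?P (F - {e}) (X - {a}) \<tau>' c1 Q" by blast
    have "?P F X \<tau> c (insert e Q)"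
    proof (intro conjI)
      have "ends e \<subseteq> comp F c" using e(2) cp cq by (simp add: comp_def)
      then show "\<forall>e\<in>insert e Q. ends e \<subseteq> comp F c" using Q(2) sub by blast
    next
      have sep: "\<not> conn (F - {e} - Q) x x'" if "x \<in> X - {a}" "x' \<in> X - {a}" "x \<noteq> x'" for x x'
        using Q(2) that by blast
      have sepa: "\<not> conn (F - {e} - Q) a x" if "x \<in> X" "x \<noteq> a" for x
      proof
        assume "conn (F - {e} - Q) a x"
        then have "conn (F - {e}) a x" by (rule conn_mono) auto
        moreover have "conn (F - {e}) q a" using e(6) by (simp add: comp_def)
        moreover have "conn (F - {e}) p x" using rest[OF that] by (simp add: comp_def)
        ultimately show False using pq conn_sym conn_trans by meson
      qed
      have eq: "F - insert e Q = F - {e} - Q" by auto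
      show "\<forall>x\<in>X. \<forall>x'\<in>X. x \<noteq> x' \<longrightarrow> \<not> conn (F - insert e Q) x x'"
        unfolding eq using sep sepa conn_sym by (metis Diff_iff empty_iff insert_iff)
    next
      show "joins (comp F c) \<tau> (insert e Q) X"
        unfolding joins_def
      proof (intro allI impI)
        fix R :: "'v \<Rightarrow> 'v \<Rightarrow> bool" assume equ: "equivp R"
          and lab: "\<forall>v\<in>comp F c. R v (\<tau> v)" and ed: "\<forall>e\<in>insert e Q. \<forall>p q. ends e = {p, q} \<longrightarrow> R p q"
        have refl: "R x x" and sym: "R x y \<Longrightarrow> R y x" and trans: "R x y \<Longrightarrow> R y z \<Longrightarrow> R x z" for x y z
          using equ by (auto elim: equivpE dest: reflpD sympD transpD)
        have "R p q" using ed e(2) by blast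
        moreover have "R p (\<tau> p)" "R q a" using lab cp cq e(4) by (auto simp: comp_def)
        ultimately have ap: "R a (\<tau> p)" using sym trans by meson
        have "\<forall>v\<in>comp (F - {e}) c1. R v (\<tau>' v)"
        proof
          fix v assume "v \<in> comp (F - {e}) c1"
          then have "R v (\<tau> v)" using lab sub by blast
          then show "R v (\<tau>' v)" using ap trans[of v "\<tau> v" "\<tau> p"] by (simp add: \<tau>'_def)
        qed
        then have R1: "\<forall>x\<in>X - {a}. \<forall>x'\<in>X - {a}. R x x'"
          using Q(2) equ ed unfolding joins_def by blast
        have Ra: "R a x" if "x \<in> X" for x
          using that R1 tp ap refl trans by (cases "x = a") blast+
        then show "\<forall>x\<in>X. \<forall>x'\<in>X. R x x'" using sym trans by blast
      qed
    next
      show "cycle_free \<tau> (insert e Q)"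
        unfolding cycle_free_def
      proof (intro allI impI)
        fix A assume A: "acyc A" and lab: "\<forall>u v. conn A u v \<longrightarrow> \<tau> u = \<tau> v"
        have npq: "\<not> conn A p q" using lab e(4,5) by auto
        have "acyc (insert e A)" using acyc_insert[OF A e(2) npq] .
        \<comment> \<open>Contracting \<open>e\<close> turns the labels \<open>\<tau>\<close> into
          \<open>\<tau>'\<close>, and \<open>A\<close> together with \<open>e\<close> respects the
          new labels, so the induction hypothesis applies to it.\<close>
        moreover have "\<forall>u v. conn (insert e A) u v \<longrightarrow> \<tau>' u = \<tau>' v"
          unfolding conn_insert[OF e(2)] using lab e(4) by (metis \<tau>'_def)
        ultimately have IH: "acyc (insert e A \<union> Q)"
            "\<And>u v. \<tau>' u = \<tau>' v \<Longrightarrow> conn (insert e A \<union> Q) u v \<Longrightarrow> conn (insert e A) u v"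
          using Q(2) unfolding cycle_free_def by blast+
        have eq: "A \<union> insert e Q = insert e A \<union> Q" by auto
        have "conn A u v" if "\<tau> u = \<tau> v" "conn (insert e A \<union> Q) u v" for u v
        proof -
          have "\<tau>' u = \<tau>' v" using that by (simp add: \<tau>'_def)
          then have "conn (insert e A) u v" using IH(2) that by blast
          then show ?thesis unfolding conn_insert[OF e(2)] using lab e(4,5) that(1) by metis
        qed
        then show "acyc (A \<union> insert e Q) \<and> (\<forall>u v. \<tau> u = \<tau> v \<longrightarrow> conn (A \<union> insert e Q) u v \<longrightarrow> conn A u v)"
          unfolding eq using IH(1) by blast
      qed
    qed
    moreover have "insert e Q \<subseteq> F" using Q(1) e(1) by auto
    ultimately show ?thesis by blast
  qed
qed

end

section \<open>Exchanging several edges at once\<close>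

context edge_ends
begin

text \<open>Each new edge merges just the two components that make up its \<open>P b\<close>. As
  these unions are disjoint, no two new edges can be chained.\<close>

lemma conn_joined:
  assumes c: "conn (F0 \<union> B) u v" and ends: "\<And>b. b \<in> B \<Longrightarrow> ends b = {x b, y b}"
    and P: "\<And>b. b \<in> B \<Longrightarrow> P b = comp F0 (x b) \<union> comp F0 (y b)"
    and dj: "\<And>b b'. b \<in> B \<Longrightarrow> b' \<in> B \<Longrightarrow> b \<noteq> b' \<Longrightarrow> P b \<inter> P b' = {}"
  shows "conn F0 u v \<or> (\<exists>b\<in>B. u \<in> P b \<and> v \<in> P b)"
proof -
  let ?R = "\<lambda>u v. conn F0 u v \<or> (\<exists>b\<in>B. u \<in> P b \<and> v \<in> P b)"
  have cl: "v \<in> P b" if "b \<in> B" "u \<in> P b" "conn F0 u v" for u v b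
    using that P[OF that(1)] conn_trans[of F0 _ u v] by (auto simp: comp_def)
  show "?R u v"
  proof (rule conn_least[where R = ?R, OF c])
    fix u v w assume "?R u v" "?R v w"
    then consider "conn F0 u v" "conn F0 v w" | b where "b \<in> B" "conn F0 u v" "v \<in> P b" "w \<in> P b"
      | b where "b \<in> B" "u \<in> P b" "v \<in> P b" "conn F0 v w"
      | b b' where "b \<in> B" "b' \<in> B" "u \<in> P b" "v \<in> P b" "v \<in> P b'" "w \<in> P b'" by blast
    then show "?R u w"
    proof cases
      case 1
      then show ?thesis using conn_trans by blast
    next
      case 2
      then show ?thesis using cl conn_sym by blast
    next
      case 3
      then show ?thesis using cl by blast
    next
      case 4
      then have "b = b'" using dj by blast
      then show ?thesis using 4 by blast
    qed
  next
    fix e p q assume e: "e \<in> F0 \<union> B" "ends e = {p, q}"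
    show "?R p q"
    proof (cases "e \<in> F0")
      case True
      then show ?thesis using e conn_edge by blast
    next
      case False
      then have eB: "e \<in> B" using e by auto
      have "x e \<in> P e" "y e \<in> P e" using P[OF eB] by auto
      moreover have "{p, q} = {x e, y e}" using ends[OF eB] e(2) by simp
      ultimately have "p \<in> P e" "q \<in> P e" by (auto simp: doubleton_eq_iff)
      then show ?thesis using eB by blast
    qed
  qed simp
qed

lemma acyc_joined:
  assumes "finite B" "acyc F0" and "\<And>b. b \<in> B \<Longrightarrow> ends b = {x b, y b}"
    and "\<And>b. b \<in> B \<Longrightarrow> P b = comp F0 (x b) \<union> comp F0 (y b)"
    and "\<And>b b'. b \<in> B \<Longrightarrow> b' \<in> B \<Longrightarrow> b \<noteq> b' \<Longrightarrow> P b \<inter> P b' = {}"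
    and "\<And>b. b \<in> B \<Longrightarrow> \<not> conn F0 (x b) (y b)"
  shows "acyc (F0 \<union> B)"
  using assms
proof (induction rule: finite_induct)
  case (insert b B)
  have "\<not> conn (F0 \<union> B) (x b) (y b)"
  proof
    assume c: "conn (F0 \<union> B) (x b) (y b)"
    have "conn F0 (x b) (y b) \<or> (\<exists>b'\<in>B. x b \<in> P b' \<and> y b \<in> P b')"
      by (rule conn_joined[OF c insert.prems(2) insert.prems(3) insert.prems(4)]) auto
    then obtain b' where b': "b' \<in> B" "x b \<in> P b'" using insert.prems(5)[of b] by auto
    moreover have "x b \<in> P b" using insert.prems(3)[of b] by simp
    moreover have "b' \<noteq> b" using b' insert.hyps by auto
    ultimately show False using insert.prems(4)[of b b'] by blast
  qed
  moreover have "acyc (F0 \<union> B)"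
    by (rule insert.IH[OF insert.prems(1) insert.prems(2) insert.prems(3) insert.prems(4) insert.prems(5)]) auto
  ultimately have "acyc (insert b (F0 \<union> B))"
    using acyc_insert[of "F0 \<union> B" b "x b" "y b"] insert.prems(2)[of b] by simp
  then show ?case by simp
qed simp

end

context multigr
begin

text \<open>For a red forest inside \<open>G\<close> the cardinality of this set is \<open>M\<close>
  times the number of components of size \<open>M\<close>, so minimising it for positive
  \<open>M\<close> minimises that number.\<close>

definition big :: "nat \<Rightarrow> 'a set \<Rightarrow> 'v set" where
  "big M H = {v\<in>V. card (comp H v) = M}"

end

text \<open>The edges of Q cut the red component K of c between the terminals in X; every blue edge in
  Bs is made red and joins the piece around its terminal to another red component.\<close>
locale swap = multigr ends V G for ends :: "'a \<Rightarrow> 'v set" and V G +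
  fixes F Q Bs :: "'a set" and x y :: "'a \<Rightarrow> 'v" and X :: "'v set" and c :: 'v
  assumes acF: "acyc F" and FG: "F \<subseteq> G" and BG: "Bs \<subseteq> G" and Bne: "Bs \<noteq> {}" and cV: "c \<in> V"
    and QF: "Q \<subseteq> F" and QK: "\<And>e. e \<in> Q \<Longrightarrow> ends e \<subseteq> comp F c"
    and XK: "X \<subseteq> comp F c" and sep: "\<And>u v. u \<in> X \<Longrightarrow> v \<in> X \<Longrightarrow> u \<noteq> v \<Longrightarrow> \<not> conn (F - Q) u v"
    and endsB: "\<And>b. b \<in> Bs \<Longrightarrow> ends b = {x b, y b}" and xX: "\<And>b. b \<in> Bs \<Longrightarrow> x b \<in> X"
    and xinj: "inj_on x Bs"
    and yK: "\<And>b. b \<in> Bs \<Longrightarrow> y b \<notin> comp F c"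
    and yinj: "\<And>b b'. b \<in> Bs \<Longrightarrow> b' \<in> Bs \<Longrightarrow> b \<noteq> b' \<Longrightarrow> comp F (y b) \<noteq> comp F (y b')"
begin

abbreviation "K \<equiv> comp F c"
abbreviation "F1 \<equiv> F - Q \<union> Bs"

definition P :: "'a \<Rightarrow> 'v set" where
  "P b = comp (F - Q) (x b) \<union> comp F (y b)"

lemma K_V: "K \<subseteq> V"
  using comp_V[OF FG cV] .

lemma finK: "finite K"
  using K_V finV finite_subset by blast

lemma comp_outside:
  assumes "v \<notin> K"
  shows "comp (F - Q) v = comp F v"
proof
  show "comp (F - Q) v \<subseteq> comp F v" by (rule comp_mono) auto
  show "comp F v \<subseteq> comp (F - Q) v"
  proof
    fix u assume "u \<in> comp F v"
    then have "conn F v u" by (simp add: comp_def)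
    moreover have "v \<in> comp (F - Q) v \<inter> - K" using assms by auto
    ultimately have "u \<in> comp (F - Q) v \<inter> - K"
    proof (rule conn_closed)
      fix e p q assume e: "e \<in> F" "ends e = {p, q}" "p \<in> comp (F - Q) v \<inter> - K"
      then have "e \<in> F - Q" using QK by auto
      then have "q \<in> comp (F - Q) v"
        using e conn_edge[of e "F - Q" p q] conn_trans by (auto simp: comp_def)
      moreover have "q \<notin> K"
      proof
        assume "q \<in> K"
        then have "comp F q = K" by (rule comp_eqI)
        moreover have "p \<in> comp F q" using conn_sym[OF conn_edge[OF e(1,2)]] by (simp add: comp_def)
        ultimately show False using e by auto
      qed
      ultimately show "q \<in> comp (F - Q) v \<inter> - K" by auto
    qed
    then show "u \<in> comp (F - Q) v" by simp
  qed
qed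

lemma comp_piece: "v \<in> K \<Longrightarrow> comp (F - Q) v \<subseteq> K"
  using comp_mono[of "F - Q" F v] comp_eqI by auto

lemma comp_y_disjoint: "b \<in> Bs \<Longrightarrow> comp F (y b) \<inter> K = {}"
  using yK comp_eqI by (metis comp_self disjoint_iff)

lemma P_eq: "b \<in> Bs \<Longrightarrow> P b = comp (F - Q) (x b) \<union> comp (F - Q) (y b)"
  using comp_outside yK by (simp add: P_def)

lemma P_disjoint:
  assumes "b \<in> Bs" "b' \<in> Bs" "b \<noteq> b'"
  shows "P b \<inter> P b' = {}"
proof -
  have xx: "x b \<in> K" "x b' \<in> K" using xX XK assms by auto
  have "x b \<noteq> x b'" using xinj assms by (auto dest: inj_onD)
  then have "\<not> conn (F - Q) (x b) (x b')" using sep xX assms by blast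
  then have "comp (F - Q) (x b) \<inter> comp (F - Q) (x b') = {}"
    using comp_eqI comp_self by (metis (no_types, lifting) comp_def disjoint_iff mem_Collect_eq)
  moreover have "comp F (y b) \<inter> comp F (y b') = {}"
    using yinj[OF assms] comp_eqI by (metis disjoint_iff)
  ultimately show ?thesis
    unfolding P_def using comp_piece xx comp_y_disjoint assms by blast
qed

lemma xy_separated:
  assumes "b \<in> Bs"
  shows "\<not> conn (F - Q) (x b) (y b)"
proof
  assume "conn (F - Q) (x b) (y b)"
  then have "y b \<in> comp (F - Q) (x b)" by (simp add: comp_def)
  then have "y b \<in> K" using comp_piece[of "x b"] xX[OF assms] XK by auto
  then show False using yK[OF assms] by simp
qed

lemma finB: "finite Bs"
  using BG finG finite_subset by blast

lemma acyc_F1: "acyc F1"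
  by (rule acyc_joined[OF finB acyc_subset[OF acF] endsB P_eq P_disjoint xy_separated]) auto

lemma comp_F1_P:
  assumes "b \<in> Bs" "v \<in> P b"
  shows "comp F1 v \<subseteq> P b"
proof
  fix u assume "u \<in> comp F1 v"
  then have c: "conn F1 v u" by (simp add: comp_def)
  have "conn (F - Q) v u \<or> (\<exists>b\<in>Bs. v \<in> P b \<and> u \<in> P b)"
    by (rule conn_joined[OF c endsB P_eq P_disjoint])
  then show "u \<in> P b"
  proof
    assume "conn (F - Q) v u"
    then show ?thesis using assms P_eq conn_trans[of "F - Q" _ v u] by (auto simp: comp_def)
  next
    assume "\<exists>b\<in>Bs. v \<in> P b \<and> u \<in> P b"
    then show ?thesis using assms P_disjoint by (metis disjoint_iff)
  qed
qed

lemma comp_F1_other: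
  assumes "\<And>b. b \<in> Bs \<Longrightarrow> v \<notin> P b"
  shows "comp F1 v = comp (F - Q) v"
proof
  show "comp (F - Q) v \<subseteq> comp F1 v" by (rule comp_mono) auto
  show "comp F1 v \<subseteq> comp (F - Q) v"
  proof
    fix u assume "u \<in> comp F1 v"
    then have c: "conn F1 v u" by (simp add: comp_def)
    have "conn (F - Q) v u \<or> (\<exists>b\<in>Bs. v \<in> P b \<and> u \<in> P b)"
      by (rule conn_joined[OF c endsB P_eq P_disjoint])
    then show "u \<in> comp (F - Q) v" using assms by (auto simp: comp_def)
  qed
qed

lemma comp_F1_far:
  assumes "v \<notin> K" "\<And>b. b \<in> Bs \<Longrightarrow> v \<notin> comp F (y b)"
  shows "comp F1 v = comp F v"
proof -
  have "v \<notin> P b" if "b \<in> Bs" for b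
    using that assms comp_piece[of "x b"] xX[OF that] XK by (auto simp: P_def)
  then show ?thesis using comp_F1_other comp_outside[OF assms(1)] by simp
qed

lemma finX: "finite X"
  using XK finK finite_subset by blast

text \<open>The piece around one terminal contains none of the other \<open>card X - 1\<close>
  terminals, which also lie in \<open>K\<close>. This is the gain from exchanging several arcs at
  once.\<close>

lemma card_piece:
  assumes "u \<in> X"
  shows "card (comp (F - Q) u) + card X \<le> card K + 1"
proof -
  have uK: "u \<in> K" using assms XK by auto
  have fin: "finite (comp (F - Q) u)" using comp_piece[OF uK] finK finite_subset by blast
  have "comp (F - Q) u \<inter> (X - {u}) = {}" using sep[OF assms] by (auto simp: comp_def)
  then have "card (comp (F - Q) u \<union> (X - {u})) = card (comp (F - Q) u) + card (X - {u})"
    using fin finX by (intro card_Un_disjoint) auto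
  moreover have "card (comp (F - Q) u \<union> (X - {u})) \<le> card K"
    using comp_piece[OF uK] XK finK by (intro card_mono) auto
  moreover have "card (X - {u}) + 1 = card X"
    using finX assms by (metis Suc_eq_plus1 card_Suc_Diff1)
  ultimately show ?thesis by simp
qed

lemma comp_y_fin: "b \<in> Bs \<Longrightarrow> finite (comp F (y b))"
proof -
  assume "b \<in> Bs"
  then have "y b \<in> V" using endsB[of b] ends_V[of b] BG by auto
  then show ?thesis using comp_V[OF FG] finV finite_subset by blast
qed

lemma fin_P: "b \<in> Bs \<Longrightarrow> finite (P b)"
  using comp_piece[of "x b"] xX[of b] XK finK comp_y_fin[of b] unfolding P_def
  by (meson finite_UnI finite_subset subsetD)

lemma card_P:
  assumes "b \<in> Bs"
  shows "card (P b) + card X \<le> card K + 1 + card (comp F (y b))"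
  using card_Un_le[of "comp (F - Q) (x b)" "comp F (y b)"] card_piece[OF xX[OF assms]]
  unfolding P_def by linarith

lemma card_comp_rest:
  assumes "v \<in> K" "\<And>b. b \<in> Bs \<Longrightarrow> v \<notin> P b"
  shows "card (comp F1 v) < card K"
proof -
  obtain b where b: "b \<in> Bs" using Bne by auto
  have "x b \<notin> comp (F - Q) v"
  proof
    assume "x b \<in> comp (F - Q) v"
    then have "v \<in> comp (F - Q) (x b)" using conn_sym by (simp add: comp_def)
    then show False using assms(2)[OF b] by (simp add: P_def)
  qed
  moreover have "x b \<in> K" using xX[OF b] XK by auto
  ultimately have "comp (F - Q) v \<subset> K" using comp_piece[OF assms(1)] by blast
  then show ?thesis using comp_F1_other[OF assms(2)] finK by (simp add: psubset_card_mono)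
qed

text \<open>The two pieces are disjoint parts of \<open>K\<close>. So if \<open>card K = M\<close>
  and the attached components have less than half that size, at most one new component reaches size
  \<open>M\<close>.\<close>

lemma card_two_P:
  assumes "b \<in> Bs" "b' \<in> Bs" "b \<noteq> b'"
  shows "card (P b) + card (P b') \<le> card K + card (comp F (y b)) + card (comp F (y b'))"
proof -
  let ?A = "comp (F - Q) (x b)" and ?B = "comp (F - Q) (x b')"
  have xx: "x b \<in> K" "x b' \<in> K" using xX XK assms by auto
  have "?A \<inter> ?B = {}" using P_disjoint[OF assms] by (auto simp: P_def)
  moreover have "?A \<subseteq> K" "?B \<subseteq> K" using comp_piece xx by auto
  ultimately have "card ?A + card ?B \<le> card K"
    using finK card_Un_disjoint[of ?A ?B] card_mono[of K "?A \<union> ?B"] by (metis finite_subset Un_least)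
  moreover have "card (P b) \<le> card ?A + card (comp F (y b))" "card (P b') \<le> card ?B + card (comp F (y b'))"
    unfolding P_def by (rule card_Un_le)+
  ultimately show ?thesis by linarith
qed

lemma card_comp_F1_P: "b \<in> Bs \<Longrightarrow> v \<in> P b \<Longrightarrow> card (comp F1 v) \<le> card (P b)"
  using comp_F1_P fin_P by (intro card_mono)

lemma comp_F1_cases:
  obtains b where "b \<in> Bs" "v \<in> P b" | "v \<in> K" "card (comp F1 v) < card K"
    | "v \<notin> K" "comp F1 v = comp F v"
proof (cases "\<exists>b\<in>Bs. v \<in> P b")
  case True
  then show thesis using that by blast
next
  case False
  then show thesis
    using that card_comp_rest[of v] comp_F1_far[of v] by (cases "v \<in> K") (auto simp: P_def)
qed

lemma swap_bounded:
  assumes bd: "\<And>v. v \<in> V \<Longrightarrow> card (comp F v) \<le> M" and P: "\<And>b. b \<in> Bs \<Longrightarrow> card (P b) \<le> M" and v: "v \<in> V"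
  shows "card (comp F1 v) \<le> M"
proof (cases rule: comp_F1_cases[of v])
  case (1 b)
  then show ?thesis using card_comp_F1_P P by (meson le_trans)
next
  case 2
  then show ?thesis using bd[OF cV] by simp
next
  case 3
  then show ?thesis using bd[OF v] by simp
qed

lemma swap_big_subset:
  assumes bd: "\<And>v. v \<in> V \<Longrightarrow> card (comp F v) \<le> M" and P: "\<And>b. b \<in> Bs \<Longrightarrow> card (P b) < M"
  shows "big M F1 \<subseteq> big M F - K"
proof
  fix v assume v: "v \<in> big M F1"
  show "v \<in> big M F - K"
  proof (cases rule: comp_F1_cases[of v])
    case (1 b)
    then show ?thesis using card_comp_F1_P[of b v] P[of b] v by (simp add: big_def)
  next
    case 2
    then show ?thesis using bd[OF cV] v by (simp add: big_def)
  next
    case 3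
    then show ?thesis using v by (simp add: big_def)
  qed
qed

text \<open>The component \<open>K\<close> of size \<open>M\<close> disappears, and at most one
  \<open>P b\<close> of that size takes its place.\<close>

lemma swap_big_card:
  assumes K: "card K = M" and P: "\<And>b. b \<in> Bs \<Longrightarrow> card (P b) \<le> M"
    and P2: "\<And>b b'. b \<in> Bs \<Longrightarrow> b' \<in> Bs \<Longrightarrow> b \<noteq> b' \<Longrightarrow> card (P b) < M \<or> card (P b') < M"
  shows "card (big M F1) \<le> card (big M F)"
proof -
  define W where "W = \<Union>(P ` {b\<in>Bs. card (P b) = M})"
  have W: "finite W \<and> card W \<le> M"
  proof (cases "\<exists>b\<in>Bs. card (P b) = M")
    case True
    then obtain b where b: "b \<in> Bs" "card (P b) = M" by auto
    have "{b\<in>Bs. card (P b) = M} = {b}" using b P2 by fastforce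
    then show ?thesis using b fin_P by (simp add: W_def)
  next
    case False
    then have "W = {}" by (auto simp: W_def)
    then show ?thesis by simp
  qed
  have "big M F1 \<subseteq> (big M F - K) \<union> W"
  proof
    fix v assume v: "v \<in> big M F1"
    show "v \<in> (big M F - K) \<union> W"
    proof (cases rule: comp_F1_cases[of v])
      case (1 b)
      then have "card (P b) = M" using card_comp_F1_P[of b v] P[of b] v by (simp add: big_def)
      then show ?thesis using 1 by (auto simp: W_def)
    next
      case 2
      then show ?thesis using K v by (simp add: big_def)
    next
      case 3
      then show ?thesis using v by (simp add: big_def)
    qed
  qed
  moreover have fin: "finite (big M F)" using finV by (simp add: big_def)
  ultimately have "card (big M F1) \<le> card ((big M F - K) \<union> W)" using W by (intro card_mono) auto
  also have "\<dots> \<le> card (big M F - K) + card W" by (rule card_Un_le)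
  also have "\<dots> \<le> card (big M F - K) + card K" using W K by simp
  also have "\<dots> = card (big M F)"
  proof -
    have "K \<subseteq> big M F"
    proof
      fix v assume "v \<in> K"
      then have "comp F v = K" "v \<in> V" using comp_eqI K_V by blast+
      then show "v \<in> big M F" using K by (simp only: big_def mem_Collect_eq simp_thms)
    qed
    then show ?thesis using fin finK by (simp add: card_Diff_subset card_mono)
  qed
  finally show ?thesis .
qed

end

section \<open>Blocks of a blue tree after deleting several arcs\<close>

context edge_ends
begin

text \<open>The default \<open>g\<close> is meant for the root block when it has no terminal: it
  then shares its label with the block of \<open>g\<close>, so that a spanning tree on the labels
  leaves exactly these two blocks apart.\<close>

definition label :: "'a set \<Rightarrow> 'v set \<Rightarrow> 'v \<Rightarrow> 'v \<Rightarrow> 'v" where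
  "label A X g v = (if \<exists>x\<in>X. conn A v x then SOME x. x \<in> X \<and> conn A v x else g)"

lemma label_cong:
  assumes "conn A u v"
  shows "label A X g u = label A X g v"
proof -
  have "conn A u x \<longleftrightarrow> conn A v x" for x
    using assms conn_sym conn_trans by meson
  then show ?thesis by (simp add: label_def)
qed

lemma label_conn:
  assumes "x \<in> X" "conn A v x"
  shows "label A X g v \<in> X \<and> conn A v (label A X g v)"
proof -
  have "\<exists>x. x \<in> X \<and> conn A v x" using assms by blast
  from someI_ex[OF this] show ?thesis using assms unfolding label_def by auto
qed

lemma label_in: "g \<in> X \<Longrightarrow> label A X g v \<in> X"
  using label_conn[of _ X A v g] by (cases "\<exists>x\<in>X. conn A v x") (auto simp: label_def)

lemma label_self:
  assumes "x \<in> X" and "\<And>x'. x' \<in> X \<Longrightarrow> x' \<noteq> x \<Longrightarrow> \<not> conn A x x'"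
  shows "label A X g x = x"
  using label_conn[OF assms(1), of A x g] assms(2) by blast

lemma label_else: "\<not> (\<exists>x\<in>X. conn A v x) \<Longrightarrow> label A X g v = g"
  unfolding label_def by simp

end

context multigr
begin

lemma blocks_root:
  assumes "arc r A b x y" "b \<in> B"
  shows "\<not> conn (A - B) x r"
  using arc_not_deleted[OF assms(1), of B] assms(2) by blast

text \<open>The edge by which the root path of \<open>v\<close> last leaves its block must belong to
  \<open>B\<close>, and being directed towards the root it has its tail in that block.\<close>

lemma blocks_cover:
  assumes con: "conn A v r" and nr: "\<not> conn (A - B) v r"
    and arcs: "\<And>b. b \<in> B \<Longrightarrow> arc r A b (x b) (y b)"
  shows "\<exists>b\<in>B. conn (A - B) v (x b)"
proof -
  have v: "v \<in> comp (A - B) v" "r \<notin> comp (A - B) v" using nr by (auto simp: comp_def)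
  obtain b s t where b: "b \<in> A" "ends b = {s, t}" "s \<in> comp (A - B) v" "t \<notin> comp (A - B) v"
    "conn {e \<in> A. ends e \<inter> comp (A - B) v = {}} t r"
    by (rule last_exit[OF con v])
  have bB: "b \<in> B"
  proof (rule ccontr)
    assume "b \<notin> B"
    then have "conn (A - B) s t" using b conn_edge by blast
    then show False using b conn_trans by (auto simp: comp_def)
  qed
  have "conn (A - {b}) t r" by (rule conn_mono[OF b(5)]) (use b in auto)
  then have "x b \<noteq> t" using arcs[OF bB] by (auto simp: arc_def)
  moreover have "{x b, y b} = {s, t}" using arcs[OF bB] b(2) by (simp add: arc_def)
  ultimately have "x b = s" by (auto simp: doubleton_eq_iff)
  then show ?thesis using bB b(3) by (auto simp: comp_def)
qed

section \<open>Extremal decompositions\<close>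

definition state :: "nat \<Rightarrow> 'a set \<Rightarrow> (nat \<Rightarrow> 'a set) \<Rightarrow> 'a set \<Rightarrow> bool" where
  "state k E T F \<longleftrightarrow> trees k T \<and> acyc F \<and> F \<subseteq> E \<and> F \<inter> (\<Union>i<k. T i) = {} \<and> E \<subseteq> F \<union> (\<Union>i<k. T i)"

definition bounded :: "nat \<Rightarrow> 'a set \<Rightarrow> bool" where
  "bounded M F \<longleftrightarrow> (\<forall>v\<in>V. card (comp F v) \<le> M)"

definition rooted_state ::
  "'v \<Rightarrow> nat \<Rightarrow> 'a set \<Rightarrow> nat \<Rightarrow> (nat \<Rightarrow> 'a set) \<Rightarrow> 'a set \<Rightarrow> 'v set list \<Rightarrow> bool" where
  "rooted_state r k E M T F L \<longleftrightarrow> E \<subseteq> G \<and> r \<in> V \<and> state k E T F \<and> bounded M F \<and>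
     legal r k T F L \<and> card (comp F r) = M"

text \<open>Lexicographic minimality is kept only in the form of single comparisons: a rival with
  the same root, the same number of largest components and the same members \<open>L0\<close> has no
  smaller next member. The closure under arcs is what remains of preferring longer lists.\<close>

definition optimal ::
  "'v \<Rightarrow> nat \<Rightarrow> 'a set \<Rightarrow> nat \<Rightarrow> (nat \<Rightarrow> 'a set) \<Rightarrow> 'a set \<Rightarrow> 'v set list \<Rightarrow> bool" where
  "optimal r k E M T F L \<longleftrightarrow> rooted_state r k E M T F L \<and>
     (\<forall>T' F'. state k E T' F' \<longrightarrow> bounded M F' \<longrightarrow> card (big M F) \<le> card (big M F')) \<and>
     (\<forall>T' F' L0 R L1 R'. L = L0 @ R # L1 \<longrightarrow> card (big M F') = card (big M F) \<longrightarrow>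
        rooted_state r k E M T' F' (L0 @ [R']) \<longrightarrow> card R \<le> card R') \<and>
     (\<forall>i b z y. i < k \<longrightarrow> arc r (T i) b z y \<longrightarrow> z \<in> \<Union>(set L) \<longrightarrow> y \<in> \<Union>(set L))"

lemma optimalD:
  assumes "optimal r k E M T F L"
  shows "E \<subseteq> G" "r \<in> V" "trees k T" "acyc F" "F \<subseteq> E" "F \<subseteq> G" "F \<inter> (\<Union>i<k. T i) = {}"
    "E \<subseteq> F \<union> (\<Union>i<k. T i)" "\<And>v. v \<in> V \<Longrightarrow> card (comp F v) \<le> M"
    "legal r k T F L" "card (comp F r) = M"
proof -
  have "rooted_state r k E M T F L" using assms by (simp only: optimal_def)
  then show "E \<subseteq> G" "r \<in> V" "trees k T" "acyc F" "F \<subseteq> E" "F \<subseteq> G" "F \<inter> (\<Union>i<k. T i) = {}"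
    "E \<subseteq> F \<union> (\<Union>i<k. T i)" "\<And>v. v \<in> V \<Longrightarrow> card (comp F v) \<le> M"
    "legal r k T F L" "card (comp F r) = M"
    unfolding rooted_state_def state_def bounded_def by blast+
qed

lemma optimal_big:
  assumes "optimal r k E M T F L" "state k E T' F'" "bounded M F'"
  shows "card (big M F) \<le> card (big M F')"
  using assms unfolding optimal_def by (elim conjE) blast

text \<open>For empty \<open>L0\<close> the root component of the rival may be smaller than
  \<open>M\<close>, so lists cannot be compared; the strict inequality then contradicts the minimal
  number of largest components.\<close>

lemma optimal_list:
  assumes o: "optimal r k E M T F (L0 @ R # L1)" and s: "state k E T' F'" "bounded M F'"
    and big: "card (big M F') \<le> card (big M F)" "L0 = [] \<Longrightarrow> card (big M F') < card (big M F)"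
    and l: "legal r k T' F' (L0 @ [R'])"
  shows "card R \<le> card R'"
proof -
  have eq: "card (big M F') = card (big M F)" using optimal_big[OF o s] big by simp
  then have ne: "L0 \<noteq> []" using big by auto
  have "comp F' r = comp F r"
    using legal_nonempty[OF l] legal_nonempty[OF optimalD(10)[OF o]] ne by simp
  then have "card (comp F' r) = M" using optimalD(11)[OF o] by simp
  then have "rooted_state r k E M T' F' (L0 @ [R'])"
    using optimalD(1,2)[OF o] s l unfolding rooted_state_def by blast
  then show ?thesis using o eq unfolding optimal_def by (elim conjE) blast
qed

text \<open>The sets \<open>T1\<close> need not be spanning trees: one of them may still wait for
  the red edge that the augmentation supplies. If the root component shrinks, there are fewer
  components of size \<open>M\<close>; if a later member shrinks, the list gets smaller.\<close>

lemma optimal_not_shrinkable: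
  assumes o: "optimal r k E M T F (L0 @ L2)" and sh: "shrinkable r k T1 F1 L0"
    and F1: "acyc F1" "F1 \<subseteq> E" "bounded M F1" "card (big M F1) \<le> card (big M F)"
    and FT: "F1 \<inter> (\<Union>i<k. T1 i) = {}" "E \<subseteq> F1 \<union> (\<Union>i<k. T1 i)" and root: "comp F1 r = comp F r"
  shows False
proof -
  obtain T' e La R Lb R' where S: "L0 = La @ R # Lb" "e \<in> F1" "ends e \<subseteq> R" "trees k T'"
     "(\<Union>i<k. T' i) = insert e (\<Union>i<k. T1 i)" "legal r k T' (F1 - {e}) (La @ [R'])" "R' \<subset> R"
    using sh unfolding shrinkable_def by blast
  have o': "optimal r k E M T F (La @ R # (Lb @ L2))" using o S(1) by simp
  let ?F = "F1 - {e}"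
  have FG: "F1 \<subseteq> G" using F1(2) optimalD(1)[OF o] by auto
  have fin: "finite (comp F1 v)" if "v \<in> V" for v
    using comp_V[OF FG that] finV finite_subset by blast
  have sub: "comp ?F v \<subseteq> comp F1 v" for v by (rule comp_mono) auto
  have le: "card (comp ?F v) \<le> card (comp F1 v)" if "v \<in> V" for v
    using card_mono[OF fin[OF that] sub] .
  have st: "state k E T' ?F"
    unfolding state_def using S(4,5) acyc_subset[OF F1(1)] F1(2) FT by auto
  have bd: "bounded M ?F" using F1(3) le unfolding bounded_def by (meson le_trans)
  have bsub: "big M ?F \<subseteq> big M F1"
  proof
    fix v assume "v \<in> big M ?F"
    then have "v \<in> V" "card (comp ?F v) = M" by (auto simp: big_def)
    then show "v \<in> big M F1" using le[of v] F1(3) unfolding bounded_def big_def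
      by (simp add: le_antisym)
  qed
  have finb: "finite (big M F1)" using finV by (simp add: big_def)
  have b1: "card (big M ?F) \<le> card (big M F)" using card_mono[OF finb bsub] F1(4) by simp
  have b2: "card (big M ?F) < card (big M F)" if La: "La = []"
  proof -
    have R: "R = comp F1 r" using legal_nonempty[OF optimalD(10)[OF o']] La root by simp
    obtain p p' where p: "ends e = {p, p'}" "p \<in> V" by (rule edge_obtain[of e]) (use S(2) FG in auto)
    have cp: "comp F1 p = R" using S(3) p(1) comp_eqI R by auto
    have "p' \<notin> comp ?F p" using acycD[OF F1(1) S(2) p(1)] by (simp add: comp_def)
    moreover have "p' \<in> comp F1 p" using S(3) p(1) cp by simp
    ultimately have "comp ?F p \<subset> comp F1 p" using sub by blast
    then have lt: "card (comp ?F p) < card (comp F1 p)" using fin[OF p(2)] by (rule psubset_card_mono[rotated])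
    have cM: "card (comp F1 p) = M" using cp R root optimalD(11)[OF o] by simp
    then have "p \<in> big M F1" "p \<notin> big M ?F" using lt p(2) by (auto simp: big_def)
    then have "card (big M ?F) < card (big M F1)" using bsub finb by (intro psubset_card_mono) auto
    then show ?thesis using F1(4) by simp
  qed
  have "card R \<le> card R'" by (rule optimal_list[OF o' st bd b1 b2 S(6)])
  moreover have "R \<subseteq> V"
    using legal_V[OF optimalD(10)[OF o'] optimalD(6)[OF o'] treesD(1)[OF optimalD(3)[OF o']] optimalD(2)[OF o']] by auto
  then have "card R' < card R" using S(7) finV finite_subset by (metis psubset_card_mono)
  ultimately show False by simp
qed

lemma optimal_arc_real:
  assumes o: "optimal r k E M T F L" and i: "i < k" and b: "arc r (T i) b z y" and z: "z \<in> \<Union>(set L)"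
  shows "b \<in> E"
proof (rule ccontr)
  assume bE: "b \<notin> E"
  let ?T = "T(i := T i - {b})"
  note D = optimalD[OF o]
  have bT: "b \<in> T i" using b by (simp add: arc_def)
  have sh: "shrinkable r k ?T F L" by (rule augment_removed[OF D(3,2,10,4,6,7) i b z])
  show False
    by (rule optimal_not_shrinkable[of r k E M T F L "[]" ?T F])
       (use o sh D bE union_remove[OF D(3) i bT] in \<open>auto simp: bounded_def\<close>)
qed

text \<open>By \<open>joins\<close> all vertices become connected once \<open>q\<close> and
  \<open>r\<close> are identified; by \<open>cycle_free\<close> these two, which carry the same
  label, stay apart. So \<open>A \<union> Q\<close> has exactly two components on
  \<open>V\<close>.\<close>

lemma two_blocks:
  assumes A: "acyc A" and cov: "\<And>v. v \<in> V \<Longrightarrow> conn A v r \<or> (\<exists>x\<in>X. conn A v x)"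
    and g: "g \<in> X" "conn A q g" and q: "\<not> conn A q r" and rX: "\<And>x. x \<in> X \<Longrightarrow> \<not> conn A x r"
    and S: "S \<subseteq> V" and joi: "joins S (label A X g) Q X" and cf: "cycle_free (label A X g) Q"
    and sepA: "\<And>x x'. x \<in> X \<Longrightarrow> x' \<in> X \<Longrightarrow> x \<noteq> x' \<Longrightarrow> \<not> conn A x x'"
  shows "acyc (A \<union> Q)" "\<not> conn (A \<union> Q) q r" "\<And>v. v \<in> V \<Longrightarrow> conn (A \<union> Q) v r \<or> conn (A \<union> Q) v q"
proof -
  have cf': "acyc (A \<union> Q) \<and> (\<forall>u v. label A X g u = label A X g v \<longrightarrow> conn (A \<union> Q) u v \<longrightarrow> conn A u v)"
    using cf A label_cong unfolding cycle_free_def by blast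
  then show "acyc (A \<union> Q)" by blast
  have lr: "label A X g r = g" using rX conn_sym by (intro label_else) blast
  have lq: "label A X g q = g" using label_cong[OF g(2)] label_self[OF g(1)] sepA[OF g(1)] by metis
  show nqr: "\<not> conn (A \<union> Q) q r" using cf' lr lq q by metis
  \<comment> \<open>Connectivity after adding an imaginary edge between \<open>q\<close> and
    \<open>r\<close>.\<close>
  define R where "R u v \<longleftrightarrow> conn (A \<union> Q) u v \<or> (conn (A \<union> Q) u r \<and> conn (A \<union> Q) q v) \<or>
    (conn (A \<union> Q) u q \<and> conn (A \<union> Q) r v)" for u v
  have up: "conn (A \<union> Q) u v" if "conn A u v" for u v using that by (rule conn_mono) auto
  have equ: "equivp R"
  proof (rule equivpI)
    show "reflp R" by (simp add: R_def reflp_def)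
    show "symp R" unfolding R_def symp_def using conn_sym by meson
    show "transp R" unfolding R_def transp_def using conn_sym conn_trans by meson
  qed
  have Rrg: "R r g" using up[OF g(2)] by (simp add: R_def)
  have lab: "R v (label A X g v)" if v: "v \<in> V" for v
  proof (cases "\<exists>x\<in>X. conn A v x")
    case True
    then show ?thesis using label_conn up unfolding R_def by blast
  next
    case False
    then have "conn A v r" using cov[OF v] by blast
    then have "R v r" using up by (simp add: R_def)
    then show ?thesis using label_else[OF False] Rrg equ by (metis equivp_transp)
  qed
  have "\<forall>e\<in>Q. \<forall>p q. ends e = {p, q} \<longrightarrow> R p q" 
    unfolding R_def using conn_edge by blast
  then have XX: "R x x'" if "x \<in> X" "x' \<in> X" for x x'
    using joi equ lab S that unfolding joins_def by blast
  fix v assume v: "v \<in> V"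
  have "R v r"
  proof -
    have "R v (label A X g v)" by (rule lab[OF v])
    moreover have "R (label A X g v) g" using XX label_in g(1) by blast
    ultimately show ?thesis using Rrg equ by (metis equivp_symp equivp_transp)
  qed
  then show "conn (A \<union> Q) v r \<or> conn (A \<union> Q) v q" by (auto simp: R_def)
qed

lemma one_block:
  assumes A: "acyc A" and cov: "\<And>v. v \<in> V \<Longrightarrow> \<exists>x\<in>X. conn A v x"
    and S: "S \<subseteq> V" and joi: "joins S (label A X g) Q X" and cf: "cycle_free (label A X g) Q"
  shows "acyc (A \<union> Q)" "\<And>u v. u \<in> V \<Longrightarrow> v \<in> V \<Longrightarrow> conn (A \<union> Q) u v"
proof -
  show "acyc (A \<union> Q)" using cf A label_cong unfolding cycle_free_def by blast
  have up: "conn (A \<union> Q) u v" if "conn A u v" for u v using that by (rule conn_mono) auto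
  have equ: "equivp (conn (A \<union> Q))"
    by (rule equivpI) (simp add: reflp_def, unfold symp_def transp_def, use conn_sym in blast, use conn_trans in blast)
  have "\<forall>v\<in>S. conn (A \<union> Q) v (label A X g v)" using cov S label_conn up by blast
  moreover have "\<forall>e\<in>Q. \<forall>p q. ends e = {p, q} \<longrightarrow> conn (A \<union> Q) p q"
    using conn_edge by blast
  ultimately have XX: "conn (A \<union> Q) x x'" if "x \<in> X" "x' \<in> X" for x x'
    using joi equ that unfolding joins_def by blast
  fix u v assume "u \<in> V" "v \<in> V"
  then show "conn (A \<union> Q) u v" using cov up XX conn_sym conn_trans by meson
qed

lemma swap_disjoint:
  assumes T: "trees k T" and FT: "F \<inter> (\<Union>j<k. T j) = {}" and i: "i < k" and A: "A \<subseteq> T i" and Q: "Q \<subseteq> F"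
    and j: "j < k" "l < k" "j \<noteq> l"
  shows "(T(i := A \<union> Q)) j \<inter> (T(i := A \<union> Q)) l = {}"
proof -
  have "(A \<union> Q) \<inter> T l = {}" if "l < k" "l \<noteq> i" for l
    using treesD(4)[OF T that(1) i that(2)] FT A Q that by blast
  then show ?thesis using j treesD(4)[OF T j] by (auto simp: Int_commute)
qed

text \<open>If all attached components were smaller, the m arcs in \<open>Bs\<close> could become
  red at once without an oversized component. Deleting them splits tree \<open>i\<close> into m + 1
  blocks. If the entry vertex \<open>w\<close> of \<open>K\<close> and all earlier members lie in
  the root block, m red edges of \<open>K\<close> rejoin the blocks, and the component of
  \<open>w\<close> shrinks. Otherwise m - 1 edges of \<open>K\<close> leave two parts, and an
  augmentation in the earlier members joins these. Both outcomes contradict optimality.\<close>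

lemma exchange_bound:
  assumes o: "optimal r k E M T F (L0 @ K # L1)" and i: "i < k" and Bne: "Bs \<noteq> {}"
    and arcs: "\<And>b. b \<in> Bs \<Longrightarrow> arc r (T i) b (x b) (y b)"
    and xK: "\<And>b. b \<in> Bs \<Longrightarrow> x b \<in> K" and yL: "\<And>b. b \<in> Bs \<Longrightarrow> comp F (y b) \<in> set L1"
    and yinj: "\<And>b b'. b \<in> Bs \<Longrightarrow> b' \<in> Bs \<Longrightarrow> b \<noteq> b' \<Longrightarrow> comp F (y b) \<noteq> comp F (y b')"
    and small: "\<And>b. b \<in> Bs \<Longrightarrow> card (comp F (y b)) \<le> t" and tM: "2 * t < M"
  shows "\<exists>b\<in>Bs. card Bs + (M - 1 - card K) \<le> card (comp F (y b))"
proof (rule ccontr)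
  assume "\<not> (\<exists>b\<in>Bs. card Bs + (M - 1 - card K) \<le> card (comp F (y b)))"
  then have less: "card (comp F (y b)) < card Bs + (M - 1 - card K)" if "b \<in> Bs" for b
    using that by (meson not_le)
  note D = optimalD[OF o]
  note TD = treesD[OF D(3)]
  define A where "A = T i - Bs"
  define U where "U = {v\<in>V. \<not> conn A v r}"
  define X0 where "X0 = x ` Bs"
  have BT: "Bs \<subseteq> T i" using arcs by (auto simp: arc_def)
  have BE: "Bs \<subseteq> E"
  proof
    fix b assume b: "b \<in> Bs"
    show "b \<in> E" by (rule optimal_arc_real[OF o i arcs[OF b]]) (use xK[OF b] in auto)
  qed
  have BG: "Bs \<subseteq> G" using BE D(1) by auto
  have finB: "finite Bs" using BG finG finite_subset by blast
  have acA: "acyc A" using acyc_subset[OF TD(2)[OF i]] by (simp add: A_def)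
  have LV: "\<Union>(set (L0 @ K # L1)) \<subseteq> V" using legal_V[OF D(10) D(6) TD(1) D(2)] .
  have KV: "K \<subseteq> V" using LV by auto
  obtain w where w: "K = comp F w" "w \<notin> \<Union>(set L0)"
    "(L0 = [] \<and> w = r) \<or> (legal r k T F L0 \<and> (\<exists>i b z. i < k \<and> z \<in> \<Union>(set L0) \<and> arc r (T i) b z w))"
    by (rule legal_entry[OF D(10)])
  have wV: "w \<in> V" using KV w(1) by auto
  have finK: "finite K" using KV finV finite_subset by blast
  have compK: "comp F u = K" if "u \<in> K" for u using that comp_eqI w(1) by metis
  have dj: "sorted_wrt (\<lambda>A B. A \<inter> B = {}) (L0 @ K # L1)" by (rule legal_disjoint[OF D(10)])
  have L0K: "v \<notin> K" "b \<in> Bs \<Longrightarrow> v \<notin> comp F (y b)" if vL: "v \<in> \<Union>(set L0)" for v b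
  proof -
    obtain R where "R \<in> set L0" "v \<in> R" using vL by auto
    moreover have "R \<inter> R' = {}" if "R \<in> set L0" "R' \<in> set (K # L1)" for R R'
      using dj that unfolding sorted_wrt_append by blast
    ultimately show "v \<notin> K" "b \<in> Bs \<Longrightarrow> v \<notin> comp F (y b)"
      using yL[of b] by (meson disjoint_iff list.set_intros)+
  qed
  have yK: "y b \<notin> K" if "b \<in> Bs" for b
    using dj yL[OF that] comp_self[of "y b" F] unfolding sorted_wrt_append by auto
  have xsep: "\<not> conn A (x b) (x b')" if "b \<in> Bs" "b' \<in> Bs" "b \<noteq> b'" for b b'
  proof
    assume "conn A (x b) (x b')"
    then have "conn (T i - {b, b'}) (x b) (x b')" by (rule conn_mono) (use that in \<open>auto simp: A_def\<close>)
    then show False using arc_tails_separated[OF arcs[OF that(1)] arcs[OF that(2)] that(3)] by blast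
  qed
  have xinj: "inj_on x Bs" using xsep by (metis inj_onI conn_refl)
  have cX0: "card X0 = card Bs" using xinj by (simp add: X0_def card_image)
  have m: "card Bs \<ge> 1" using Bne finB by (simp add: Suc_leI card_gt_0_iff)
  have xnr: "\<not> conn A (x b) r" if "b \<in> Bs" for b
    unfolding A_def by (rule blocks_root[OF arcs[OF that] that])
  have cover: "\<exists>b\<in>Bs. conn A v (x b)" if "v \<in> V" "\<not> conn A v r" for v
    unfolding A_def
    by (rule blocks_cover[OF TD(3)[OF i that(1) D(2)] _ arcs]) (use that in \<open>simp_all add: A_def\<close>)
  have KM: "card K \<le> M" using D(9)[OF wV] w(1) by simp
  have endsB: "ends b = {x b, y b}" if "b \<in> Bs" for b using arcs[OF that] by (simp add: arc_def)
  have keep: "arc r ((T(i := A \<union> Q)) l) b z u"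
    if "acyc (A \<union> Q)" "l < k" "arc r (T l) b z u" "z \<in> V" "z \<notin> U" for Q l b z u
  proof (cases "l = i")
    case True
    have c: "conn A z r" using that by (simp add: U_def)
    have a: "arc r (T i) b z u" using that True by simp
    have "b \<in> A" using arc_not_deleted[OF a, of Bs] c a by (auto simp: A_def arc_def)
    then show ?thesis using arc_transfer[OF a _ _ c, of "A \<union> Q"] that(1) True by (auto simp: A_def)
  qed (use that in simp)
  have swapI: "swap ends V G F Q Bs x y X w"
    if "Q \<subseteq> F" "\<forall>e\<in>Q. ends e \<subseteq> K" "X0 \<subseteq> X" "X \<subseteq> K" "\<forall>u\<in>X. \<forall>v\<in>X. u \<noteq> v \<longrightarrow> \<not> conn (F - Q) u v" for Q X
    by unfold_locales
      (use that D(4,6) BG Bne wV endsB xinj yK yinj w(1) in \<open>auto simp: X0_def\<close>)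
  have un: "(\<Union>j<k. (T(i := A \<union> Q)) j) = (\<Union>j<k. T j) - Bs \<union> Q" for Q
    unfolding A_def by (rule union_swap[OF D(3) i BT])
  have F1T: "(F - Q \<union> Bs) \<inter> (\<Union>j<k. (T(i := A \<union> Q)) j) = {}" if "Q \<subseteq> F" for Q
    unfolding un using that D(7) BT i by blast
  have F1E: "F - Q \<union> Bs \<subseteq> E" for Q using D(5) BE by auto
  have EF1: "E \<subseteq> (F - Q \<union> Bs) \<union> (\<Union>j<k. (T(i := A \<union> Q)) j)" for Q
    unfolding un using D(8) by auto
  have TG: "(T(i := A \<union> Q)) j \<subseteq> G" if "Q \<subseteq> F" "j < k" for Q j
    using TD(1)[OF that(2)] TD(1)[OF i] that D(6) by (auto simp: A_def)
  \<comment> \<open>The case where \<open>K\<close> supplies only m - 1 edges: it is impossible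
    whenever an augmentation within \<open>L0\<close> closes the remaining gap. The choice of
    \<open>q\<close> decides which block stays apart from the root block.\<close>
  have two: False if q: "q \<in> U"
    and sh: "\<And>Q U'. Q \<subseteq> F \<Longrightarrow> near r k (T(i := A \<union> Q)) i U' \<Longrightarrow> U' \<subseteq> U \<Longrightarrow> q \<in> U' \<Longrightarrow>
       acyc (F - Q \<union> Bs) \<Longrightarrow> (\<And>v. v \<in> \<Union>(set L0) \<Longrightarrow> comp (F - Q \<union> Bs) v = comp F v) \<Longrightarrow>
       shrinkable r k (T(i := A \<union> Q)) (F - Q \<union> Bs) L0" for q
  proof -
    have qV: "q \<in> V" "\<not> conn A q r" using q by (auto simp: U_def)
    obtain g where g: "g \<in> Bs" "conn A q (x g)" using cover[OF qV] by blast
    let ?\<tau> = "label A X0 (x g)"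
    have gX: "x g \<in> X0" using g by (simp add: X0_def)
    have X0K: "X0 \<subseteq> K" using xK by (auto simp: X0_def)
    have sepA: "\<not> conn A u u'" if "u \<in> X0" "u' \<in> X0" "u \<noteq> u'" for u u'
      using that xsep by (auto simp: X0_def)
    have cxg: "comp F (x g) = K" by (rule compK[OF xK[OF g(1)]])
    have "\<exists>Q\<subseteq>F. (\<forall>e\<in>Q. ends e \<subseteq> comp F (x g)) \<and> (\<forall>u\<in>X0. \<forall>u'\<in>X0. u \<noteq> u' \<longrightarrow> \<not> conn (F - Q) u u') \<and>
       joins (comp F (x g)) ?\<tau> Q X0 \<and> cycle_free ?\<tau> Q"
    proof (rule separating_tree[OF _ gX D(4)])
      show "?\<tau> u = u" if "u \<in> X0" for u by (rule label_self[OF that]) (use sepA that in blast)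
      show "?\<tau> v \<in> X0" for v by (rule label_in[OF gX])
    qed (use finB X0K cxg finK in \<open>auto simp: X0_def\<close>)
    then obtain Q where Q: "Q \<subseteq> F" "\<forall>e\<in>Q. ends e \<subseteq> K" "\<forall>u\<in>X0. \<forall>u'\<in>X0. u \<noteq> u' \<longrightarrow> \<not> conn (F - Q) u u'"
      "joins K ?\<tau> Q X0" "cycle_free ?\<tau> Q" unfolding cxg by blast
    have covr: "conn A v r \<or> (\<exists>u\<in>X0. conn A v u)" if "v \<in> V" for v
      using cover[OF that] by (auto simp: X0_def)
    have X0r: "\<not> conn A u r" if "u \<in> X0" for u using xnr that by (auto simp: X0_def)
    note tb = two_blocks[OF acA covr gX g(2) qV(2) X0r KV Q(4,5) sepA]
    interpret S: swap ends V G F Q Bs x y X0 w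
      by (rule swapI[OF Q(1,2) order_refl X0K Q(3)])
    let ?F1 = "F - Q \<union> Bs" and ?T1 = "T(i := A \<union> Q)"
    define U' where "U' = {v\<in>V. \<not> conn (A \<union> Q) v r}"
    have N: "near r k ?T1 i U'"
    proof -
      have "conn (A \<union> Q) u v" if "u \<in> U'" "v \<in> U'" for u v
      proof -
        have "conn (A \<union> Q) u q" "conn (A \<union> Q) v q" using tb(3)[of u] tb(3)[of v] that by (auto simp: U'_def)
        then show ?thesis using conn_sym conn_trans by meson
      qed
      moreover have "acyc (?T1 j)" if "j < k" for j using TD(2)[OF that] tb(1) by simp
      moreover have "conn (?T1 j) u v" if "j < k" "j \<noteq> i" "u \<in> V" "v \<in> V" for j u v
        using TD(3)[OF that(1,3,4)] that(2) by simp
      moreover have "?T1 j \<inter> ?T1 l = {}" if "j < k" "l < k" "j \<noteq> l" for j l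
        by (rule swap_disjoint[OF D(3,7) i _ Q(1) that]) (simp add: A_def)
      ultimately show ?thesis
        unfolding near_def using i D(2) TG[OF Q(1)] U'_def by simp
    qed
    have U'U: "U' \<subseteq> U"
      unfolding U_def U'_def using conn_mono[of A _ r "A \<union> Q"] by auto
    have qU': "q \<in> U'" using tb(2) qV by (simp add: U'_def)
    have far: "comp ?F1 v = comp F v" if "v \<in> \<Union>(set L0)" for v
      by (rule S.comp_F1_far) (use L0K[OF that] w(1) in auto)
    have shr: "shrinkable r k ?T1 ?F1 L0"
      by (rule sh[OF Q(1) N U'U qU' S.acyc_F1 far])
    then have L0ne: "L0 \<noteq> []" by (auto simp: shrinkable_def)
    have rL0: "r \<in> \<Union>(set L0)"
    proof -
      have "comp F r \<in> set L0" using legal_nonempty[OF D(10)] L0ne by (metis hd_append2 hd_in_set)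
      then show ?thesis by auto
    qed
    have le: "card (S.P b) + card Bs \<le> card K + 1 + card (comp F (y b))" if "b \<in> Bs" for b
      using S.card_P[OF that] cX0 w(1) by simp
    \<comment> \<open>For \<open>card K = M\<close> the truncated difference
      \<open>M - 1 - card K\<close> is 0 and not -1, so a new component may have size
      \<open>M\<close>; by \<open>tM\<close> there is at most one, and it replaces \<open>K\<close>.
      For smaller \<open>K\<close> all \<open>P b\<close> stay below \<open>M\<close>.\<close>
    have "(\<forall>v\<in>V. card (comp ?F1 v) \<le> M) \<and> card (big M ?F1) \<le> card (big M F)"
    proof (cases "card K = M")
      case True
      have PM: "card (S.P b) \<le> M" if "b \<in> Bs" for b
        using le[OF that] less[OF that] True by simp
      have P2: "card (S.P b) < M \<or> card (S.P b') < M" if "b \<in> Bs" "b' \<in> Bs" "b \<noteq> b'" for b b'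
        using S.card_two_P[OF that] small[OF that(1)] small[OF that(2)] tM True[unfolded w(1)] by linarith
      show ?thesis
        using S.swap_bounded[OF D(9) PM] S.swap_big_card[OF _ PM P2] True w(1) by simp
    next
      case False
      have PM: "card (S.P b) < M" if "b \<in> Bs" for b
        using le[OF that] less[OF that] False KM by linarith
      have "big M ?F1 \<subseteq> big M F" using S.swap_big_subset[OF D(9) PM] by auto
      moreover have "finite (big M F)" using finV by (simp add: big_def)
      ultimately show ?thesis
        using S.swap_bounded[OF D(9) less_imp_le[OF PM]] card_mono by blast
    qed
    then show False
      using optimal_not_shrinkable[OF o shr S.acyc_F1 F1E _ _ F1T[OF Q(1)] EF1 far[OF rL0]]
      unfolding bounded_def by blast
  qed
  show False
  proof (cases "\<Union>(set L0) \<inter> U = {}")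
    case False
    then have "\<exists>R\<in>set L0. R \<inter> U \<noteq> {}" by auto
    then obtain La Ra Lb where L: "L0 = La @ Ra # Lb" "Ra \<inter> U \<noteq> {}" "\<forall>R\<in>set La. \<not> R \<inter> U \<noteq> {}"
      using split_list_first_prop[of L0 "\<lambda>R. R \<inter> U \<noteq> {}"] by auto
    obtain q where q: "q \<in> Ra" "q \<in> U" using L by auto
    show False
    proof (rule two[OF q(2)])
      fix Q U' assume Q: "Q \<subseteq> F" and N: "near r k (T(i := A \<union> Q)) i U'" and U': "U' \<subseteq> U" "q \<in> U'"
        and ac: "acyc (F - Q \<union> Bs)" and far: "\<And>v. v \<in> \<Union>(set L0) \<Longrightarrow> comp (F - Q \<union> Bs) v = comp F v"
      have acX: "acyc (A \<union> Q)" using nearD(6)[OF N i] by simp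
      have l: "legal r k T F (La @ Ra # (Lb @ K # L1))" using D(10) L(1) by simp
      obtain wa where wa: "Ra = comp F wa" "wa \<notin> \<Union>(set La)"
        "(La = [] \<and> wa = r) \<or> (legal r k T F La \<and> (\<exists>i b z. i < k \<and> z \<in> \<Union>(set La) \<and> arc r (T i) b z wa))"
        by (rule legal_entry[OF l])
      have "legal r k (T(i := A \<union> Q)) (F - Q \<union> Bs) (La @ [comp (F - Q \<union> Bs) wa])"
      proof (rule legal_replace[OF wa(3,2)])
        fix l b z u assume a: "l < k" "arc r (T l) b z u" "z \<in> \<Union>(set La)"
        show "arc r ((T(i := A \<union> Q)) l) b z u"
          by (rule keep[OF acX a(1,2)]) (use a(3) L LV in auto)
      qed (use far L in auto)
      moreover have "comp (F - Q \<union> Bs) wa = Ra" using far[of wa] wa(1) L by auto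
      ultimately have "legal r k (T(i := A \<union> Q)) (F - Q \<union> Bs) (La @ [Ra])" by simp
      then have "shrinkable r k (T(i := A \<union> Q)) (F - Q \<union> Bs) (La @ [Ra])"
      proof (rule augment[OF _ N ac _ F1T[OF Q] _ q(1) U'(2)])
        show "F - Q \<union> Bs \<subseteq> G" using F1E D(1) by blast
        show "\<Union>(set La) \<inter> U' = {}" using L(3) U' by auto
      qed
      then show "shrinkable r k (T(i := A \<union> Q)) (F - Q \<union> Bs) L0"
        using shrinkable_append[of r k _ _ "La @ [Ra]" Lb] L(1) by simp
    qed
  next
    case dis: True
    show False
    proof (cases "w \<in> U")
      case True
      then have "w \<noteq> r" by (auto simp: U_def)
      then obtain j b z where a: "legal r k T F L0" "j < k" "z \<in> \<Union>(set L0)" "arc r (T j) b z w"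
        using w(3) by blast
      have z: "z \<in> V" "z \<notin> U" using a(3) LV dis by auto
      have ji: "j \<noteq> i"
      proof
        assume ji: "j = i"
        have c: "conn A z r" using z by (simp add: U_def)
        have ai: "arc r (T i) b z w" using a ji by simp
        then have "b \<in> A" using arc_not_deleted[OF ai, of Bs] c by (auto simp: A_def arc_def)
        then have "conn A z w" using ai conn_edge[of b A z w] by (simp add: arc_def)
        then have "conn A w r" using c conn_sym conn_trans by meson
        then show False using True by (simp add: U_def)
      qed
      show False
      proof (rule two[OF True])
        fix Q U' assume Q: "Q \<subseteq> F" and N: "near r k (T(i := A \<union> Q)) i U'" and U': "U' \<subseteq> U" "w \<in> U'"
          and ac: "acyc (F - Q \<union> Bs)" and far: "\<And>v. v \<in> \<Union>(set L0) \<Longrightarrow> comp (F - Q \<union> Bs) v = comp F v"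
        have acX: "acyc (A \<union> Q)" using nearD(6)[OF N i] by simp
        have l: "legal r k (T(i := A \<union> Q)) (F - Q \<union> Bs) L0"
        proof (rule legal_transfer[OF a(1) _ far])
          fix l b z u assume a: "l < k" "arc r (T l) b z u" "z \<in> \<Union>(set L0)"
          show "arc r ((T(i := A \<union> Q)) l) b z u"
            by (rule keep[OF acX a(1,2)]) (use a(3) LV dis in auto)
        qed
        show "shrinkable r k (T(i := A \<union> Q)) (F - Q \<union> Bs) L0"
        proof (rule augment_arc[OF l N ac _ F1T[OF Q] _ a(2) _ a(3) U'(2)])
          show "F - Q \<union> Bs \<subseteq> G" using F1E D(1) by blast
          show "\<Union>(set L0) \<inter> U' = {}" using dis U' by auto
          show "arc r ((T(i := A \<union> Q)) j) b z w" using a(4) ji by simp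
        qed
      qed
    next
      case wU: False
      have wr: "conn A w r" using wU wV by (simp add: U_def)
      \<comment> \<open>Here \<open>w\<close> lies in the root block and serves as one more
        terminal. So \<open>K\<close> supplies all m red edges, and the piece around
        \<open>w\<close> replaces \<open>K\<close> in the list.\<close>
      define X where "X = insert w X0"
      have wX0: "w \<notin> X0" using xnr wr by (auto simp: X0_def)
      have cX: "card X = card Bs + 1" using wX0 cX0 finB by (simp add: X_def X0_def)
      have XK: "X \<subseteq> K" using xK w(1) by (auto simp: X_def X0_def)
      have wX: "w \<in> X" by (simp add: X_def)
      have sepA: "\<not> conn A u u'" if "u \<in> X" "u' \<in> X" "u \<noteq> u'" for u u'
      proof -
        have "\<not> conn A w (x b)" "\<not> conn A (x b) w" if "b \<in> Bs" for b
          using xnr[OF that] wr conn_sym conn_trans by meson+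
        then show ?thesis using that xsep by (auto simp: X_def X0_def)
      qed
      let ?\<tau> = "label A X w"
      have "\<exists>Q\<subseteq>F. (\<forall>e\<in>Q. ends e \<subseteq> comp F w) \<and> (\<forall>u\<in>X. \<forall>u'\<in>X. u \<noteq> u' \<longrightarrow> \<not> conn (F - Q) u u') \<and>
         joins (comp F w) ?\<tau> Q X \<and> cycle_free ?\<tau> Q"
      proof (rule separating_tree[OF _ wX D(4)])
        show "?\<tau> u = u" if "u \<in> X" for u by (rule label_self[OF that]) (use sepA that in blast)
        show "?\<tau> v \<in> X" for v by (rule label_in[OF wX])
      qed (use finB XK w(1) finK in \<open>auto simp: X_def X0_def\<close>)
      then obtain Q where Q: "Q \<subseteq> F" "\<forall>e\<in>Q. ends e \<subseteq> K" "\<forall>u\<in>X. \<forall>u'\<in>X. u \<noteq> u' \<longrightarrow> \<not> conn (F - Q) u u'"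
        "joins K ?\<tau> Q X" "cycle_free ?\<tau> Q" unfolding w(1)[symmetric] by blast
      have covX: "\<exists>u\<in>X. conn A v u" if "v \<in> V" for v
      proof (cases "conn A v r")
        case True
        then have "conn A v w" using wr conn_sym conn_trans by meson
        then show ?thesis using wX by blast
      next
        case False
        then show ?thesis using cover[OF that] by (auto simp: X_def X0_def)
      qed
      have ob1: "acyc (A \<union> Q)" by (rule one_block(1)[OF acA covX KV Q(4,5)])
      have ob2: "conn (A \<union> Q) u v" if "u \<in> V" "v \<in> V" for u v
        by (rule one_block(2)[OF acA covX KV Q(4,5) that])
      interpret S: swap ends V G F Q Bs x y X w
        by (rule swapI[OF Q(1,2) _ XK Q(3)]) (auto simp: X_def)
      let ?F1 = "F - Q \<union> Bs" and ?T1 = "T(i := A \<union> Q)"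
      have T1: "trees k ?T1"
      proof -
        have "acyc (?T1 j)" if "j < k" for j using TD(2)[OF that] ob1 by simp
        moreover have "conn (?T1 j) u v" if "j < k" "u \<in> V" "v \<in> V" for j u v
          using TD(3)[OF that] ob2[OF that(2,3)] by simp
        moreover have "?T1 j \<inter> ?T1 l = {}" if "j < k" "l < k" "j \<noteq> l" for j l
          by (rule swap_disjoint[OF D(3,7) i _ Q(1) that]) (simp add: A_def)
        ultimately show ?thesis unfolding trees_def using TG[OF Q(1)] by simp
      qed
      have far: "comp ?F1 v = comp F v" if "v \<in> \<Union>(set L0)" for v
        by (rule S.comp_F1_far[OF L0K(1)[OF that, unfolded w(1)] L0K(2)[OF that]])
      have st: "state k E ?T1 ?F1"
        unfolding state_def by (intro conjI T1 S.acyc_F1 F1E F1T[OF Q(1)] EF1)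
      have PM: "card (S.P b) < M" if "b \<in> Bs" for b
        using S.card_P[OF that] less[OF that] KM w(1) cX m by simp
      have bd: "bounded M ?F1"
        unfolding bounded_def using S.swap_bounded[OF D(9) less_imp_le[OF PM]] by blast
      have bs: "big M ?F1 \<subseteq> big M F - K" using S.swap_big_subset[OF D(9) PM] w(1) by simp
      have finb: "finite (big M F)" using finV by (simp add: big_def)
      have "big M ?F1 \<subseteq> big M F" using bs by auto
      then have b1: "card (big M ?F1) \<le> card (big M F)" by (rule card_mono[OF finb])
      have b2: "card (big M ?F1) < card (big M F)" if "L0 = []"
      proof -
        have "w = r" using that w(3) legal_nonempty by blast
        then have "w \<in> big M F" using D(11) wV by (simp add: big_def)
        moreover have "w \<notin> big M ?F1" using bs w(1) by auto
        ultimately have "big M ?F1 \<subset> big M F" using bs by auto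
        then show ?thesis by (rule psubset_card_mono[OF finb])
      qed
      have l: "legal r k ?T1 ?F1 (L0 @ [comp ?F1 w])"
      proof (rule legal_replace[OF w(3,2) _ far])
        fix l b z u assume a: "l < k" "arc r (T l) b z u" "z \<in> \<Union>(set L0)"
        show "arc r (?T1 l) b z u"
          by (rule keep[OF ob1 a(1,2)]) (use a(3) LV dis in auto)
      qed
      have "w \<notin> S.P b" if b: "b \<in> Bs" for b
      proof
        assume "w \<in> S.P b"
        moreover have "w \<notin> comp F (y b)" using yK[OF b] comp_eqI[of w F "y b"] w(1) by (metis comp_self)
        ultimately have "conn (F - Q) (x b) w" by (auto simp: S.P_def comp_def)
        moreover have "x b \<in> X" "x b \<noteq> w" using b wX0 by (auto simp: X_def X0_def)
        ultimately show False using Q(3) wX by blast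
      qed
      then have "comp ?F1 w = comp (F - Q) w" by (rule S.comp_F1_other)
      then have "card (comp ?F1 w) < card K" using S.card_piece[OF wX] cX m w(1) by simp
      moreover have "card K \<le> card (comp ?F1 w)" by (rule optimal_list[OF o st bd b1 b2 l])
      ultimately show False by simp
    qed
  qed
qed

end

section \<open>Counting\<close>

lemma lexn_nthI:
  assumes "length xs = n" "length ys = n" "j < n" "\<And>i. i < j \<Longrightarrow> xs ! i = ys ! i" "xs ! j < ys ! (j::nat)"
  shows "(xs, ys) \<in> lexn less_than n"
proof -
  have "xs = take j xs @ xs ! j # drop (Suc j) xs" "ys = take j ys @ ys ! j # drop (Suc j) ys"
    using assms by (simp_all add: id_take_nth_drop)
  moreover have "take j xs = take j ys" using assms by (intro nth_take_lemma) auto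
  ultimately have "\<exists>xys x y xs' ys'. xs = xys @ x # xs' \<and> ys = xys @ y # ys' \<and> (x, y) \<in> less_than"
    using assms(5) by (metis less_than_iff)
  then show ?thesis using assms(1,2) by (simp add: lexn_conv)
qed

text \<open>The hypothesis on subsets forces the sizes, in increasing order, to be at least
  \<open>\<delta> + 1\<close>, \<open>\<delta> + 2\<close> and so on, which bounds the deficits by
  the steps of a staircase.\<close>

lemma sum_staircase:
  fixes a :: real
  assumes "finite S" and sub: "\<And>S'. S' \<subseteq> S \<Longrightarrow> S' \<noteq> {} \<Longrightarrow> \<exists>C\<in>S'. card S' + \<delta> \<le> f C"
    and le: "\<And>C. C \<in> S \<Longrightarrow> f C \<le> t" and a: "real t < a + 1"
  shows "(\<Sum>C\<in>S. a - (real (f C) - 1)) \<le> (\<Sum>j<t - \<delta>. a - real \<delta> - real j)"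
proof -
  have "(\<Sum>C\<in>S. a - (real (f C) - 1)) \<le> (\<Sum>j<card S. a - real \<delta> - real j)"
    using assms(1) sub
  proof (induction "card S" arbitrary: S)
    case 0
    then show ?case by simp
  next
    case (Suc m)
    have "S \<noteq> {}" using Suc.hyps(2) by auto
    then obtain C where C: "C \<in> S" "card S + \<delta> \<le> f C" using Suc.prems(2)[of S] by auto
    have cm: "card (S - {C}) = m" using Suc.hyps(2) C(1) Suc.prems(1) by simp
    have IH: "(\<Sum>C\<in>S - {C}. a - (real (f C) - 1)) \<le> (\<Sum>j<card (S - {C}). a - real \<delta> - real j)"
      by (rule Suc.hyps(1)) (use cm Suc.prems in auto)
    have "(\<Sum>C\<in>S. a - (real (f C) - 1)) = (a - (real (f C) - 1)) + (\<Sum>C\<in>S - {C}. a - (real (f C) - 1))"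
      using C(1) Suc.prems(1) by (rule sum.remove[rotated])
    also have "\<dots> \<le> (a - real \<delta> - real m) + (\<Sum>j<m. a - real \<delta> - real j)"
      using IH C(2) Suc.hyps(2) cm by simp
    finally show ?case unfolding Suc.hyps(2)[symmetric] by simp
  qed
  \<comment> \<open>The missing steps up to \<open>t - \<delta>\<close> are nonnegative because
    \<open>t < a + 1\<close>, so the full staircase is an upper bound.\<close>
  also have "\<dots> \<le> (\<Sum>j<t - \<delta>. a - real \<delta> - real j)"
  proof (rule sum_mono2)
    show "{..<card S} \<subseteq> {..<t - \<delta>}"
    proof (cases "S = {}")
      case False
      then obtain C where "C \<in> S" "card S + \<delta> \<le> f C" using sub[of S] by auto
      then show ?thesis using le[of C] by auto
    qed simp
    show "0 \<le> a - real \<delta> - real j" if "j \<in> {..<t - \<delta>} - {..<card S}" for j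
    proof -
      have "j + \<delta> + 1 \<le> t" using that by auto
      then have "real j + real \<delta> + 1 \<le> real t" by linarith
      then show ?thesis using a by simp
    qed
  qed simp
  finally show ?thesis .
qed

context multigr
begin

lemma optimal_exists:
  assumes E: "E \<subseteq> G" and s0: "state k E T0 F0" and no: "\<And>T F. state k E T F \<Longrightarrow> \<not> bounded N F"
  obtains r M T F L where "N < M" "optimal r k E M T F L"
proof -
  define n where "n = card V"
  have FG: "F \<subseteq> G" if "state k E T F" for T F using that E by (auto simp: state_def)
  have cV: "card (comp F v) \<le> n" if "state k E T F" "v \<in> V" for T F v
    unfolding n_def using comp_V[OF FG[OF that(1)] that(2)] finV by (rule card_mono[rotated])
  define M where "M = (LEAST M. \<exists>T F. state k E T F \<and> bounded M F)"
  have "\<exists>T F. state k E T F \<and> bounded n F" using s0 cV unfolding bounded_def by blast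
  then have ex: "\<exists>T F. state k E T F \<and> bounded M F"
    unfolding M_def by (rule LeastI[of "\<lambda>M. \<exists>T F. state k E T F \<and> bounded M F"])
  have leM: "M \<le> M'" if "state k E T F" "bounded M' F" for M' T F
    unfolding M_def by (rule Least_le) (use that in blast)
  have NM: "N < M"
  proof (rule ccontr)
    assume "\<not> N < M"
    then have "bounded M F \<Longrightarrow> bounded N F" for F unfolding bounded_def by (meson le_trans not_le)
    then show False using ex no by blast
  qed
  have bigne: "\<exists>v\<in>V. card (comp F v) = M" if st: "state k E T F" "bounded M F" for T F
  proof (rule ccontr)
    assume "\<not> (\<exists>v\<in>V. card (comp F v) = M)"
    then have "card (comp F v) \<le> M - 1" if "v \<in> V" for v
      using st(2) that unfolding bounded_def by (metis Suc_pred' diff_is_0_eq le_0_eq le_SucE nat_less_le not_gr_zero NM not_less0)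
    then have "bounded (M - 1) F" by (simp add: bounded_def)
    then show False using leM[OF st(1)] NM by fastforce
  qed
  obtain T1 F1 where m1: "state k E T1 F1" "bounded M F1"
    and min: "\<And>T F. state k E T F \<Longrightarrow> bounded M F \<Longrightarrow> card (big M F1) \<le> card (big M F)"
  proof -
    obtain z where "(\<lambda>(T, F). state k E T F \<and> bounded M F) z"
      "\<forall>y. (\<lambda>(T, F). state k E T F \<and> bounded M F) y \<longrightarrow> card (big M (snd z)) \<le> card (big M (snd y))"
      using ex_has_least_nat[of "\<lambda>(T, F). state k E T F \<and> bounded M F" _ "\<lambda>z. card (big M (snd z))"] ex
      by (metis (mono_tags, lifting) case_prodI)
    then show thesis using that[of "fst z" "snd z"] by (auto simp: case_prod_beta)
  qed
  define Z where "Z = {(T, F, r, L). rooted_state r k E M T F L \<and> card (big M F) = card (big M F1)}"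
  \<comment> \<open>Keys are padded to length \<open>n\<close> with \<open>Suc n\<close>, more than
    any component size, so that extending a list lowers its key. This gives the closure under
    arcs.\<close>
  define key where "key L = map (\<lambda>i. if i < length L then card (L ! i) else Suc n) [0..<n]" for L :: "'v set list"
  have lkey: "length (key L) = n" for L by (simp add: key_def)
  obtain r1 where "r1 \<in> V" "card (comp F1 r1) = M" using bigne[OF m1] by blast
  then have "(T1, F1, r1, [comp F1 r1]) \<in> Z"
    unfolding Z_def rooted_state_def using E m1 by (simp add: legal.root)
  moreover have "wf (inv_image (lexn less_than n) (\<lambda>(T, F, r, L). key L) ::
      (((nat \<Rightarrow> 'a set) \<times> 'a set \<times> 'v \<times> 'v set list) \<times> _) set)"
    by (intro wf_inv_image wf_lexn wf_less_than)
  ultimately obtain z where z: "z \<in> Z"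
    "\<And>z'. (z', z) \<in> inv_image (lexn less_than n) (\<lambda>(T, F, r, L). key L) \<Longrightarrow> z' \<notin> Z"
    by (metis wfE_min)
  obtain T F r L where zeq: "z = (T, F, r, L)" by (cases z)
  have rs: "rooted_state r k E M T F L" and bg: "card (big M F) = card (big M F1)"
    using z(1) by (auto simp: Z_def zeq)
  have kmin: "(key L', key L) \<notin> lexn less_than n"
    if "rooted_state r k E M T' F' L'" "card (big M F') = card (big M F)" for T' F' L'
  proof
    assume "(key L', key L) \<in> lexn less_than n"
    then have "(T', F', r, L') \<notin> Z" by (intro z(2)) (simp add: zeq)
    then show False using that bg by (simp add: Z_def)
  qed
  have len: "length L' \<le> n" if "rooted_state r k E M T' F' L'" for T' F' L'
  proof -
    have s: "state k E T' F'" "legal r k T' F' L'" "r \<in> V" using that by (auto simp: rooted_state_def)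
    then have T': "trees k T'" by (simp add: state_def)
    show ?thesis unfolding n_def by (rule legal_length[OF s(2) FG[OF s(1)] treesD(1)[OF T'] s(3)])
  qed
  have st: "state k E T F" and l: "legal r k T F L" and rV: "r \<in> V" and bd: "bounded M F" and cr: "card (comp F r) = M"
    using rs by (auto simp: rooted_state_def)
  have o1: "card (big M F) \<le> card (big M F')" if "state k E T' F'" "bounded M F'" for T' F'
    using min[OF that] bg by simp
  have o2: "card R \<le> card R'"
    if L: "L = L0 @ R # L1" and b: "card (big M F') = card (big M F)" and rs': "rooted_state r k E M T' F' (L0 @ [R'])"
    for T' F' L0 R L1 R'
  proof (rule ccontr)
    assume "\<not> card R \<le> card R'"
    then have lt: "card R' < card R" by simp
    have j: "length L0 < n" using len[OF rs'] by simp
    have "(key (L0 @ [R']), key L) \<in> lexn less_than n"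
    proof (rule lexn_nthI[OF lkey lkey j])
      show "key (L0 @ [R']) ! i = key L ! i" if "i < length L0" for i
        using that j L by (simp add: key_def nth_append)
      show "key (L0 @ [R']) ! length L0 < key L ! length L0"
        using lt j L by (simp add: key_def nth_append)
    qed
    then show False using kmin[OF rs' b] by simp
  qed
  have o3: "u \<in> \<Union>(set L)" if a: "i < k" "arc r (T i) b z' u" "z' \<in> \<Union>(set L)" for i b z' u
  proof (rule ccontr)
    assume u: "u \<notin> \<Union>(set L)"
    have l': "legal r k T F (L @ [comp F u])" by (rule legal.step[OF l a(1,3,2) u])
    then have rs': "rooted_state r k E M T F (L @ [comp F u])"
      using rs unfolding rooted_state_def by blast
    have j: "length L < n" using len[OF rs'] by simp
    have T: "trees k T" using st by (simp add: state_def)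
    have "u \<in> V" using legal_V[OF l' FG[OF st] treesD(1)[OF T] rV] by auto
    then have cu: "card (comp F u) \<le> n" by (rule cV[OF st])
    have "(key (L @ [comp F u]), key L) \<in> lexn less_than n"
    proof (rule lexn_nthI[OF lkey lkey j])
      show "key (L @ [comp F u]) ! i = key L ! i" if "i < length L" for i
        using that j by (simp add: key_def nth_append)
      show "key (L @ [comp F u]) ! length L < key L ! length L"
        using cu j by (simp add: key_def nth_append)
    qed
    then show False using kmin[OF rs' refl] by simp
  qed
  have "optimal r k E M T F L"
    unfolding optimal_def using rs o1 o2 o3 by blast
  then show thesis using that NM by blast
qed

text \<open>Only later members count, because the exchange behind \<open>exchange_bound\<close> has
  to leave the members before position \<open>s\<close> unchanged.\<close>

definition children :: "nat \<Rightarrow> 'v \<Rightarrow> 'a set \<Rightarrow> 'v set list \<Rightarrow> nat \<Rightarrow> 'v set set" where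
  "children t r A L s = {C \<in> set (drop (Suc s) L). card C \<le> t \<and> (\<exists>b z y. arc r A b z y \<and> z \<in> L ! s \<and> y \<in> C)}"

lemma children_staircase:
  assumes o: "optimal r k E M T F L" and i: "i < k" and s: "s < length L" and tM: "2 * t < M"
    and S': "S' \<subseteq> children t r (T i) L s" "S' \<noteq> {}"
  shows "\<exists>C\<in>S'. card S' + (M - 1 - card (L ! s)) \<le> card C"
proof -
  note D = optimalD[OF o]
  have L: "L = take s L @ L ! s # drop (Suc s) L" using s by (rule id_take_nth_drop)
  have ex: "\<exists>w. arc r (T i) (fst w) (fst (snd w)) (snd (snd w)) \<and> fst (snd w) \<in> L ! s \<and> snd (snd w) \<in> C"
    if "C \<in> S'" for C
    using S'(1) that unfolding children_def by fastforce
  define w where "w C = (SOME w. arc r (T i) (fst w) (fst (snd w)) (snd (snd w)) \<and> fst (snd w) \<in> L ! s \<and> snd (snd w) \<in> C)" for C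
  define bb where "bb C = fst (w C)" for C
  define xx where "xx C = fst (snd (w C))" for C
  define yy where "yy C = snd (snd (w C))" for C
  have w: "arc r (T i) (bb C) (xx C) (yy C)" "xx C \<in> L ! s" "yy C \<in> C" if "C \<in> S'" for C
    using someI_ex[OF ex[OF that]] unfolding bb_def xx_def yy_def w_def by blast+
  have CL: "C \<in> set (drop (Suc s) L)" "card C \<le> t" if "C \<in> S'" for C
    using S'(1) that by (auto simp: children_def)
  have compC: "comp F (yy C) = C" if "C \<in> S'" for C
  proof -
    have "C \<in> set L" using CL(1)[OF that] by (meson in_set_dropD)
    then obtain v where "C = comp F v" using legal_members[OF D(10)] by blast
    then show ?thesis using comp_eqI w(3)[OF that] by metis
  qed
  have inj: "inj_on bb S'"
  proof (rule inj_onI)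
    fix C C' assume C: "C \<in> S'" "C' \<in> S'" "bb C = bb C'"
    then have "yy C = yy C'" using arc_unique[OF w(1)[OF C(1)], of "xx C'" "yy C'"] w(1)[OF C(2)] by simp
    then show "C = C'" using compC C by metis
  qed
  define h where "h = the_inv_into S' bb"
  have h: "h (bb C) = C" if "C \<in> S'" for C unfolding h_def by (rule the_inv_into_f_f[OF inj that])
  have "\<exists>b\<in>bb ` S'. card (bb ` S') + (M - 1 - card (L ! s)) \<le> card (comp F (yy (h b)))"
  proof (rule exchange_bound[where i = i and x = "\<lambda>b. xx (h b)" and t = t])
    show "optimal r k E M T F (take s L @ L ! s # drop (Suc s) L)" using o L by simp
  next
    fix b b' assume b: "b \<in> bb ` S'" "b' \<in> bb ` S'" "b \<noteq> b'"
    then show "comp F (yy (h b)) \<noteq> comp F (yy (h b'))" using h compC by auto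
  qed (use i S'(2) w h compC CL tM in auto)
  then show ?thesis using h compC card_image[OF inj] by auto
qed

text \<open>The deficit of each small member is charged to an earlier member from which an arc
  enters it. By \<open>children_staircase\<close> a member is charged at most \<open>k\<close>
  staircases, and \<open>ar\<close> says that its own surplus pays for them.\<close>

lemma optimal_average:
  fixes a :: real
  assumes o: "optimal r k E M T F L" and tM: "2 * t < M" and t: "a \<le> real t" "real t < a + 1" and lM: "l + 2 \<le> M"
    and ar: "\<And>\<delta>. \<delta> < t \<Longrightarrow> real k * (\<Sum>j<t - \<delta>. a - real \<delta> - real j) \<le> real l - real \<delta> - a"
  shows "a * real (length L) \<le> real (\<Sum>R\<in>set L. card R - 1)"
proof -
  note D = optimalD[OF o]
  define g where "g C = a - (real (card C) - 1)" for C :: "'v set"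
  define Sm where "Sm = {C \<in> set L. card C \<le> t}"
  have dist: "distinct L" by (rule legal_distinct[OF D(10)])
  have LV: "\<Union>(set L) \<subseteq> V" using legal_V[OF D(10,6) treesD(1)[OF D(3)] D(2)] .
  have card1: "card C \<ge> 1" if "C \<in> set L" for C
  proof -
    have "C \<noteq> {}" using legal_members[OF D(10) that] by auto
    moreover have "finite C" using LV that finV by (meson Union_upper finite_subset)
    ultimately show ?thesis by (simp add: Suc_leI card_gt_0_iff)
  qed
  have gpos: "g C \<ge> 0" if "card C \<le> t" for C
    using that t(2) unfolding g_def by linarith
  have finch: "finite (children t r A L s)" for A s by (simp add: children_def)
  have chsum: "(\<Sum>C\<in>children t r (T i) L s. g C) \<le> (\<Sum>j<t - (M - 1 - card (L ! s)). a - real (M - 1 - card (L ! s)) - real j)"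
    if "i < k" "s < length L" for i s
    unfolding g_def
  proof (rule sum_staircase[OF finch _ _ t(2)])
    show "\<exists>C\<in>S'. card S' + (M - 1 - card (L ! s)) \<le> card C"
      if "S' \<subseteq> children t r (T i) L s" "S' \<noteq> {}" for S'
      by (rule children_staircase[OF o \<open>i < k\<close> \<open>s < length L\<close> tM that])
  qed (simp add: children_def)
  have block: "(\<Sum>i<k. \<Sum>C\<in>children t r (T i) L s. g C) \<le> (if card (L ! s) \<le> t then 0 else - g (L ! s))"
    if s: "s < length L" for s
  proof -
    define \<delta> where "\<delta> = M - 1 - card (L ! s)"
    have "(\<Sum>i<k. \<Sum>C\<in>children t r (T i) L s. g C) \<le> (\<Sum>i<k. \<Sum>j<t - \<delta>. a - real \<delta> - real j)"
      by (rule sum_mono) (use chsum s in \<open>simp add: \<delta>_def\<close>)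
    then have *: "(\<Sum>i<k. \<Sum>C\<in>children t r (T i) L s. g C) \<le> real k * (\<Sum>j<t - \<delta>. a - real \<delta> - real j)" by simp
    show ?thesis
    proof (cases "card (L ! s) \<le> t")
      case True
      \<comment> \<open>The staircase below a small member has no steps, since
        \<open>2 * t < M\<close> makes \<open>\<delta>\<close> at least \<open>t\<close>.\<close>
      then have "t - \<delta> = 0" using tM by (simp add: \<delta>_def)
      then show ?thesis using * True by simp
    next
      case False
      show ?thesis
      proof (cases "\<delta> < t")
        case True
        have "l - \<delta> \<le> card (L ! s) - 1" using lM False by (simp add: \<delta>_def)
        then have "real l - real \<delta> \<le> real (card (L ! s)) - 1" using False by linarith
        then show ?thesis using * ar[OF True] False by (simp add: g_def)
      next
        case d: False
        then have "(\<Sum>i<k. \<Sum>C\<in>children t r (T i) L s. g C) \<le> 0" using * by simp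
        moreover have "real (card (L ! s)) \<ge> real t + 1" using False by linarith
        ultimately show ?thesis using False t(1) by (simp add: g_def)
      qed
    qed
  qed
  define I where "I = (SIGMA s:{..<length L}. SIGMA i:{..<k}. children t r (T i) L s)"
  have Smin: "\<exists>p\<in>I. snd (snd p) = C" if C: "C \<in> Sm" for C
  proof -
    obtain j where j: "j < length L" "L ! j = C" using C by (auto simp: Sm_def in_set_conv_nth)
    have L: "L = take j L @ C # drop (Suc j) L" using id_take_nth_drop[OF j(1)] j(2) by simp
    have l: "legal r k T F (take j L @ C # drop (Suc j) L)" using D(10) L by simp
    obtain w where w: "C = comp F w"
      "(take j L = [] \<and> w = r) \<or> (legal r k T F (take j L) \<and> (\<exists>i b z. i < k \<and> z \<in> \<Union>(set (take j L)) \<and> arc r (T i) b z w))"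
      by (rule legal_entry[OF l])
    have "w \<noteq> r" using w(1) C D(11) tM by (auto simp: Sm_def)
    then obtain i b z where a: "i < k" "z \<in> \<Union>(set (take j L))" "arc r (T i) b z w" using w(2) by blast
    then obtain s where s: "s < j" "z \<in> L ! s" by (auto simp: in_set_conv_nth)
    have "C \<in> set (drop (Suc s) L)"
    proof -
      have "drop (Suc s) L ! (j - Suc s) = C" using s(1) j by simp
      moreover have "j - Suc s < length (drop (Suc s) L)" using s(1) j(1) by simp
      ultimately show ?thesis by (metis nth_mem)
    qed
    then have "C \<in> children t r (T i) L s"
      using a(3) s(2) w(1) C unfolding children_def Sm_def by auto
    then have "(s, i, C) \<in> I" using s(1) j(1) a(1) by (simp add: I_def)
    then show ?thesis by force
  qed
  \<comment> \<open>A small member may be a child of several members or through several trees; as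
    its deficit is nonnegative, counting it repeatedly does no harm.\<close>
  have "(\<Sum>C\<in>Sm. g C) \<le> (\<Sum>p\<in>I. g (snd (snd p)))"
  proof (rule sum_le_included[where i = "\<lambda>p. snd (snd p)"])
    show "finite Sm" by (simp add: Sm_def)
    show "finite I" unfolding I_def by (intro finite_SigmaI finch) auto
    show "\<forall>p\<in>I. 0 \<le> g (snd (snd p))" using gpos by (auto simp: I_def children_def)
    show "\<forall>C\<in>Sm. \<exists>p\<in>I. snd (snd p) = C \<and> g C \<le> g (snd (snd p))" using Smin by fastforce
  qed
  also have "\<dots> = (\<Sum>s<length L. \<Sum>i<k. \<Sum>C\<in>children t r (T i) L s. g C)"
    unfolding I_def by (simp add: sum.Sigma finch finite_SigmaI case_prod_beta)
  also have "\<dots> \<le> (\<Sum>s<length L. if card (L ! s) \<le> t then 0 else - g (L ! s))"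
    by (rule sum_mono) (use block in auto)
  also have "\<dots> = (\<Sum>C\<in>set L. if card C \<le> t then 0 else - g C)"
    by (rule sum.reindex_bij_betw[OF bij_betw_nth[OF dist refl refl]])
  finally have 1: "(\<Sum>C\<in>Sm. g C) \<le> (\<Sum>C\<in>set L. if card C \<le> t then 0 else - g C)" .
  have "(\<Sum>C\<in>Sm. g C) = (\<Sum>C\<in>set L. if card C \<le> t then g C else 0)"
    unfolding Sm_def by (simp add: sum.inter_filter)
  then have "0 \<le> (\<Sum>C\<in>set L. (if card C \<le> t then 0 else - g C) - (if card C \<le> t then g C else 0))"
    using 1 by (simp add: sum_subtractf)
  also have "\<dots> = (\<Sum>C\<in>set L. - g C)" by (rule sum.cong) auto
  also have "\<dots> = (\<Sum>C\<in>set L. real (card C - 1) - a)"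
    by (rule sum.cong) (use card1 in \<open>auto simp: g_def of_nat_diff\<close>)
  also have "\<dots> = real (\<Sum>C\<in>set L. card C - 1) - a * real (length L)"
    by (simp add: sum_subtractf distinct_card[OF dist])
  finally show ?thesis by simp
qed

end

lemma sum_arith: "(\<Sum>j<n. c - real j) = real n * c - real n * (real n - 1) / 2"
  by (induction n) (auto simp: field_simps)

text \<open>For \<open>\<delta> = 0\<close> the bound on \<open>l\<close> is exactly what is needed.
  For larger \<open>\<delta>\<close> the first \<open>\<delta>\<close> steps of the full staircase
  drop out; their sum is \<open>B\<close>, and as each of them is at least 1, this pays for the
  surplus lost on the right.\<close>

lemma staircase_bound:
  fixes a :: real
  assumes k: "k > 0" and t: "real t < a + 1" and l: "real l \<ge> real (k + 1) * a + real k * (real t - 1) * (a - real t / 2)"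
    and d: "\<delta> < t"
  shows "real k * (\<Sum>j<t - \<delta>. a - real \<delta> - real j) \<le> real l - real \<delta> - a"
proof -
  define B where "B = real \<delta> * a - real \<delta> * (real \<delta> - 1) / 2"
  have n: "real (t - \<delta>) = real t - real \<delta>" using d by simp
  have B: "real \<delta> \<le> B"
  proof (cases "\<delta> = 0")
    case False
    have "real \<delta> \<le> a" using d t by linarith
    then have "real \<delta> * real \<delta> \<le> real \<delta> * a" by (intro mult_left_mono) auto
    moreover have "real \<delta> * 1 \<le> real \<delta> * real \<delta>" using False by (intro mult_left_mono) auto
    ultimately have "real \<delta> * (real \<delta> + 1) / 2 \<le> B" "real \<delta> \<le> real \<delta> * (real \<delta> + 1) / 2"
      unfolding B_def by (simp_all add: field_simps)
    then show ?thesis by linarith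
  qed (simp add: B_def)
  have "1 * B \<le> real k * B" using B k by (intro mult_right_mono) auto
  then have kB: "real \<delta> \<le> real k * B" using B by linarith
  have "real k * (\<Sum>j<t - \<delta>. a - real \<delta> - real j) =
      real k * a + real k * (real t - 1) * (a - real t / 2) - real k * B"
    unfolding sum_arith n B_def by (simp add: field_simps power2_eq_square)
  then show ?thesis using l kB by (simp add: algebra_simps)
qed

section \<open>Density contradiction and return from virtual edges to the given multigraph\<close>

lemma conn_image:
  assumes "\<And>e. e \<in> P \<Longrightarrow> ends' (f e) = ends e"
  shows "edge_ends.conn ends' (f ` P) = edge_ends.conn ends P"
proof -
  have "adj_rel (f ` P) ends' = adj_rel P ends"
    using assms by (fastforce simp: adj_rel_def)
  then show ?thesis unfolding edge_ends.conn_def by simp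
qed

lemma acyc_image:
  assumes ends: "\<And>e. e \<in> P \<Longrightarrow> ends' (f e) = ends e" and inj: "inj f" and ac: "edge_ends.acyc ends' (f ` P)"
  shows "edge_ends.acyc ends P"
  unfolding edge_ends.acyc_def
proof (intro ballI allI impI)
  fix e p q assume e: "e \<in> P" "ends e = {p, q}"
  have "f ` P - {f e} = f ` (P - {e})" using inj by (auto dest: injD)
  moreover have "edge_ends.conn ends' (f ` (P - {e})) = edge_ends.conn ends (P - {e})"
    by (rule conn_image) (use ends in auto)
  moreover have "\<not> edge_ends.conn ends' (f ` P - {f e}) p q"
    by (rule edge_ends.acycD[OF ac]) (use e ends in auto)
  ultimately show "\<not> edge_ends.conn ends (P - {e}) p q" by simp
qed

context multigr
begin

text \<open>Let the n members of a closed list have e + n vertices in total, so that they carry e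
  red edges. The density bound gives e (k + 1) \<le> d (n - 1), while the average of at least d / (k
  + 1) edges per member gives d n \<le> e (k + 1).\<close>

lemma bounded_decomposition:
  assumes E: "E \<subseteq> G" and T0: "trees (Suc k) T0" and d: "d > 0"
    and dens: "\<And>H. H \<subseteq> V \<Longrightarrow> card H \<ge> 2 \<Longrightarrow>
      real (card {e \<in> E. ends e \<subseteq> H}) \<le> (real k + real d / real (d + k + 1)) * (real (card H) - 1)"
    and a: "a = real d / real (k + 1)" and t: "a \<le> real t" "real t < a + 1" and tl: "2 * t \<le> l + 1"
    and ar: "\<And>\<delta>. \<delta> < t \<Longrightarrow> real k * (\<Sum>j<t - \<delta>. a - real \<delta> - real j) \<le> real l - real \<delta> - a"
  obtains T F where "state k E T F" "bounded (l + 1) F"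
proof -
  have "card {e \<in> E. ends e \<subseteq> H} \<le> Suc k * (card H - 1)" if H: "H \<subseteq> V" "card H \<ge> 2" for H
  proof -
    have "real d / real (d + k + 1) \<le> 1" by simp
    then have "(real k + real d / real (d + k + 1)) * (real (card H) - 1) \<le> (real k + 1) * (real (card H) - 1)"
      using H(2) by (intro mult_right_mono) auto
    also have "\<dots> = real (Suc k * (card H - 1))"
    proof -
      have "real (card H) - 1 = real (card H - 1)" using H(2) by simp
      then show ?thesis by (simp only: of_nat_mult of_nat_Suc add.commute)
    qed
    finally have "real (card {e \<in> E. ends e \<subseteq> H}) \<le> real (Suc k * (card H - 1))" using dens[OF H] by linarith
    then show ?thesis by (simp only: of_nat_le_iff)
  qed
  then obtain T1 where T1: "trees (Suc k) T1" "E \<subseteq> (\<Union>i<Suc k. T1 i)"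
    using tree_cover[OF T0 E] by metis
  \<comment> \<open>The real edges of the last tree form the initial red forest; its virtual edges
    are discarded, so red edges are always real.\<close>
  have s0: "state k E T1 (T1 k \<inter> E)"
  proof -
    have "trees k T1" using T1(1) unfolding trees_def by simp
    moreover have "acyc (T1 k \<inter> E)" using acyc_subset[OF treesD(2)[OF T1(1)], of k] by simp
    moreover have "T1 k \<inter> T1 i = {}" if "i < k" for i using treesD(4)[OF T1(1), of k i] that by simp
    then have "(T1 k \<inter> E) \<inter> (\<Union>i<k. T1 i) = {}" by blast
    moreover have "E \<subseteq> (T1 k \<inter> E) \<union> (\<Union>i<k. T1 i)" using T1(2) by (auto simp: lessThan_Suc)
    ultimately show ?thesis unfolding state_def by blast
  qed
  show thesis
  proof (rule ccontr)
    assume "\<not> thesis"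
    then have "\<And>T F. state k E T F \<Longrightarrow> \<not> bounded (l + 1) F" using that by blast
    then obtain r M T F L where M: "l + 1 < M" and o: "optimal r k E M T F L"
      using optimal_exists[OF E s0] by metis
    note D = optimalD[OF o]
    let ?H = "\<Union>(set L)"
    have tM: "2 * t < M" "l + 2 \<le> M" using M tl by auto
    have avg: "a * real (length L) \<le> real (\<Sum>R\<in>set L. card R - 1)"
      by (rule optimal_average[OF o tM(1) t tM(2) ar])
    have cl: "b \<in> E \<and> y \<in> ?H" if "i < k" "arc r (T i) b z y" "z \<in> ?H" for i b z y
      using optimal_arc_real[OF o that] o that unfolding optimal_def by blast
    have c1: "k * (card ?H - 1) + (\<Sum>R\<in>set L. card R - 1) \<le> card {e \<in> E. ends e \<subseteq> ?H}"
      by (rule dense_closure(1)[OF D(3,2,10,4,5,1,7)]) (rule cl; assumption)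
    have c2: "card ?H = (\<Sum>R\<in>set L. card R)"
      by (rule dense_closure(2)[OF D(3,2,10,4,5,1,7)]) (rule cl; assumption)
    have HV: "?H \<subseteq> V" using legal_V[OF D(10,6) treesD(1)[OF D(3)] D(2)] .
    have R1: "comp F r \<in> set L" using legal_nonempty[OF D(10)] hd_in_set by metis
    have finH: "finite ?H" using HV finV finite_subset by blast
    have H2: "card ?H \<ge> 2"
    proof -
      have "card (comp F r) \<le> card ?H" using R1 finH by (intro card_mono) auto
      then show ?thesis using D(11) M by simp
    qed
    have card1: "card C \<ge> 1" if "C \<in> set L" for C
    proof -
      have "C \<noteq> {}" using legal_members[OF D(10) that] by auto
      moreover have "finite C" using finH that by (meson Union_upper finite_subset)
      ultimately show ?thesis by (simp add: Suc_leI card_gt_0_iff)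
    qed
    define e where "e = (\<Sum>R\<in>set L. card R - 1)"
    define n where "n = length L"
    have "(\<Sum>R\<in>set L. card R) = (\<Sum>R\<in>set L. (card R - 1) + 1)"
    proof (rule sum.cong[OF refl])
      fix R assume "R \<in> set L"
      then show "card R = card R - 1 + 1" using card1[of R] by simp
    qed
    also have "\<dots> = e + n"
      unfolding sum.distrib e_def n_def using distinct_card[OF legal_distinct[OF D(10)]] by simp
    finally have h: "card ?H = e + n" using c2 by simp
    have "real k * (real (card ?H) - 1) + real e \<le> real (card {e \<in> E. ends e \<subseteq> ?H})"
    proof -
      have "real (k * (card ?H - 1) + e) \<le> real (card {e \<in> E. ends e \<subseteq> ?H})"
        using c1 unfolding e_def by (simp only: of_nat_le_iff)
      then show ?thesis using H2 by (simp add: of_nat_diff)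
    qed
    also have "\<dots> \<le> (real k + real d / real (d + k + 1)) * (real (card ?H) - 1)" by (rule dens[OF HV H2])
    finally have "real e \<le> real d / real (d + k + 1) * (real (card ?H) - 1)" by (simp add: algebra_simps)
    then have "real e * real (d + k + 1) \<le> real d * (real e + real n - 1)"
      unfolding h by (simp add: field_simps)
    then have 1: "real e * real (k + 1) \<le> real d * (real n - 1)" by (simp add: algebra_simps)
    have "real d * real n \<le> real e * real (k + 1)"
      using avg unfolding a e_def[symmetric] n_def[symmetric] by (simp add: field_simps)
    then have "real d * real n \<le> real d * (real n - 1)" using 1 by linarith
    then show False using d by (simp add: algebra_simps)
  qed
qed

end

lemma frac_arboricity_ge:
  assumes "multigraph V E ends" "H \<subseteq> V" "card H \<ge> 2"
  shows "real (card {e \<in> E. ends e \<subseteq> H}) \<le> frac_arboricity V E ends * (real (card H) - 1)"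
proof -
  let ?S = "{real (card F) / (real (card W) - 1) | W F.
      W \<subseteq> V \<and> F \<subseteq> E \<and> (\<forall>e\<in>F. ends e \<subseteq> W) \<and> card W \<ge> 2}"
  have "?S \<subseteq> (\<lambda>(W, F). real (card F) / (real (card W) - 1)) ` (Pow V \<times> Pow E)" by auto
  moreover have "finite (Pow V \<times> Pow E)" using assms(1) by (simp add: multigraph_def)
  ultimately have "finite ?S" by (meson finite_imageI finite_subset)
  moreover have "real (card {e \<in> E. ends e \<subseteq> H}) / (real (card H) - 1) \<in> ?S"
    using assms(2,3) by blast
  ultimately have "real (card {e \<in> E. ends e \<subseteq> H}) / (real (card H) - 1) \<le> frac_arboricity V E ends"
    unfolding frac_arboricity_def by (rule Max_ge)
  then show ?thesis using assms(3) by (simp add: field_simps)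
qed

lemma forest_decomposition:
  fixes V :: "'v set" and E :: "'e set" and ends :: "'e \<Rightarrow> 'v set"
  assumes G: "multigraph V E ends" and d: "d > 0"
    and fa: "frac_arboricity V E ends \<le> real k + real d / real (d + k + 1)"
    and a: "a = real d / real (k + 1)" and t: "a \<le> real t" "real t < a + 1" and tl: "2 * t \<le> l + 1"
    and ar: "\<And>\<delta>. \<delta> < t \<Longrightarrow> real k * (\<Sum>j<t - \<delta>. a - real \<delta> - real j) \<le> real l - real \<delta> - a"
  shows "\<exists>P :: nat \<Rightarrow> 'e set.
     (\<forall>i\<le>k. \<forall>j\<le>k. i \<noteq> j \<longrightarrow> P i \<inter> P j = {}) \<and> (\<Union>i\<le>k. P i) = E \<and>
     (\<forall>i\<le>k. is_forest (P i) ends) \<and>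
     (\<forall>C\<in>components V (P k) ends. card (comp_edges (P k) ends C) \<le> l)"
proof (cases "V = {}")
  case True
  then have "E = {}" using G by (auto simp: multigraph_def)
  moreover have "is_forest {} ends" by (auto simp: is_forest_def has_cycle_def)
  ultimately show ?thesis using True by (intro exI[of _ "\<lambda>_. {}"]) (simp add: components_def)
next
  case False
  then obtain v0 where v0: "v0 \<in> V" by auto
  have fin: "finite V" "finite E" and endsE: "\<And>e. e \<in> E \<Longrightarrow> ends e \<subseteq> V \<and> card (ends e) = 2"
    using G by (auto simp: multigraph_def)
  define en :: "'e + nat \<times> 'v \<Rightarrow> 'v set" where "en = case_sum ends (\<lambda>(i, v). {v0, v})"
  \<comment> \<open>One star of virtual edges centred at \<open>v0\<close> for each of the
    \<open>k + 1\<close> forests, with tags that keep parallel copies distinct. They provide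
    disjoint spanning trees however sparse the given graph is.\<close>
  define S where "S i = (\<lambda>v. Inr (i, v) :: 'e + nat \<times> 'v) ` (V - {v0})" for i :: nat
  define GG where "GG = Inl ` E \<union> (\<Union>i\<le>k. S i)"
  have MG: "multigr en V GG"
  proof
    show "finite V" by (rule fin)
    show "finite GG" using fin by (auto simp: GG_def S_def)
  next
    fix e assume "e \<in> GG"
    then consider e' where "e' \<in> E" "e = Inl e'" | i v where "v \<in> V" "v0 \<noteq> v" "e = Inr (i, v)"
      by (auto simp: GG_def S_def)
    then have *: "en e \<subseteq> V \<and> card (en e) = 2"
      by cases (use endsE v0 in \<open>simp_all add: en_def\<close>)
    show "en e \<subseteq> V" by (rule conjunct1[OF *])
    show "card (en e) = 2" by (rule conjunct2[OF *])
  qed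
  interpret M: multigr en V GG by (rule MG)
  have star: "M.acyc (S i)" "M.conn (S i) u v0" if "u \<in> V" for i u
  proof -
    show "M.conn (S i) u v0"
    proof (cases "u = v0")
      case False
      show ?thesis
      proof (rule M.conn_edge)
        show "Inr (i, u) \<in> S i" using that False by (simp add: S_def)
        show "en (Inr (i, u)) = {u, v0}" by (simp add: en_def insert_commute)
      qed
    qed simp
    show "M.acyc (S i)"
      unfolding M.acyc_def
    proof (intro ballI allI impI notI)
      fix e p q assume e: "e \<in> S i" "en e = {p, q}" and c: "M.conn (S i - {e}) p q"
      obtain v where v: "e = Inr (i, v)" "v \<noteq> v0" using e(1) by (auto simp: S_def)
      have "{p, q} = {v0, v}" using e(2) v(1) by (simp add: en_def)
      then have "M.conn (S i - {e}) v v0" using c M.conn_sym by (auto simp: doubleton_eq_iff)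
      then have "v0 \<in> {v}"
        by (rule M.conn_closed) (use v in \<open>auto simp: S_def en_def doubleton_eq_iff\<close>)
      then show False using v by simp
    qed
  qed
  have T0: "M.trees (Suc k) S"
  proof -
    have "S i \<subseteq> GG" if "i < Suc k" for i using that by (auto simp: GG_def)
    moreover have "M.conn (S i) u v" if "u \<in> V" "v \<in> V" for i u v
      using star(2) that M.conn_sym M.conn_trans by meson
    moreover have "S i \<inter> S j = {}" if "i \<noteq> j" for i j using that by (auto simp: S_def)
    ultimately show ?thesis unfolding M.trees_def using star(1)[OF v0] by blast
  qed
  have dens: "real (card {e \<in> Inl ` E. en e \<subseteq> H}) \<le> (real k + real d / real (d + k + 1)) * (real (card H) - 1)"
    if H: "H \<subseteq> V" "card H \<ge> 2" for H
  proof -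
    have "{e \<in> Inl ` E. en e \<subseteq> H} = Inl ` {e \<in> E. ends e \<subseteq> H}" by (auto simp: en_def)
    then have "card {e \<in> Inl ` E. en e \<subseteq> H} = card {e \<in> E. ends e \<subseteq> H}" by (simp add: card_image)
    moreover have "frac_arboricity V E ends * (real (card H) - 1) \<le> (real k + real d / real (d + k + 1)) * (real (card H) - 1)"
      using fa H(2) by (intro mult_right_mono) auto
    ultimately show ?thesis using frac_arboricity_ge[OF G H] by linarith
  qed
  have EG: "Inl ` E \<subseteq> GG" by (simp add: GG_def)
  \<comment> \<open>Bounds on red components count vertices, hence \<open>l + 1\<close> for a tree
    with at most \<open>l\<close> edges.\<close>
  obtain T F where st: "M.state k (Inl ` E) T F" and bd: "M.bounded (l + 1) F"
    using M.bounded_decomposition[OF EG T0 d dens a t tl ar] by blast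
  define P where "P i = {e \<in> E. Inl e \<in> (if i < k then T i else F)}" for i
  have T: "M.trees k T" and F: "M.acyc F" "F \<subseteq> Inl ` E" "F \<inter> (\<Union>i<k. T i) = {}" "Inl ` E \<subseteq> F \<union> (\<Union>i<k. T i)"
    using st by (auto simp: M.state_def)
  have Pk: "Inl ` P k = F" using F(2) by (auto simp: P_def)
  have acP: "edge_ends.acyc ends (P i)" if "i \<le> k" for i
  proof (rule acyc_image[where f = Inl and ends' = en])
    have "M.acyc (if i < k then T i else F)" using M.treesD(2)[OF T] F(1) by simp
    then show "M.acyc (Inl ` P i)" by (rule M.acyc_subset) (auto simp: P_def)
  qed (auto simp: en_def)
  have dj: "P i \<inter> P j = {}" if "i \<le> k" "j \<le> k" "i \<noteq> j" for i j
  proof -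
    have FT: "F \<inter> T i = {}" if "i < k" for i using F(3) that by blast
    have "(if i < k then T i else F) \<inter> (if j < k then T j else F) = {}"
    proof (cases "i < k"; cases "j < k")
      assume "i < k" "j < k"
      then show ?thesis using M.treesD(4)[OF T _ _ that(3)] by simp
    next
      assume "i < k" "\<not> j < k"
      then show ?thesis using FT[of i] by (simp add: Int_commute)
    next
      assume "\<not> i < k" "j < k"
      then show ?thesis using FT[of j] by simp
    qed (use that in simp)
    then show ?thesis unfolding P_def by blast
  qed
  have un: "(\<Union>i\<le>k. P i) = E"
  proof
    show "E \<subseteq> (\<Union>i\<le>k. P i)"
    proof
      fix e assume e: "e \<in> E"
      then consider "Inl e \<in> F" | i where "i < k" "Inl e \<in> T i" using F(4) by auto
      then show "e \<in> (\<Union>i\<le>k. P i)"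
      proof cases
        case 1
        then show ?thesis using e by (intro UN_I[of k]) (auto simp: P_def)
      next
        case 2
        then show ?thesis using e by (intro UN_I[of i]) (auto simp: P_def)
      qed
    qed
  qed (auto simp: P_def)
  have "card (comp_edges (P k) ends C) \<le> l" if C: "C \<in> components V (P k) ends" for C
  proof -
    obtain v where v: "v \<in> V" "C = {u \<in> V. (v, u) \<in> (adj_rel (P k) ends)\<^sup>*}"
      using C by (auto simp: components_def)
    have cc: "edge_ends.conn ends (P k) = M.conn F"
      using conn_image[of "P k" en Inl ends] Pk by (simp add: en_def)
    then have "edge_ends.comp ends (P k) v = M.comp F v"
      unfolding edge_ends.comp_def by simp
    moreover have "M.comp F v \<subseteq> V" using M.comp_V[OF _ v(1)] F(2) EG by blast
    moreover have "C = V \<inter> edge_ends.comp ends (P k) v"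
      unfolding v(2) edge_ends.comp_def edge_ends.conn_def by auto
    ultimately have CC: "C = edge_ends.comp ends (P k) v" "C = M.comp F v" by auto
    have "card C \<le> l + 1" using bd v(1) CC(2) by (simp add: M.bounded_def)
    moreover have "card {e \<in> P k. ends e \<subseteq> C} \<le> card C - 1"
    proof -
      have "finite (edge_ends.comp ends (P k) v)"
        unfolding CC(1)[symmetric] v(2) using fin(1) by simp
      moreover have "card (ends e) = 2" if "e \<in> P k" for e using that endsE by (simp add: P_def)
      ultimately show ?thesis
        unfolding CC(1) using edge_ends.card_edges_comp_le[OF acP[OF order_refl], of v] by blast
    qed
    ultimately show ?thesis by (simp add: comp_edges_def)
  qed
  then show ?thesis
    using dj un edge_ends.acyc_imp_is_forest[OF acP] by (intro exI[of _ P]) blast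
qed

theorem theorem1p6:
  fixes V :: "'v set" and E :: "'e set" and ends :: "'e \<Rightarrow> 'v set" and d k :: nat
  assumes "multigraph V E ends"
    and "d > 0" and "k > 0"
    and "frac_arboricity V E ends \<le> real k + real d / real (d + k + 1)"
  shows "\<exists>P :: nat \<Rightarrow> 'e set.
     (\<forall>i\<le>k. \<forall>j\<le>k. i \<noteq> j \<longrightarrow> P i \<inter> P j = {}) \<and>
     (\<Union>i\<le>k. P i) = E \<and>
     (\<forall>i\<le>k. is_forest (P i) ends) \<and>
     (\<exists>i\<le>k. \<forall>C\<in>components V (P i) ends.
        int (card (comp_edges (P i) ends C)) \<le>
          int d + \<lceil>real k * (real_of_int \<lceil>real d / real (k + 1)\<rceil> - 1) *
                   (real d / real (k + 1) - real_of_int \<lceil>real d / real (k + 1)\<rceil> / 2)\<rceil>)"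
proof -
  define a where "a = real d / real (k + 1)"
  define t where "t = nat \<lceil>a\<rceil>"
  have apos: "a > 0" using assms(2) by (simp add: a_def)
  have ct: "\<lceil>a\<rceil> = int t" using apos by (simp add: t_def)
  have t: "a \<le> real t" "real t < a + 1" using ct by linarith+
  have t1: "1 \<le> t" using t(1) apos by linarith
  define x where "x = real k * (real t - 1) * (a - real t / 2)"
  have x0: "0 \<le> x"
  proof (cases "t = 1")
    case False
    then have "real t \<ge> 2" using t1 by linarith
    then have "a - real t / 2 \<ge> 0" "real t - 1 \<ge> 0" using t(2) by linarith+
    then show ?thesis by (simp add: x_def)
  qed (simp add: x_def)
  define l where "l = d + nat \<lceil>x\<rceil>"
  have il: "int l = int d + \<lceil>x\<rceil>" using x0 by (simp add: l_def)
  have da: "real d = real (k + 1) * a" by (simp add: a_def)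
  have rl: "real l \<ge> real (k + 1) * a + x"
  proof -
    have "real_of_int (int l) \<ge> real d + x" unfolding il by simp
    then show ?thesis using da by simp
  qed
  \<comment> \<open>As \<open>k\<close> is at least 1, 2 (t - 1) \<le> (k + 1) (t - 1) < (k + 1) a =
    d. This yields \<open>2 * t < M\<close> for every oversized \<open>M\<close>, so that two pieces
    of one \<open>K\<close> with small components attached cannot both reach size
    \<open>M\<close>.\<close>
  have tl: "2 * t \<le> l + 1"
  proof -
    have "2 * (real t - 1) \<le> real (k + 1) * (real t - 1)"
      using assms(3) t1 by (intro mult_right_mono) auto
    also have "\<dots> < real (k + 1) * a" using t(2) by (intro mult_strict_left_mono) auto
    finally have "2 * real t < real d + 2" using da by simp
    then have "2 * t < d + 2" by linarith
    then show ?thesis by (simp add: l_def)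
  qed
  obtain P :: "nat \<Rightarrow> 'e set" where P: "\<forall>i\<le>k. \<forall>j\<le>k. i \<noteq> j \<longrightarrow> P i \<inter> P j = {}" "(\<Union>i\<le>k. P i) = E"
     "\<forall>i\<le>k. is_forest (P i) ends" "\<forall>C\<in>components V (P k) ends. card (comp_edges (P k) ends C) \<le> l"
    using forest_decomposition[OF assms(1,2,4) a_def t tl
        staircase_bound[OF assms(3) t(2) rl[unfolded x_def]]] by blast
  have "int (card (comp_edges (P k) ends C)) \<le> int d + \<lceil>x\<rceil>" if "C \<in> components V (P k) ends" for C
    using P(4) that unfolding il[symmetric] by simp
  then show ?thesis
    using P(1-3) unfolding a_def[symmetric] ct x_def by (intro exI[of _ P]) (auto intro!: exI[of _ k])
qed

end
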